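(* Let $V$ be a $U$-module. Then $V$ is a Whittaker module (of type $\eta$) if and only if $$V\cong U\otimes_{Z(U)\otimes U_q(E)}\bigl(Z(U)/Z_{\ast}\bigr)_{\eta}$$ for some ideal $Z_{\ast}$ of $Z(U)$. In particular, in such a case the ideal $Z_{\ast}$ is uniquely determined to be $Z_V$.
   Context: Let $q\in\mathbb{C}$ with $q\neq 0$ and $q^{2}\neq 1$, and let $m\in\mathbb{N}$. Put $f_m(K)=\frac{K^{m}-K^{-m}}{q-q^{-1}}$. $U=U_q(f_m(K))$ is the associative unital $\mathbb{C}$-algebra generated by $E,F,K^{\pm1}$ with relations $KE=q^{2}EK$, $KF=q^{-2}FK$, $KK^{-1}=K^{-1}K=1$, $EF-FE=f_m(K)$; $Z(U)$ is its center. $U_q(E)$ is the subalgebra of $U$ generated by $E$. Fix a non-singular character of $U_q(E)$, that is, an algebra homomorphism $\eta\colon U_q(E)\to\mathbb{C}$ with $\eta(E)\neq 0$. In a left $U$-module $V$, a vector $0\neq v\in V$ is a Whittaker vector of type $\eta$ if $Ev=\eta(E)v$; if moreover $V=Uv$, then $V$ is called a Whittaker module of type $\eta$ and $v$ a cyclic Whittaker vector. For a $U$-module $V$, $Z_V$ is the intersection of $Z(U)$ with the annihilator of $V$ in $U$, i.e. $Z_V=\{z\in Z(U): zV=0\}$. For an ideal $Z_\ast$ of $Z(U)$, $(Z(U)/Z_\ast)_\eta$ is the $Z(U)\otimes U_q(E)$-module with underlying space $Z(U)/Z_\ast$ on which $Z(U)$ acts by multiplication and $U_q(E)$ acts through the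 character $\eta$; $Z(U)\otimes U_q(E)$ acts on $U$ on the right by multiplication.
   Formalization: Assumes q is not a root of unity: otherwise the claim fails (q a primitive cube root of 1, m=1: E³ is central and E³−η(E)³ kills the module induced from Z_*=0). In the equivalence Z_* is a proper ideal, since Z_*=Z(U) gives the zero module. *)

theory Defs
  imports Complex_Main "HOL-Algebra.Algebra" "HOL-Algebra.Algebraic_Closure_Type"
    "HOL-Library.Poly_Mapping"
begin

section \<open>Modules over a possibly noncommutative ring\<close>

text \<open>
  The locale \<^locale>\<open>module\<close> of the library requires a commutative ring of scalars. As there,
  the fields \<^const>\<open>monoid.mult\<close> and \<^const>\<open>monoid.one\<close> of a \<^type>\<open>module\<close> record are
  meaningless for a module.
\<close>

locale left_module = R?: ring R + M?: abelian_group M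
  for R :: "('r, 'a) ring_scheme" (structure) and M :: "('r, 'v, 'b) module_scheme" (structure) +
  assumes smult_closed [simp, intro]:
      "\<lbrakk>a \<in> carrier R; x \<in> carrier M\<rbrakk> \<Longrightarrow> a \<odot>\<^bsub>M\<^esub> x \<in> carrier M"
    and smult_l_distr:
      "\<lbrakk>a \<in> carrier R; b \<in> carrier R; x \<in> carrier M\<rbrakk> \<Longrightarrow>
        (a \<oplus>\<^bsub>R\<^esub> b) \<odot>\<^bsub>M\<^esub> x = a \<odot>\<^bsub>M\<^esub> x \<oplus>\<^bsub>M\<^esub> b \<odot>\<^bsub>M\<^esub> x"
    and smult_r_distr:
      "\<lbrakk>a \<in> carrier R; x \<in> carrier M; y \<in> carrier M\<rbrakk> \<Longrightarrow>
        a \<odot>\<^bsub>M\<^esub> (x \<oplus>\<^bsub>M\<^esub> y) = a \<odot>\<^bsub>M\<^esub> x \<oplus>\<^bsub>M\<^esub> a \<odot>\<^bsub>M\<^esub> y"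
    and smult_assoc:
      "\<lbrakk>a \<in> carrier R; b \<in> carrier R; x \<in> carrier M\<rbrakk> \<Longrightarrow>
        (a \<otimes>\<^bsub>R\<^esub> b) \<odot>\<^bsub>M\<^esub> x = a \<odot>\<^bsub>M\<^esub> (b \<odot>\<^bsub>M\<^esub> x)"
    and smult_one [simp]: "x \<in> carrier M \<Longrightarrow> \<one>\<^bsub>R\<^esub> \<odot>\<^bsub>M\<^esub> x = x"

definition module_isomorphic ::
  "('r, 'a) ring_scheme \<Rightarrow> ('r, 'v, 'b) module_scheme \<Rightarrow> ('r, 'w, 'c) module_scheme \<Rightarrow> bool" where
  "module_isomorphic R V W \<longleftrightarrow>
    (\<exists>\<phi>. bij_betw \<phi> (carrier V) (carrier W) \<and>
      (\<forall>x\<in>carrier V. \<forall>y\<in>carrier V. \<phi> (x \<oplus>\<^bsub>V\<^esub> y) = \<phi> x \<oplus>\<^bsub>W\<^esub> \<phi> y) \<and>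
      (\<forall>r\<in>carrier R. \<forall>x\<in>carrier V. \<phi> (r \<odot>\<^bsub>V\<^esub> x) = r \<odot>\<^bsub>W\<^esub> \<phi> x))"

definition ring_center :: "('r, 'a) ring_scheme \<Rightarrow> 'r set" where
  "ring_center R = {z \<in> carrier R. \<forall>x\<in>carrier R. z \<otimes>\<^bsub>R\<^esub> x = x \<otimes>\<^bsub>R\<^esub> z}"


section \<open>Tensor products\<close>

text \<open>
  \<open>M \<otimes> N\<close> over a ring with carrier \<open>S\<close>, where \<open>ra x s\<close> is a right action on \<open>M\<close> and
  \<open>la s y\<close> a left action on \<open>N\<close>: the free abelian group on \<open>M \<times> N\<close> modulo the subgroup
  generated by the biadditivity and balancing relators. Its elements are cosets of finite formal
  sums \<open>\<Sum> n\<^sub>i (x\<^sub>i, y\<^sub>i)\<close> with \<open>n\<^sub>i\<close> integers.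
\<close>

definition tensor_relators ::
  "'s set \<Rightarrow> ('x, 'a) ring_scheme \<Rightarrow> ('x \<Rightarrow> 's \<Rightarrow> 'x) \<Rightarrow> ('y, 'b) ring_scheme \<Rightarrow> ('s \<Rightarrow> 'y \<Rightarrow> 'y)
    \<Rightarrow> ('x \<times> 'y \<Rightarrow>\<^sub>0 int) set" where
  "tensor_relators S M ra N la =
     {frag_of (x \<oplus>\<^bsub>M\<^esub> x', y) - frag_of (x, y) - frag_of (x', y) | x x' y.
        x \<in> carrier M \<and> x' \<in> carrier M \<and> y \<in> carrier N}
   \<union> {frag_of (x, y \<oplus>\<^bsub>N\<^esub> y') - frag_of (x, y) - frag_of (x, y') | x y y'.
        x \<in> carrier M \<and> y \<in> carrier N \<and> y' \<in> carrier N}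
   \<union> {frag_of (ra x s, y) - frag_of (x, la s y) | x s y.
        x \<in> carrier M \<and> s \<in> S \<and> y \<in> carrier N}"

definition tensor_kernel ::
  "'s set \<Rightarrow> ('x, 'a) ring_scheme \<Rightarrow> ('x \<Rightarrow> 's \<Rightarrow> 'x) \<Rightarrow> ('y, 'b) ring_scheme \<Rightarrow> ('s \<Rightarrow> 'y \<Rightarrow> 'y)
    \<Rightarrow> ('x \<times> 'y \<Rightarrow>\<^sub>0 int) set" where
  "tensor_kernel S M ra N la =
     generate (free_Abelian_group (carrier M \<times> carrier N)) (tensor_relators S M ra N la)"

definition tensor_coset ::
  "'s set \<Rightarrow> ('x, 'a) ring_scheme \<Rightarrow> ('x \<Rightarrow> 's \<Rightarrow> 'x) \<Rightarrow> ('y, 'b) ring_scheme \<Rightarrow> ('s \<Rightarrow> 'y \<Rightarrow> 'y)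
    \<Rightarrow> ('x \<times> 'y \<Rightarrow>\<^sub>0 int) \<Rightarrow> ('x \<times> 'y \<Rightarrow>\<^sub>0 int) set" where
  "tensor_coset S M ra N la p =
     tensor_kernel S M ra N la #>\<^bsub>free_Abelian_group (carrier M \<times> carrier N)\<^esub> p"

definition tensor_group ::
  "'s set \<Rightarrow> ('x, 'a) ring_scheme \<Rightarrow> ('x \<Rightarrow> 's \<Rightarrow> 'x) \<Rightarrow> ('y, 'b) ring_scheme \<Rightarrow> ('s \<Rightarrow> 'y \<Rightarrow> 'y)
    \<Rightarrow> ('x \<times> 'y \<Rightarrow>\<^sub>0 int) set monoid" where
  "tensor_group S M ra N la =
     free_Abelian_group (carrier M \<times> carrier N) Mod tensor_kernel S M ra N la"

text \<open>
  If \<open>M\<close> is moreover a left module over some ring, acting by \<open>lu\<close> and commuting with \<open>ra\<close>, then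
  so is \<open>M \<otimes> N\<close>, with \<open>u (x \<otimes> y) = (u x) \<otimes> y\<close>. The action is defined on cosets through all
  representatives, in the manner of \<^const>\<open>rcoset_mult\<close>.
\<close>

definition tensor_module ::
  "('u \<Rightarrow> 'x \<Rightarrow> 'x) \<Rightarrow> 's set \<Rightarrow> ('x, 'a) ring_scheme \<Rightarrow> ('x \<Rightarrow> 's \<Rightarrow> 'x) \<Rightarrow> ('y, 'b) ring_scheme
    \<Rightarrow> ('s \<Rightarrow> 'y \<Rightarrow> 'y) \<Rightarrow> ('u, ('x \<times> 'y \<Rightarrow>\<^sub>0 int) set) module" where
  "tensor_module lu S M ra N la =
     \<lparr>carrier = carrier (tensor_group S M ra N la),
      monoid.mult = (\<lambda>_ _. undefined), one = undefined,
      ring.zero = \<one>\<^bsub>tensor_group S M ra N la\<^esub>,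
      add = monoid.mult (tensor_group S M ra N la),
      module.smult = (\<lambda>u P. \<Union>p\<in>P. tensor_coset S M ra N la
                 (frag_extend (\<lambda>(x, y). frag_of (lu u x, y)) p))\<rparr>"

text \<open>
  The complex algebra \<open>A \<otimes> B\<close>, with \<open>(a \<otimes> b) (c \<otimes> d) = (a c) \<otimes> (b d)\<close>, for complex algebras
  \<open>A\<close> and \<open>B\<close> given as rings with structure maps \<open>\<iota>A\<close> and \<open>\<iota>B\<close> from \<open>\<complex>\<close> to their centers.
\<close>

definition tensor_algebra ::
  "(complex \<Rightarrow> 'a) \<Rightarrow> ('a, 'm) ring_scheme \<Rightarrow> (complex \<Rightarrow> 'b) \<Rightarrow> ('b, 'n) ring_scheme
    \<Rightarrow> ('a \<times> 'b \<Rightarrow>\<^sub>0 int) set ring" where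
  "tensor_algebra \<iota>A A \<iota>B B =
     (let ra = (\<lambda>a c. \<iota>A c \<otimes>\<^bsub>A\<^esub> a); la = (\<lambda>c b. \<iota>B c \<otimes>\<^bsub>B\<^esub> b);
          T = tensor_group UNIV A ra B la;
          cl = tensor_coset UNIV A ra B la
      in \<lparr>carrier = carrier T,
          monoid.mult = (\<lambda>P Q. \<Union>p\<in>P. \<Union>q\<in>Q.
             cl (frag_extend (\<lambda>(a, b).
                   frag_extend (\<lambda>(c, d). frag_of (a \<otimes>\<^bsub>A\<^esub> c, b \<otimes>\<^bsub>B\<^esub> d)) q) p)),
          one = cl (frag_of (\<one>\<^bsub>A\<^esub>, \<one>\<^bsub>B\<^esub>)),
          ring.zero = \<one>\<^bsub>T\<^esub>,
          add = monoid.mult T\<rparr>)"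

text \<open>
  The additive map \<open>x \<otimes> y \<mapsto> f (x, y)\<close> from a tensor product to \<open>G\<close>, for \<open>f\<close> biadditive and
  balanced; for such \<open>f\<close> all representatives of a coset have the same value, so that
  \<^const>\<open>the_elem\<close> is applied to a singleton.
\<close>

definition tensor_lift ::
  "('g, 'a) ring_scheme \<Rightarrow> ('x \<times> 'y \<Rightarrow> 'g) \<Rightarrow> ('x \<times> 'y \<Rightarrow>\<^sub>0 int) set \<Rightarrow> 'g" where
  "tensor_lift G f P =
     the_elem ((\<lambda>p. \<Oplus>\<^bsub>G\<^esub>s\<in>Poly_Mapping.keys p. [Poly_Mapping.lookup p s] \<cdot>\<^bsub>G\<^esub> f s) ` P)"


section \<open>The algebra \<open>U\<^sub>q(f\<^sub>m(K))\<close>\<close>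

datatype generator = GE | GF | GK | GKinv

text \<open>
  The free monoid on the generators, written additively because the convolution product of
  \<^type>\<open>poly_mapping\<close> expects an additive monoid of exponents.
\<close>

datatype monomial = Monomial (letters: "generator list")

instantiation monomial :: monoid_add
begin
definition zero_monomial :: monomial where "0 = Monomial []"
definition plus_monomial :: "monomial \<Rightarrow> monomial \<Rightarrow> monomial" where
  "v + w = Monomial (letters v @ letters w)"
instance by standard (simp_all add: zero_monomial_def plus_monomial_def)
end

type_synonym free_alg = "monomial \<Rightarrow>\<^sub>0 complex"
type_synonym uq = "free_alg set"

definition gen :: "generator \<Rightarrow> free_alg" where
  "gen g = Poly_Mapping.single (Monomial [g]) 1"

definition const :: "complex \<Rightarrow> free_alg" where
  "const c = Poly_Mapping.single 0 c"

definition f_poly :: "complex \<Rightarrow> nat \<Rightarrow> free_alg" where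
  "f_poly q m = const (1 / (q - inverse q)) * (gen GK ^ m - gen GKinv ^ m)"

definition uq_relators :: "complex \<Rightarrow> nat \<Rightarrow> free_alg set" where
  "uq_relators q m =
     {gen GK * gen GE - const (q^2) * gen GE * gen GK,
      gen GK * gen GF - const (inverse (q^2)) * gen GF * gen GK,
      gen GK * gen GKinv - 1,
      gen GKinv * gen GK - 1,
      gen GE * gen GF - gen GF * gen GE - f_poly q m}"

definition uq_ideal :: "complex \<Rightarrow> nat \<Rightarrow> free_alg set" where
  "uq_ideal q m = genideal ring_of_type_algebra (uq_relators q m)"

definition Uq :: "complex \<Rightarrow> nat \<Rightarrow> uq ring" where
  "Uq q m = ring_of_type_algebra Quot uq_ideal q m"

definition uq_class :: "complex \<Rightarrow> nat \<Rightarrow> free_alg \<Rightarrow> uq" where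
  "uq_class q m x = uq_ideal q m +>\<^bsub>ring_of_type_algebra\<^esub> x"

definition uq_E :: "complex \<Rightarrow> nat \<Rightarrow> uq" where
  "uq_E q m = uq_class q m (gen GE)"

definition uq_scalar :: "complex \<Rightarrow> nat \<Rightarrow> complex \<Rightarrow> uq" where
  "uq_scalar q m c = uq_class q m (const c)"

definition ZU :: "complex \<Rightarrow> nat \<Rightarrow> uq ring" where
  "ZU q m = (Uq q m)\<lparr>carrier := ring_center (Uq q m)\<rparr>"

text \<open>The subring generated by \<open>E\<close> and the scalars, i.e. the subalgebra generated by \<open>E\<close>.\<close>

definition UqE :: "complex \<Rightarrow> nat \<Rightarrow> uq ring" where
  "UqE q m = (Uq q m)\<lparr>carrier :=
     generate_ring (Uq q m) (insert (uq_E q m) (range (uq_scalar q m)))\<rparr>"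


section \<open>Whittaker modules\<close>

definition nonsingular_character :: "complex \<Rightarrow> nat \<Rightarrow> (uq \<Rightarrow> complex) \<Rightarrow> bool" where
  "nonsingular_character q m \<eta> \<longleftrightarrow>
     \<eta> \<in> ring_hom (UqE q m) ring_of_type_algebra \<and>
     (\<forall>c. \<eta> (uq_scalar q m c) = c) \<and>
     \<eta> (uq_E q m) \<noteq> 0"

definition whittaker_vector ::
  "complex \<Rightarrow> nat \<Rightarrow> (uq \<Rightarrow> complex) \<Rightarrow> (uq, 'v, 'b) module_scheme \<Rightarrow> 'v \<Rightarrow> bool" where
  "whittaker_vector q m \<eta> V v \<longleftrightarrow>
     v \<in> carrier V \<and> v \<noteq> \<zero>\<^bsub>V\<^esub> \<and>
     uq_E q m \<odot>\<^bsub>V\<^esub> v = uq_scalar q m (\<eta> (uq_E q m)) \<odot>\<^bsub>V\<^esub> v"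

definition whittaker_module ::
  "complex \<Rightarrow> nat \<Rightarrow> (uq \<Rightarrow> complex) \<Rightarrow> (uq, 'v, 'b) module_scheme \<Rightarrow> bool" where
  "whittaker_module q m \<eta> V \<longleftrightarrow>
     (\<exists>v. whittaker_vector q m \<eta> V v \<and> carrier V = {u \<odot>\<^bsub>V\<^esub> v | u. u \<in> carrier (Uq q m)})"

definition central_annihilator :: "complex \<Rightarrow> nat \<Rightarrow> (uq, 'v, 'b) module_scheme \<Rightarrow> uq set" where
  "central_annihilator q m V =
     {z \<in> ring_center (Uq q m). \<forall>v\<in>carrier V. z \<odot>\<^bsub>V\<^esub> v = \<zero>\<^bsub>V\<^esub>}"

definition ZU_UqE :: "complex \<Rightarrow> nat \<Rightarrow> (uq \<times> uq \<Rightarrow>\<^sub>0 int) set ring" where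
  "ZU_UqE q m = tensor_algebra (uq_scalar q m) (ZU q m) (uq_scalar q m) (UqE q m)"

text \<open>\<open>u (z \<otimes> e) = u z e\<close>\<close>

definition ZU_UqE_right ::
  "complex \<Rightarrow> nat \<Rightarrow> uq \<Rightarrow> (uq \<times> uq \<Rightarrow>\<^sub>0 int) set \<Rightarrow> uq" where
  "ZU_UqE_right q m u t = tensor_lift (Uq q m) (\<lambda>(z, e). u \<otimes>\<^bsub>Uq q m\<^esub> z \<otimes>\<^bsub>Uq q m\<^esub> e) t"

text \<open>
  The module \<open>(Z(U)/Z\<^sub>*)\<^sub>\<eta>\<close>, where \<open>(z \<otimes> e) w = z (\<eta>(e) w)\<close>; the complex number \<open>\<eta>(e)\<close> acts as
  multiplication by the class of the corresponding scalar of \<open>U\<close>.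
\<close>

definition ZU_quot ::
  "complex \<Rightarrow> nat \<Rightarrow> (uq \<Rightarrow> complex) \<Rightarrow> uq set \<Rightarrow> ((uq \<times> uq \<Rightarrow>\<^sub>0 int) set, uq set) module" where
  "ZU_quot q m \<eta> Zs = (let Q = ZU q m Quot Zs in
     \<lparr>carrier = carrier Q, monoid.mult = monoid.mult Q, one = \<one>\<^bsub>Q\<^esub>, ring.zero = \<zero>\<^bsub>Q\<^esub>, add = add Q,
      module.smult = (\<lambda>t w. tensor_lift Q
        (\<lambda>(z, e). (Zs +>\<^bsub>ZU q m\<^esub> z) \<otimes>\<^bsub>Q\<^esub> ((Zs +>\<^bsub>ZU q m\<^esub> uq_scalar q m (\<eta> e)) \<otimes>\<^bsub>Q\<^esub> w)) t)\<rparr>)"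

definition induced_module ::
  "complex \<Rightarrow> nat \<Rightarrow> (uq \<Rightarrow> complex) \<Rightarrow> uq set \<Rightarrow> (uq, (uq \<times> uq set \<Rightarrow>\<^sub>0 int) set) module" where
  "induced_module q m \<eta> Zs =
     tensor_module (monoid.mult (Uq q m)) (carrier (ZU_UqE q m))
       (Uq q m) (ZU_UqE_right q m) (ZU_quot q m \<eta> Zs) (module.smult (ZU_quot q m \<eta> Zs))"

end

theory Submission
  imports Defs
begin

text \<open>
  Let \<open>h = \<eta>(E) \<noteq> 0\<close>. The proof rests on the Casimir element \<open>\<Omega> = F E + g(K)\<close>, where
  \<open>g(K) = \<alpha> K\<^sup>m + \<beta> K\<^sup>-\<^sup>m\<close> is chosen with \<open>f\<^sub>m(K) = g(K) - g(q\<^sup>-\<^sup>2 K)\<close>. Then also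
  \<open>\<Omega> = E F + g(q\<^sup>-\<^sup>2 K)\<close>, and \<open>\<Omega>\<close> is central (\<open>casimir_central\<close>).

  On a vector \<open>v\<close> with \<open>E v = h v\<close> the generator \<open>F\<close> can be eliminated:
  \<open>h F v = F E v = (\<Omega> - g(K)) v\<close>. Hence \<open>U v\<close> is spanned by the vectors \<open>K\<^sup>b p(\<Omega>) v\<close> with
  \<open>b\<close> an integer and \<open>p\<close> a polynomial (\<open>whittaker_reduction\<close>). Such a vector is an eigenvector
  of \<open>E\<close> with eigenvalue \<open>q\<^sup>-\<^sup>2\<^sup>b h\<close>, and these eigenvalues are pairwise distinct because \<open>q\<close> is
  not a root of unity. If therefore \<open>\<Sum>\<^sub>b K\<^sup>b p\<^sub>b(\<Omega>) v = 0\<close>, then every \<open>K\<^sup>b p\<^sub>b(\<Omega>) v\<close>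
  vanishes, so that \<open>p\<^sub>b(\<Omega>) v = 0\<close> because \<open>K\<close> is invertible (\<open>whittaker_annihilator\<close>).
  The annihilator of \<open>v\<close> is thus generated by \<open>E - h\<close> and by central elements, and the latter
  annihilate all of \<open>V = U v\<close>. This says that the map \<open>u \<otimes> z \<mapsto> u z v\<close> from the module induced
  from \<open>Z\<^sub>V\<close> to \<open>V\<close> is injective (\<open>induced_iso\<close>).

  Conversely, the module induced from an ideal \<open>Z\<^sub>*\<close> is generated by \<open>1 \<otimes> 1\<close>, on which \<open>E\<close>
  acts by \<open>h\<close>. What has to be excluded is that the tensor product collapses: \<open>z (1 \<otimes> 1) = 0\<close>
  must force \<open>z \<in> Z\<^sub>*\<close> (\<open>pure_tensor_eq_zero_iff\<close>). This yields both \<open>1 \<otimes> 1 \<noteq> 0\<close> for a proper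
  ideal and the uniqueness of \<open>Z\<^sub>*\<close>. The tool is an explicit model of \<open>U / U (E - h)\<close> on
  families of polynomials indexed by the integers, on which \<open>\<Omega>\<close> acts as multiplication by the
  indeterminate (\<open>whittaker_act\<close>). Taking the coefficient of the generator in this model is a
  \<open>Z(U)\<close>-linear retraction of \<open>U\<close> onto its centre that is balanced over \<open>U\<^sub>q(E)\<close>.

  For the retraction to land in the centre and to be the identity there, the centre must be
  exactly \<open>\<complex>[\<Omega>]\<close> (\<open>central_imp_casimir_poly\<close>). Indeed \<open>U\<close> decomposes into eigenspaces for
  conjugation by \<open>K\<close>, and the elements of weight one are the sums of \<open>K\<^sup>b p\<^sub>b(\<Omega>)\<close>. Such a sum
  commutes with \<open>E\<close> only if the terms with \<open>b \<noteq> 0\<close> act by zero on the model.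
\<close>


section \<open>The free algebra\<close>

lemma free_alg_single_induct:
  fixes x :: free_alg
  assumes "P 0" "\<And>x y. P x \<Longrightarrow> P y \<Longrightarrow> P (x + y)"
    and "\<And>w c. P (Poly_Mapping.single w c)"
  shows "P x"
proof (induction x rule: update_induct)
  case const
  show ?case by (rule assms(1))
next
  case (update f a b)
  have "Poly_Mapping.update a b f = f + Poly_Mapping.single a b"
    using update(1)
    by (intro poly_mapping_eqI)
      (auto simp: lookup_update lookup_add lookup_single when_def in_keys_iff)
  then show ?case using assms(2)[OF update(3) assms(3)] by simp
qed

lemma const_mult: "const (c * d) = const c * const d"
  by (simp add: const_def mult_single)

lemma const_add: "const (c + d) = const c + const d"
  by (simp add: const_def single_add)

lemma const_minus: "const (- c) = - const c"
  by (simp add: const_def single_uminus)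

lemma const_diff: "const (c - d) = const c - const d"
  by (simp add: const_def single_diff)

lemma const_0 [simp]: "const 0 = 0"
  by (simp add: const_def)

lemma const_1 [simp]: "const 1 = 1"
  by (simp add: const_def)

lemma const_mult_assoc: "const c * (const d * x) = const (c * d) * x"
  by (simp add: const_mult mult.assoc)

lemma const_commute: "x * const c = const c * x"
  by (induction x rule: free_alg_single_induct)
    (simp_all add: const_def mult_single algebra_simps)

lemma const_left_commute: "x * (const c * y) = const c * (x * y)"
  by (metis const_commute mult.assoc)

text \<open>
  This is how spanning sets of \<open>U\<close> are obtained: it suffices that they contain \<open>1\<close> and are
  stable under left multiplication by single letters.
\<close>

lemma free_alg_induct [case_names one add const gen]:
  assumes "P 1" "\<And>x y. P x \<Longrightarrow> P y \<Longrightarrow> P (x + y)"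
    and "\<And>c x. P x \<Longrightarrow> P (const c * x)"
    and "\<And>g x. P x \<Longrightarrow> P (gen g * x)"
  shows "P (x :: free_alg)"
proof (induction x rule: free_alg_single_induct)
  case 1
  show ?case using assms(3)[OF assms(1), of 0] by simp
next
  case (3 w c)
  have "P (Poly_Mapping.single (Monomial l) 1)" for l
  proof (induction l)
    case Nil
    show ?case using assms(1) by (simp flip: zero_monomial_def)
  next
    case (Cons g l)
    have "Poly_Mapping.single (Monomial (g # l)) 1 = gen g * Poly_Mapping.single (Monomial l) (1::complex)"
      by (simp add: gen_def mult_single plus_monomial_def)
    then show ?case using assms(4)[OF Cons] by simp
  qed
  then have "P (Poly_Mapping.single w 1)" by (cases w) simp
  moreover have "Poly_Mapping.single w c = const c * Poly_Mapping.single w 1"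
    by (simp add: const_def mult_single)
  ultimately show ?case using assms(3) by simp
qed (use assms(2) in blast)

abbreviation "FA \<equiv> (ring_of_type_algebra :: free_alg ring)"

lemma FA_simps [simp]:
  "carrier FA = UNIV" "x \<otimes>\<^bsub>FA\<^esub> y = x * y" "x \<oplus>\<^bsub>FA\<^esub> y = x + y" "\<one>\<^bsub>FA\<^esub> = 1" "\<zero>\<^bsub>FA\<^esub> = 0"
  by (simp_all add: ring_of_type_algebra_def)

lemma FA_ring: "ring FA"
proof -
  have "\<exists>y. x + y = 0" for x :: free_alg
    using add.right_inverse by blast
  then show ?thesis
    unfolding ring_of_type_algebra_def
    by unfold_locales (auto simp: algebra_simps Units_def)
qed

lemma FA_a_inv [simp]: "\<ominus>\<^bsub>FA\<^esub> x = - x"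
  by (rule abelian_group.minus_equality) (auto intro: ring.is_abelian_group FA_ring)

section \<open>Congruence modulo the defining relations\<close>

locale uq_generic =
  fixes q :: complex and m :: nat
  assumes q_nz: "q \<noteq> 0" and q2: "q^2 \<noteq> 1" and q_nroot: "\<forall>n>0. q ^ n \<noteq> 1"
begin

abbreviation "I \<equiv> uq_ideal q m"

lemma ideal_I: "ideal I FA"
  unfolding uq_ideal_def by (rule ring.genideal_ideal[OF FA_ring]) auto

lemma relators_I: "uq_relators q m \<subseteq> I"
  unfolding uq_ideal_def by (rule ring.genideal_self[OF FA_ring]) auto

lemma I_0: "0 \<in> I"
  using additive_subgroup.zero_closed[OF ideal.axioms(1)[OF ideal_I]] by simp

lemma I_add: "x \<in> I \<Longrightarrow> y \<in> I \<Longrightarrow> x + y \<in> I"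
  using additive_subgroup.a_closed[OF ideal.axioms(1)[OF ideal_I], of x y] by simp

lemma I_lmult: "y \<in> I \<Longrightarrow> x * y \<in> I"
  using ideal.I_l_closed[OF ideal_I, of y x] by simp

lemma I_rmult: "y \<in> I \<Longrightarrow> y * x \<in> I"
  using ideal.I_r_closed[OF ideal_I, of y x] by simp

lemma I_minus: "x \<in> I \<Longrightarrow> - x \<in> I"
  using I_lmult[of x "-1"] by simp

lemma I_diff: "x \<in> I \<Longrightarrow> y \<in> I \<Longrightarrow> x - y \<in> I"
  using I_add[of x "-y"] I_minus by simp

text \<open>
  Equality in \<open>U\<close> is treated as a congruence on the free algebra, so that computations take place
  in a type of class \<^class>\<open>ring_1\<close> rather than among cosets.
\<close>

definition U_eq :: "free_alg \<Rightarrow> free_alg \<Rightarrow> bool" (infix \<open>\<doteq>\<close> 50) where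
  "x \<doteq> y \<longleftrightarrow> x - y \<in> I"

lemma U_eq_refl [simp, intro]: "x \<doteq> x"
  by (simp add: U_eq_def I_0)

lemma U_eq_sym: "x \<doteq> y \<Longrightarrow> y \<doteq> x"
  unfolding U_eq_def using I_minus by fastforce

lemma U_eq_trans [trans]: "x \<doteq> y \<Longrightarrow> y \<doteq> z \<Longrightarrow> x \<doteq> z"
  unfolding U_eq_def using I_add by fastforce

lemma U_eq_add: "x \<doteq> y \<Longrightarrow> x' \<doteq> y' \<Longrightarrow> x + x' \<doteq> y + y'"
  unfolding U_eq_def using I_add[of "x - y" "x' - y'"] by (simp add: algebra_simps)

lemma U_eq_diff: "x \<doteq> y \<Longrightarrow> x' \<doteq> y' \<Longrightarrow> x - x' \<doteq> y - y'"
  unfolding U_eq_def using I_diff[of "x - y" "x' - y'"] by (simp add: algebra_simps)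

lemma U_eq_lmult: "x \<doteq> y \<Longrightarrow> z * x \<doteq> z * y"
  unfolding U_eq_def using I_lmult[of "x - y" z] by (simp add: algebra_simps)

lemma U_eq_rmult: "x \<doteq> y \<Longrightarrow> x * z \<doteq> y * z"
  unfolding U_eq_def using I_rmult[of "x - y" z] by (simp add: algebra_simps)

lemma U_eq_sum: "(\<And>i. i \<in> A \<Longrightarrow> f i \<doteq> g i) \<Longrightarrow> sum f A \<doteq> sum g A"
  by (induction A rule: infinite_finite_induct) (auto intro: U_eq_add)

lemma U_eq_0_iff: "x \<doteq> 0 \<longleftrightarrow> x \<in> I"
  by (simp add: U_eq_def)

abbreviation "gE \<equiv> gen GE"
abbreviation "gF \<equiv> gen GF"
abbreviation "gK \<equiv> gen GK"
abbreviation "gKi \<equiv> gen GKinv"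

lemma rel_KE: "gK * gE \<doteq> const (q^2) * (gE * gK)"
  and rel_KF: "gK * gF \<doteq> const (inverse (q^2)) * (gF * gK)"
  and rel_KKi: "gK * gKi \<doteq> 1"
  and rel_KiK: "gKi * gK \<doteq> 1"
  and rel_EF: "gE * gF \<doteq> gF * gE + f_poly q m"
  using relators_I by (auto simp: uq_relators_def U_eq_def mult.assoc algebra_simps)

section \<open>Powers of K\<close>

definition K_pow :: "int \<Rightarrow> free_alg" where
  "K_pow b = (if b \<ge> 0 then gK ^ nat b else gKi ^ nat (- b))"

lemma K_pow_0 [simp]: "K_pow 0 = 1"
  by (simp add: K_pow_def)

lemma K_pow_1 [simp]: "K_pow 1 = gK"
  by (simp add: K_pow_def)

lemma K_K_pow: "gK * K_pow b \<doteq> K_pow (b + 1)"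
proof (cases "b \<ge> 0")
  case True
  then show ?thesis by (simp add: K_pow_def nat_add_distrib)
next
  case False
  then have *: "nat (- b) = Suc (nat (- b - 1))" by simp
  have "gK * K_pow b = (gK * gKi) * gKi ^ nat (- b - 1)"
    using False by (simp add: K_pow_def * mult.assoc)
  also have "\<dots> \<doteq> 1 * gKi ^ nat (- b - 1)" by (rule U_eq_rmult[OF rel_KKi])
  also have "\<dots> = K_pow (b + 1)" using False by (auto simp: K_pow_def)
  finally show ?thesis .
qed

lemma Ki_K_pow: "gKi * K_pow b \<doteq> K_pow (b - 1)"
proof (cases "b \<le> 0")
  case True
  then have *: "nat (1 - b) = Suc (nat (- b))" by simp
  show ?thesis using True by (cases "b = 0") (simp_all add: K_pow_def *)
next
  case False
  then have *: "nat b = Suc (nat (b - 1))" by simp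
  have "gKi * K_pow b = (gKi * gK) * gK ^ nat (b - 1)"
    using False by (simp add: K_pow_def * mult.assoc)
  also have "\<dots> \<doteq> 1 * gK ^ nat (b - 1)" by (rule U_eq_rmult[OF rel_KiK])
  also have "\<dots> = K_pow (b - 1)" using False by (auto simp: K_pow_def)
  finally show ?thesis .
qed

lemma K_pow_add: "K_pow a * K_pow b \<doteq> K_pow (a + b)"
proof (induction a arbitrary: b rule: int_induct[where k = 0])
  case base
  then show ?case by simp
next
  case (step1 i)
  have "K_pow (i + 1) * K_pow b \<doteq> gK * K_pow i * K_pow b" by (intro U_eq_rmult U_eq_sym[OF K_K_pow])
  also have "\<dots> = gK * (K_pow i * K_pow b)" by (simp add: mult.assoc)
  also have "\<dots> \<doteq> gK * K_pow (i + b)" by (intro U_eq_lmult step1)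
  also have "\<dots> \<doteq> K_pow (i + b + 1)" by (rule K_K_pow)
  finally show ?case by (simp add: algebra_simps)
next
  case (step2 i)
  have "K_pow (i - 1) * K_pow b \<doteq> gKi * K_pow i * K_pow b" by (intro U_eq_rmult U_eq_sym[OF Ki_K_pow])
  also have "\<dots> = gKi * (K_pow i * K_pow b)" by (simp add: mult.assoc)
  also have "\<dots> \<doteq> gKi * K_pow (i + b)" by (intro U_eq_lmult step2)
  also have "\<dots> \<doteq> K_pow (i + b - 1)" by (rule Ki_K_pow)
  finally show ?case by (simp add: algebra_simps)
qed

text \<open>
  In \<open>U\<close> this says \<open>K x K\<^sup>-\<^sup>1 = c x\<close>.
\<close>

definition K_weight :: "complex \<Rightarrow> free_alg \<Rightarrow> bool" where
  "K_weight c x \<longleftrightarrow> gK * x \<doteq> const c * (x * gK)"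

lemma K_weight_cong: assumes "K_weight c x" "x \<doteq> y" shows "K_weight c y"
proof -
  have "gK * y \<doteq> gK * x" by (intro U_eq_lmult U_eq_sym[OF assms(2)])
  also have "\<dots> \<doteq> const c * (x * gK)" using assms by (simp add: K_weight_def)
  also have "\<dots> \<doteq> const c * (y * gK)" by (intro U_eq_lmult U_eq_rmult assms)
  finally show ?thesis by (simp add: K_weight_def)
qed

lemma K_weight_add: "K_weight c x \<Longrightarrow> K_weight c y \<Longrightarrow> K_weight c (x + y)"
  unfolding K_weight_def using U_eq_add by (simp add: algebra_simps)

lemma K_weight_mult: assumes "K_weight c x" "K_weight d y" shows "K_weight (c * d) (x * y)"
proof -
  have "gK * (x * y) = (gK * x) * y" by (simp add: mult.assoc)
  also have "\<dots> \<doteq> const c * (x * gK) * y" using assms by (intro U_eq_rmult) (simp add: K_weight_def)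
  also have "\<dots> = const c * (x * (gK * y))" by (simp add: mult.assoc)
  also have "\<dots> \<doteq> const c * (x * (const d * (y * gK)))"
    using assms by (intro U_eq_lmult) (simp add: K_weight_def)
  also have "\<dots> = const (c * d) * (x * y * gK)"
    by (simp add: const_mult const_left_commute[of x] mult.assoc)
  finally show ?thesis by (simp add: K_weight_def)
qed

lemma K_weight_1: "K_weight 1 1" by (simp add: K_weight_def)
lemma K_weight_E: "K_weight (q^2) gE" using rel_KE by (simp add: K_weight_def)
lemma K_weight_F: "K_weight (inverse (q^2)) gF" using rel_KF by (simp add: K_weight_def)
lemma K_weight_const: "K_weight 1 (const c)" by (simp add: K_weight_def const_commute[of gK])

lemma K_weight_K_pow: "K_weight 1 (K_pow b)"
proof -
  have "gK * K_pow b \<doteq> K_pow b * gK"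
    using U_eq_trans[OF K_pow_add[of 1 b] U_eq_sym[OF K_pow_add[of b 1, unfolded add.commute[of b 1]]]] by simp
  then show ?thesis by (simp add: K_weight_def)
qed

lemma K_weight_Ki: assumes "K_weight c x" "c \<noteq> 0" shows "gKi * x \<doteq> const (inverse c) * (x * gKi)"
proof -
  have "gKi * x = gKi * x * 1" by simp
  also have "\<dots> \<doteq> gKi * x * (gK * gKi)" by (intro U_eq_lmult U_eq_sym[OF rel_KKi])
  also have "\<dots> = const (inverse c) * (gKi * (const c * (x * gK)) * gKi)"
    using assms(2) by (simp add: const_left_commute[of gKi] const_mult_assoc mult.assoc)
  also have "\<dots> \<doteq> const (inverse c) * (gKi * (gK * x) * gKi)"
    using U_eq_sym[OF assms(1)[unfolded K_weight_def]] by (intro U_eq_lmult U_eq_rmult)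
  also have "\<dots> = const (inverse c) * ((gKi * gK) * (x * gKi))" by (simp add: mult.assoc)
  also have "\<dots> \<doteq> const (inverse c) * (1 * (x * gKi))" by (intro U_eq_lmult U_eq_rmult rel_KiK)
  finally show ?thesis by simp
qed

lemma K_pow_K_weight: assumes "K_weight c x" "c \<noteq> 0" shows "K_pow b * x \<doteq> const (c powi b) * (x * K_pow b)"
proof (induction b rule: int_induct[where k = 0])
  case base
  then show ?case by simp
next
  case (step1 i)
  have "K_pow (i + 1) * x \<doteq> gK * K_pow i * x" by (intro U_eq_rmult U_eq_sym[OF K_K_pow])
  also have "\<dots> = gK * (K_pow i * x)" by (simp add: mult.assoc)
  also have "\<dots> \<doteq> gK * (const (c powi i) * (x * K_pow i))" by (intro U_eq_lmult step1)
  also have "\<dots> = const (c powi i) * ((gK * x) * K_pow i)" by (simp add: const_left_commute[of gK] mult.assoc)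
  also have "\<dots> \<doteq> const (c powi i) * ((const c * (x * gK)) * K_pow i)"
    using assms by (intro U_eq_lmult U_eq_rmult) (simp add: K_weight_def)
  also have "\<dots> = const (c powi (i + 1)) * (x * (gK * K_pow i))"
    using assms by (simp add: power_int_add const_mult mult.assoc)
  also have "\<dots> \<doteq> const (c powi (i + 1)) * (x * K_pow (i + 1))" by (intro U_eq_lmult K_K_pow)
  finally show ?case .
next
  case (step2 i)
  have "K_pow (i - 1) * x \<doteq> gKi * K_pow i * x" by (intro U_eq_rmult U_eq_sym[OF Ki_K_pow])
  also have "\<dots> = gKi * (K_pow i * x)" by (simp add: mult.assoc)
  also have "\<dots> \<doteq> gKi * (const (c powi i) * (x * K_pow i))" by (intro U_eq_lmult step2)
  also have "\<dots> = const (c powi i) * ((gKi * x) * K_pow i)" by (simp add: const_left_commute[of gKi] mult.assoc)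
  also have "\<dots> \<doteq> const (c powi i) * ((const (inverse c) * (x * gKi)) * K_pow i)"
    using assms by (intro U_eq_lmult U_eq_rmult K_weight_Ki)
  also have "\<dots> = const (c powi (i - 1)) * (x * (gKi * K_pow i))"
    using assms by (simp add: power_int_diff const_mult_assoc divide_inverse mult.assoc)
  also have "\<dots> \<doteq> const (c powi (i - 1)) * (x * K_pow (i - 1))" by (intro U_eq_lmult Ki_K_pow)
  finally show ?case .
qed

lemma q2_pow: "(q^2) powi b = q powi (2 * b)" "inverse (q^2) powi b = q powi (- 2 * b)"
  by (simp_all add: power_int_mult power_int_minus power_int_inverse power_int_numeral)

lemma K_pow_E: "K_pow b * gE \<doteq> const (q powi (2 * b)) * (gE * K_pow b)"
  using K_pow_K_weight[OF K_weight_E, of b] q_nz by (simp add: q2_pow)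

lemma K_pow_F: "K_pow b * gF \<doteq> const (q powi (- 2 * b)) * (gF * K_pow b)"
  using K_pow_K_weight[OF K_weight_F, of b] q_nz by (simp add: q2_pow)

lemma E_K_pow: "gE * K_pow b \<doteq> const (q powi (- 2 * b)) * (K_pow b * gE)"
proof -
  have "gE * K_pow b = const (q powi (- 2 * b)) * (const (q powi (2 * b)) * (gE * K_pow b))"
    using q_nz by (simp add: const_mult_assoc power_int_minus)
  also have "\<dots> \<doteq> const (q powi (- 2 * b)) * (K_pow b * gE)" by (intro U_eq_lmult U_eq_sym[OF K_pow_E])
  finally show ?thesis .
qed

lemma F_K_pow: "gF * K_pow b \<doteq> const (q powi (2 * b)) * (K_pow b * gF)"
proof -
  have "gF * K_pow b = const (q powi (2 * b)) * (const (q powi (- 2 * b)) * (gF * K_pow b))"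
    using q_nz by (simp add: const_mult_assoc power_int_minus)
  also have "\<dots> \<doteq> const (q powi (2 * b)) * (K_pow b * gF)" by (intro U_eq_lmult U_eq_sym[OF K_pow_F])
  finally show ?thesis .
qed

section \<open>The Casimir element\<close>

text \<open>
  The coefficients of \<open>g(K) = \<alpha> K\<^sup>m + \<beta> K\<^sup>-\<^sup>m\<close> solve
  \<open>(1 - q\<^sup>-\<^sup>2\<^sup>m) \<alpha> = s\<close> and \<open>(1 - q\<^sup>2\<^sup>m) \<beta> = - s\<close> with \<open>s = 1 / (q - q\<^sup>-\<^sup>1)\<close>. For \<open>m = 0\<close> the
  denominators are zero and both coefficients become \<open>0\<close>, which is the right choice because then
  \<open>f\<^sub>m(K) = 0\<close>.
\<close>

definition ca :: complex where "ca = q ^ (2 * m) / ((q ^ (2 * m) - 1) * (q - inverse q))"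
definition cb :: complex where "cb = 1 / ((q ^ (2 * m) - 1) * (q - inverse q))"

text \<open>
  \<open>g(K)\<close> and \<open>g(q\<^sup>-\<^sup>2 K)\<close>, whose difference is \<open>f\<^sub>m(K)\<close>.
\<close>

definition casimir_K :: free_alg where
  "casimir_K = const ca * K_pow (int m) + const cb * K_pow (- int m)"
definition casimir_K_shift :: free_alg where
  "casimir_K_shift = const (q powi (- 2 * int m) * ca) * K_pow (int m) + const (q powi (2 * int m) * cb) * K_pow (- int m)"

lemma q_minus_inv: "q - inverse q \<noteq> 0"
  using q_nz q2 by (auto simp: field_simps power2_eq_square)

lemma ca_cb:
  assumes "m > 0"
  shows "ca - q powi (- 2 * int m) * ca = 1 / (q - inverse q)"
    and "cb - q powi (2 * int m) * cb = - (1 / (q - inverse q))"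
proof -
  define Q where "Q = q ^ (2 * m)"
  define s where "s = q - inverse q"
  have Q: "Q \<noteq> 0" "Q - 1 \<noteq> 0" using q_nz q_nroot assms by (auto simp: Q_def)
  have s: "s \<noteq> 0" using q_minus_inv by (simp add: s_def)
  have p: "q powi (2 * int m) = Q"
    by (metis Q_def of_nat_mult of_nat_numeral power_int_of_nat)
  then have n: "q powi (- 2 * int m) = inverse Q" by (simp add: power_int_minus)
  define t where "t = inverse ((Q - 1) * s)"
  have t: "(Q - 1) * t = inverse s" using Q(2) by (simp add: t_def)
  have ca: "ca = Q * t" and cb: "cb = t"
    by (simp_all add: ca_def cb_def t_def Q_def s_def divide_inverse)
  have "ca - inverse Q * ca = (Q - 1) * t"
    using Q(1) by (simp add: ca algebra_simps)
  then show "ca - q powi (- 2 * int m) * ca = 1 / (q - inverse q)"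
    unfolding n t by (simp add: s_def divide_inverse)
  have "cb - Q * cb = - ((Q - 1) * t)"
    by (simp add: cb algebra_simps)
  then show "cb - q powi (2 * int m) * cb = - (1 / (q - inverse q))"
    unfolding p t by (simp add: s_def divide_inverse)
qed

lemma f_poly_eq: "f_poly q m = casimir_K - casimir_K_shift"
proof (cases "m = 0")
  case True
  then show ?thesis unfolding f_poly_def casimir_K_def casimir_K_shift_def by simp
next
  case False
  have "casimir_K - casimir_K_shift = const (ca - q powi (- 2 * int m) * ca) * K_pow (int m)
      + const (cb - q powi (2 * int m) * cb) * K_pow (- int m)"
    by (simp add: casimir_K_def casimir_K_shift_def const_diff algebra_simps)
  also have "\<dots> = const (1 / (q - inverse q)) * (K_pow (int m) - K_pow (- int m))"
    using False ca_cb by (simp only: const_minus) (simp add: algebra_simps)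
  also have "\<dots> = f_poly q m" using False by (simp add: f_poly_def K_pow_def)
  finally show ?thesis by simp
qed

definition casimir :: free_alg where "casimir = gF * gE + casimir_K"

lemma casimir_EF: "casimir \<doteq> gE * gF + casimir_K_shift"
proof -
  have "gE * gF + casimir_K_shift \<doteq> gF * gE + f_poly q m + casimir_K_shift" by (intro U_eq_add rel_EF U_eq_refl)
  then show ?thesis by (simp add: f_poly_eq casimir_def U_eq_sym)
qed

lemma E_casimir_K: "gE * casimir_K \<doteq> casimir_K_shift * gE"
proof -
  have "gE * casimir_K = const ca * (gE * K_pow (int m)) + const cb * (gE * K_pow (- int m))"
    by (simp add: casimir_K_def algebra_simps const_left_commute[of gE])
  also have "\<dots> \<doteq> const ca * (const (q powi (- 2 * int m)) * (K_pow (int m) * gE)) +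
      const cb * (const (q powi (- 2 * (- int m))) * (K_pow (- int m) * gE))"
    by (intro U_eq_add U_eq_lmult E_K_pow)
  also have "\<dots> = casimir_K_shift * gE"
    by (simp add: casimir_K_shift_def algebra_simps const_mult_assoc)
  finally show ?thesis .
qed

lemma F_casimir_K_shift: "gF * casimir_K_shift \<doteq> casimir_K * gF"
proof -
  have "gF * casimir_K_shift = const (q powi (- 2 * int m) * ca) * (gF * K_pow (int m)) +
      const (q powi (2 * int m) * cb) * (gF * K_pow (- int m))"
    by (simp add: casimir_K_shift_def algebra_simps const_left_commute[of gF])
  also have "\<dots> \<doteq> const (q powi (- 2 * int m) * ca) * (const (q powi (2 * int m)) * (K_pow (int m) * gF)) +
      const (q powi (2 * int m) * cb) * (const (q powi (2 * (- int m))) * (K_pow (- int m) * gF))"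
    by (intro U_eq_add U_eq_lmult F_K_pow)
  also have "\<dots> = casimir_K * gF"
    using q_nz by (simp add: casimir_K_def algebra_simps const_mult_assoc power_int_minus)
  finally show ?thesis .
qed

lemma K_weight_casimir: "K_weight 1 casimir"
proof -
  have 1: "K_weight 1 (gF * gE)" using K_weight_mult[OF K_weight_F K_weight_E] q_nz by simp
  have 2: "K_weight 1 casimir_K" unfolding casimir_K_def
    using K_weight_mult[OF K_weight_const K_weight_K_pow] by (auto intro!: K_weight_add)
  show ?thesis unfolding casimir_def using 1 2 by (rule K_weight_add)
qed

text \<open>
  The two expressions \<open>F E + g(K)\<close> and \<open>E F + g(q\<^sup>-\<^sup>2 K)\<close> are exchanged when \<open>E\<close> or \<open>F\<close> is
  moved past them, because \<open>E g(K) = g(q\<^sup>-\<^sup>2 K) E\<close> and \<open>F g(q\<^sup>-\<^sup>2 K) = g(K) F\<close>.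
\<close>

lemma casimir_gen: "casimir * gen g \<doteq> gen g * casimir"
proof (cases g)
  case GE
  have "casimir * gE \<doteq> (gE * gF + casimir_K_shift) * gE" by (intro U_eq_rmult casimir_EF)
  also have "\<dots> = gE * gF * gE + casimir_K_shift * gE" by (simp add: algebra_simps)
  also have "\<dots> \<doteq> gE * gF * gE + gE * casimir_K" by (intro U_eq_add U_eq_refl U_eq_sym[OF E_casimir_K])
  also have "\<dots> = gE * casimir" by (simp add: casimir_def algebra_simps)
  finally show ?thesis using GE by simp
next
  case GF
  have "gF * casimir \<doteq> gF * (gE * gF + casimir_K_shift)" by (intro U_eq_lmult casimir_EF)
  also have "\<dots> = gF * gE * gF + gF * casimir_K_shift" by (simp add: algebra_simps)
  also have "\<dots> \<doteq> gF * gE * gF + casimir_K * gF" by (intro U_eq_add U_eq_refl F_casimir_K_shift)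
  also have "\<dots> = casimir * gF" by (simp add: casimir_def algebra_simps)
  finally show ?thesis using GF by (simp add: U_eq_sym)
next
  case GK
  then show ?thesis using K_weight_casimir by (simp add: K_weight_def U_eq_sym)
next
  case GKinv
  then show ?thesis using K_weight_Ki[OF K_weight_casimir] by (simp add: U_eq_sym)
qed

lemma casimir_central: "casimir * x \<doteq> x * casimir"
proof (induction x rule: free_alg_induct)
  case one
  show ?case by simp
next
  case (add x y)
  then show ?case using U_eq_add by (simp add: algebra_simps)
next
  case (const c x)
  then show ?case using U_eq_lmult by (simp add: mult.assoc const_left_commute[of casimir])
next
  case (gen g x)
  have "casimir * (gen g * x) = (casimir * gen g) * x" by (simp add: mult.assoc)
  also have "\<dots> \<doteq> (gen g * casimir) * x" by (intro U_eq_rmult casimir_gen)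
  also have "\<dots> = gen g * (casimir * x)" by (simp add: mult.assoc)
  also have "\<dots> \<doteq> gen g * (x * casimir)" by (intro U_eq_lmult gen)
  finally show ?case by (simp add: mult.assoc)
qed

lemma FE_eq: "gF * gE = casimir - casimir_K" by (simp add: casimir_def)
lemma EF_U_eq: "gE * gF \<doteq> casimir - casimir_K_shift"
proof -
  have "casimir - casimir_K_shift \<doteq> gE * gF + casimir_K_shift - casimir_K_shift" by (intro U_eq_diff casimir_EF U_eq_refl)
  then show ?thesis by (simp add: U_eq_sym)
qed

text \<open>
  The polynomial \<open>p\<close> evaluated at \<open>\<Omega>\<close>, by the scheme of Horner.
\<close>

definition casimir_poly :: "complex poly \<Rightarrow> free_alg" where
  "casimir_poly p = fold_coeffs (\<lambda>a r. const a + casimir * r) p 0"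

lemma casimir_poly_0 [simp]: "casimir_poly 0 = 0"
  by (simp add: casimir_poly_def)

lemma casimir_poly_pCons [simp]: "casimir_poly (pCons a p) = const a + casimir * casimir_poly p"
  by (cases "a = 0 \<and> p = 0") (auto simp: casimir_poly_def)

lemma casimir_poly_1 [simp]: "casimir_poly 1 = 1"
  by (simp add: one_pCons)

lemma casimir_poly_add: "casimir_poly (p + r) = casimir_poly p + casimir_poly r"
  by (induction p r rule: poly_induct2) (simp_all add: const_add algebra_simps)

lemma casimir_poly_smult: "casimir_poly (smult c p) = const c * casimir_poly p"
proof (induction p)
  case (pCons a p)
  have "const c * const a = const (c * a)" by (simp add: const_mult)
  with pCons show ?case by (simp add: const_left_commute[of casimir] algebra_simps)
qed simp

lemma casimir_poly_mult: "casimir_poly (p * r) = casimir_poly p * casimir_poly r"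
  by (induction p) (simp_all add: casimir_poly_add casimir_poly_smult algebra_simps)

lemma casimir_poly_central: "casimir_poly p * x \<doteq> x * casimir_poly p"
proof (induction p)
  case 0
  then show ?case by simp
next
  case (pCons a p)
  have "casimir * casimir_poly p * x = casimir * (casimir_poly p * x)" by (simp add: mult.assoc)
  also have "\<dots> \<doteq> casimir * (x * casimir_poly p)" by (intro U_eq_lmult pCons)
  also have "\<dots> = casimir * x * casimir_poly p" by (simp add: mult.assoc)
  also have "\<dots> \<doteq> x * casimir * casimir_poly p" by (intro U_eq_rmult casimir_central)
  finally have "casimir * casimir_poly p * x \<doteq> x * casimir * casimir_poly p" .
  from U_eq_add[OF U_eq_refl[of "const a * x"] this] show ?case
    by (simp add: algebra_simps const_commute[of x])
qed

end

context uq_generic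
begin

section \<open>Sums of homogeneous elements\<close>

text \<open>
  Sums that keep track of which summand comes from which \<open>W d\<close>, so that eigenvalues depending on
  \<open>d\<close> can separate the summands.
\<close>

definition graded_sum :: "(int \<Rightarrow> free_alg set) \<Rightarrow> free_alg set" where
  "graded_sum W = {x. \<exists>D y. finite D \<and> (\<forall>d. y d \<in> W d) \<and> x \<doteq> (\<Sum>d\<in>D. y d)}"

lemma gsumI: "finite D \<Longrightarrow> (\<And>d. y d \<in> W d) \<Longrightarrow> x \<doteq> (\<Sum>d\<in>D. y d) \<Longrightarrow> x \<in> graded_sum W"
  unfolding graded_sum_def by blast

lemma graded_sum_cong: "x \<in> graded_sum W \<Longrightarrow> y \<doteq> x \<Longrightarrow> y \<in> graded_sum W"
  unfolding graded_sum_def using U_eq_trans by blast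

lemma graded_sum_incl:
  assumes "\<And>d. 0 \<in> W d" "x \<in> W d"
  shows "x \<in> graded_sum W"
  by (rule gsumI[of "{d}" "\<lambda>i. if i = d then x else 0"]) (use assms in auto)

lemma graded_sum_0: "(\<And>d. 0 \<in> W d) \<Longrightarrow> 0 \<in> graded_sum W"
  using graded_sum_incl by blast

lemma graded_sum_add:
  assumes W: "\<And>d. 0 \<in> W d" "\<And>d x y. x \<in> W d \<Longrightarrow> y \<in> W d \<Longrightarrow> x + y \<in> W d"
    and "x \<in> graded_sum W" "x' \<in> graded_sum W"
  shows "x + x' \<in> graded_sum W"
proof -
  obtain D y where y: "finite D" "\<And>d. y d \<in> W d" "x \<doteq> sum y D"
    using assms(3) unfolding graded_sum_def by blast
  obtain D' y' where y': "finite D'" "\<And>d. y' d \<in> W d" "x' \<doteq> sum y' D'"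
    using assms(4) unfolding graded_sum_def by blast
  define z where "z d = (if d \<in> D then y d else 0) + (if d \<in> D' then y' d else 0)" for d
  have "sum z (D \<union> D') = sum (\<lambda>d. if d \<in> D then y d else 0) (D \<union> D')
      + sum (\<lambda>d. if d \<in> D' then y' d else 0) (D \<union> D')"
    unfolding z_def by (rule sum.distrib)
  also have "\<dots> = sum y D + sum y' D'"
    using y(1) y'(1) by (simp add: sum.inter_restrict[symmetric] Int_Un_distrib2 Un_Int_distrib Int_absorb1)
  finally have "x + x' \<doteq> sum z (D \<union> D')" using U_eq_add[OF y(3) y'(3)] by simp
  then show ?thesis
    by (rule gsumI[rotated 2]) (use y y' W in \<open>auto simp: z_def\<close>)
qed

lemma graded_sum_induct [consumes 1, case_names incl zero add cong]:
  assumes "x \<in> graded_sum W"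
    and "\<And>d y. y \<in> W d \<Longrightarrow> P y"
    and "P 0" "\<And>x y. P x \<Longrightarrow> P y \<Longrightarrow> P (x + y)" "\<And>x y. P x \<Longrightarrow> x \<doteq> y \<Longrightarrow> P y"
  shows "P x"
proof -
  obtain D y where y: "finite D" "\<And>d. y d \<in> W d" "x \<doteq> sum y D"
    using assms(1) unfolding graded_sum_def by blast
  have "P (sum y D)"
    using y(1) by (induction D) (use assms(3,4) assms(2)[OF y(2)] in auto)
  then show ?thesis using assms(5) U_eq_sym[OF y(3)] by blast
qed

section \<open>The subalgebra generated by K and the Casimir element\<close>

definition A0 :: "int \<Rightarrow> free_alg set" where
  "A0 b = range (\<lambda>p. K_pow b * casimir_poly p)"

text \<open>
  The commutative subalgebra \<open>\<complex>[K, K\<^sup>-\<^sup>1, \<Omega>]\<close> of \<open>U\<close>.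
\<close>

definition A :: "free_alg set" where "A = graded_sum A0"

lemma A0_0: "0 \<in> A0 b"
  unfolding A0_def by (rule range_eqI[of _ _ 0]) simp

lemma A0_add: "x \<in> A0 b \<Longrightarrow> y \<in> A0 b \<Longrightarrow> x + y \<in> A0 b"
  unfolding A0_def by (auto simp: casimir_poly_add[symmetric] distrib_left[symmetric])

lemma A_0: "0 \<in> A" and A_add: "x \<in> A \<Longrightarrow> y \<in> A \<Longrightarrow> x + y \<in> A"
  unfolding A_def by (simp_all add: graded_sum_0 graded_sum_add A0_0 A0_add)

lemma A_cong: "x \<in> A \<Longrightarrow> y \<doteq> x \<Longrightarrow> y \<in> A"
  unfolding A_def by (rule graded_sum_cong)

lemma A_monom: "K_pow b * casimir_poly p \<in> A"
  unfolding A_def by (rule graded_sum_incl[where W = A0 and d = b, OF A0_0]) (simp add: A0_def)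

lemma A_induct [consumes 1, case_names monom add cong]:
  assumes "x \<in> A" "\<And>b p. P (K_pow b * casimir_poly p)"
    and "\<And>x y. P x \<Longrightarrow> P y \<Longrightarrow> P (x + y)" "\<And>x y. P x \<Longrightarrow> x \<doteq> y \<Longrightarrow> P y"
  shows "P x"
  using assms(1) unfolding A_def
  by (rule graded_sum_induct) (use assms(2)[of 0 0] assms(2-) in \<open>auto simp: A0_def\<close>)

lemma A_K_pow: "K_pow b \<in> A" using A_monom[of b 1] by simp
lemma A_casimir_poly: "casimir_poly p \<in> A" using A_monom[of 0 p] by simp
lemma A_1: "1 \<in> A" using A_K_pow[of 0] by simp
lemma A_const: "const c \<in> A" using A_casimir_poly[of "[:c:]"] by simp
lemma A_casimir: "casimir \<in> A" using A_casimir_poly[of "[:0,1:]"] by simp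

lemma A_mult:
  assumes "x \<in> A" "y \<in> A" shows "x * y \<in> A"
  using assms
proof (induction rule: A_induct)
  case (monom b p)
  from \<open>y \<in> A\<close> show ?case
  proof (induction rule: A_induct)
    case (monom c r)
    have "K_pow b * casimir_poly p * (K_pow c * casimir_poly r) = K_pow b * ((casimir_poly p * K_pow c) * casimir_poly r)" by (simp add: mult.assoc)
    also have "\<dots> \<doteq> K_pow b * ((K_pow c * casimir_poly p) * casimir_poly r)" by (intro U_eq_lmult U_eq_rmult casimir_poly_central)
    also have "\<dots> = (K_pow b * K_pow c) * casimir_poly (p * r)" by (simp add: casimir_poly_mult mult.assoc)
    also have "\<dots> \<doteq> K_pow (b + c) * casimir_poly (p * r)" by (intro U_eq_rmult K_pow_add)
    finally show ?case using A_cong A_monom by blast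
  next
    case (add x y)
    then show ?case by (simp add: distrib_left A_add)
  next
    case (cong x y)
    then show ?case using A_cong U_eq_lmult U_eq_sym by blast
  qed
next
  case (add x y)
  then show ?case by (simp add: distrib_right A_add)
next
  case (cong x y)
  then show ?case using A_cong U_eq_rmult U_eq_sym by blast
qed

lemma A_minus: "x \<in> A \<Longrightarrow> - x \<in> A"
  using A_mult[OF A_const[of "-1"], of x] by (simp add: const_minus)

lemma A_diff: "x \<in> A \<Longrightarrow> y \<in> A \<Longrightarrow> x - y \<in> A"
  using A_add[of x "- y"] A_minus by simp

lemma A_casimir_K: "casimir_K \<in> A" and A_casimir_K_shift: "casimir_K_shift \<in> A"
  unfolding casimir_K_def casimir_K_shift_def by (intro A_add A_mult A_const A_K_pow)+

lemma K_weight_casimir_poly: "K_weight 1 (casimir_poly p)"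
  using U_eq_sym[OF casimir_poly_central[of p gK]] by (simp add: K_weight_def)

lemma K_weight_A: assumes "x \<in> A" shows "K_weight 1 x"
  using assms
proof (induction rule: A_induct)
  case (monom b p)
  show ?case using K_weight_mult[OF K_weight_K_pow K_weight_casimir_poly] by simp
qed (auto intro: K_weight_add K_weight_cong)

text \<open>
  An element that commutes with the powers of \<open>K\<close> up to scalars can be moved past all of \<^const>\<open>A\<close>,
  since \<open>\<Omega>\<close> is central. This applies to \<open>E\<close> and \<open>F\<close>.
\<close>

lemma A_normalizes:
  assumes Y: "\<And>b. Y * K_pow b \<doteq> const (c b) * (K_pow b * Y)" and "x \<in> A"
  shows "\<exists>y\<in>A. Y * x \<doteq> y * Y"
  using assms(2)
proof (induction rule: A_induct)
  case (monom b p)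
  have "Y * (K_pow b * casimir_poly p) = (Y * K_pow b) * casimir_poly p" by (simp add: mult.assoc)
  also have "\<dots> \<doteq> const (c b) * (K_pow b * Y) * casimir_poly p" by (intro U_eq_rmult Y)
  also have "\<dots> = const (c b) * K_pow b * (Y * casimir_poly p)" by (simp add: mult.assoc)
  also have "\<dots> \<doteq> const (c b) * K_pow b * (casimir_poly p * Y)" by (intro U_eq_lmult U_eq_sym[OF casimir_poly_central])
  also have "\<dots> = (const (c b) * (K_pow b * casimir_poly p)) * Y" by (simp add: mult.assoc)
  finally show ?case using A_mult[OF A_const A_monom] by blast
next
  case (add x y)
  then obtain x' y' where "x' \<in> A" "y' \<in> A" "Y * x \<doteq> x' * Y" "Y * y \<doteq> y' * Y" by blast
  then have "x' + y' \<in> A" "Y * (x + y) \<doteq> (x' + y') * Y"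
    by (auto simp: A_add algebra_simps U_eq_add)
  then show ?case by blast
next
  case (cong x y)
  then show ?case using U_eq_trans[OF U_eq_lmult[OF U_eq_sym]] by blast
qed

lemmas A_E = A_normalizes[OF E_K_pow]
lemmas A_F = A_normalizes[OF F_K_pow]

section \<open>Reduction modulo the left ideal of a Whittaker vector\<close>

text \<open>
  Modulo \<open>U (E - h)\<close> a factor \<open>E\<close> on the right becomes \<open>h\<close>, and a factor \<open>F\<close> on the right
  becomes \<open>h\<^sup>-\<^sup>1 F E = h\<^sup>-\<^sup>1 (\<Omega> - g(K))\<close>. Since \<open>E\<close> and \<open>F\<close> normalize \<^const>\<open>A\<close>, the set
  \<open>A + U (E - h)\<close> is a left ideal that contains \<open>1\<close>.
\<close>

lemma whittaker_reduction:
  assumes h: "h \<noteq> 0"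
  shows "\<exists>a\<in>A. \<exists>d. x \<doteq> a + d * (gE - const h)"
proof (induction x rule: free_alg_induct)
  case one
  have "1 \<doteq> 1 + 0 * (gE - const h)" by simp
  then show ?case using A_1 by blast
next
  case (add x y)
  then obtain a d a' d' where *: "a \<in> A" "a' \<in> A" "x \<doteq> a + d * (gE - const h)" "y \<doteq> a' + d' * (gE - const h)"
    by blast
  have "x + y \<doteq> (a + a') + (d + d') * (gE - const h)"
    using U_eq_add[OF *(3,4)] by (simp add: algebra_simps)
  then show ?case using A_add *(1,2) by blast
next
  case (const c x)
  then obtain a d where *: "a \<in> A" "x \<doteq> a + d * (gE - const h)" by blast
  have "const c * x \<doteq> const c * a + const c * d * (gE - const h)"
    using U_eq_lmult[OF *(2), of "const c"] by (simp add: algebra_simps)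
  then show ?case using A_mult[OF A_const *(1)] by blast
next
  case (gen g x)
  then obtain a d where *: "a \<in> A" "x \<doteq> a + d * (gE - const h)" by blast
  have step: ?case if "a' \<in> A" "gen g * a \<doteq> a' + d' * (gE - const h)" for a' d'
  proof -
    have "gen g * x \<doteq> gen g * a + gen g * d * (gE - const h)"
      using U_eq_lmult[OF *(2), of "gen g"] by (simp add: algebra_simps)
    also have "\<dots> \<doteq> (a' + d' * (gE - const h)) + gen g * d * (gE - const h)"
      by (intro U_eq_add U_eq_refl that)
    also have "\<dots> = a' + (d' + gen g * d) * (gE - const h)"
      by (simp add: algebra_simps)
    finally show ?thesis using that(1) by blast
  qed
  show ?case
  proof (cases g)
    case GE
    obtain a' where a': "a' \<in> A" "gE * a \<doteq> a' * gE" using A_E[OF *(1)] by blast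
    note a'(2)
    also have "a' * gE = a' * const h + a' * (gE - const h)" by (simp add: algebra_simps)
    finally have "gen g * a \<doteq> a' * const h + a' * (gE - const h)" using GE by simp
    from step[OF A_mult[OF a'(1) A_const] this] show ?thesis .
  next
    case GF
    obtain a' where a': "a' \<in> A" "gF * a \<doteq> a' * gF" using A_F[OF *(1)] by blast
    note a'(2)
    \<comment> \<open>\<open>h F = F E - F (E - h)\<close>\<close>
    also have "a' * gF = const (inverse h) * (a' * (gF * const h))"
      using h by (simp add: const_commute[of gF] const_left_commute[of a'] const_mult_assoc)
    also have "\<dots> = const (inverse h) * a' * (casimir - casimir_K) + (- const (inverse h) * a' * gF) * (gE - const h)"
      by (simp add: FE_eq[symmetric] algebra_simps)
    finally have "gen g * a \<doteq> const (inverse h) * a' * (casimir - casimir_K) +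
        (- const (inverse h) * a' * gF) * (gE - const h)" using GF by simp
    from step[OF A_mult[OF A_mult[OF A_const a'(1)] A_diff[OF A_casimir A_casimir_K]] this] show ?thesis .
  next
    case GK
    have "gen g * a \<doteq> K_pow 1 * a + 0 * (gE - const h)" using GK by simp
    from step[OF A_mult[OF A_K_pow *(1)] this] show ?thesis .
  next
    case GKinv
    have "gen g * a \<doteq> K_pow (- 1) * a + 0 * (gE - const h)" using GKinv by (simp add: K_pow_def)
    from step[OF A_mult[OF A_K_pow *(1)] this] show ?thesis .
  qed
qed

section \<open>Weight decomposition\<close>

definition EF_pow :: "int \<Rightarrow> free_alg" where
  "EF_pow d = (if d \<ge> 0 then gE ^ nat d else gF ^ nat (- d))"

text \<open>
  \<open>A E\<^sup>d\<close> for \<open>d \<ge> 0\<close> and \<open>A F\<^sup>-\<^sup>d\<close> for \<open>d < 0\<close>; both consist of elements of weight \<open>q\<^sup>2\<^sup>d\<close>.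
\<close>

definition weight_part :: "int \<Rightarrow> free_alg set" where
  "weight_part d = (\<lambda>a. a * EF_pow d) ` A"

lemma weight_part_0: "0 \<in> weight_part d"
  using A_0 unfolding weight_part_def by (metis imageI mult_zero_left)

lemma weight_part_add: "x \<in> weight_part d \<Longrightarrow> y \<in> weight_part d \<Longrightarrow> x + y \<in> weight_part d"
  unfolding weight_part_def by (auto simp: distrib_right[symmetric] intro: A_add)

lemma K_weight_EF_pow: "K_weight (q powi (2 * d)) (EF_pow d)"
proof -
  have E: "K_weight ((q^2) ^ n) (gE ^ n)" for n
    by (induction n) (auto intro: K_weight_1 K_weight_mult K_weight_E)
  have F: "K_weight (inverse (q^2) ^ n) (gF ^ n)" for n
    by (induction n) (auto intro: K_weight_1 K_weight_mult K_weight_F)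
  show ?thesis
  proof (cases "d \<ge> 0")
    case True
    then have "(q^2) ^ nat d = q powi (2 * d)" by (simp add: power_int_def nat_mult_distrib power_mult)
    then show ?thesis using E[of "nat d"] True by (simp add: EF_pow_def)
  next
    case False
    then have "inverse (q^2) ^ nat (- d) = q powi (2 * d)"
      using nat_mult_distrib[of 2 "- d"] by (simp add: power_int_def power_mult power_inverse)
    then show ?thesis using F[of "nat (- d)"] False by (simp add: EF_pow_def)
  qed
qed

lemma K_weight_weight_part: "x \<in> weight_part d \<Longrightarrow> K_weight (q powi (2 * d)) x"
  unfolding weight_part_def using K_weight_mult[OF K_weight_A K_weight_EF_pow] by auto

lemma graded_sum_weight_part_lmult:
  assumes Y: "\<And>d a. a \<in> A \<Longrightarrow> Y * (a * EF_pow d) \<in> graded_sum weight_part" and "x \<in> graded_sum weight_part"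
  shows "Y * x \<in> graded_sum weight_part"
  using assms(2)
proof (induction rule: graded_sum_induct)
  case (incl d y)
  then obtain a where "a \<in> A" "y = a * EF_pow d" by (auto simp: weight_part_def)
  then show ?case using Y by simp
next
  case zero
  then show ?case using graded_sum_0[where W = weight_part, OF weight_part_0] by simp
next
  case (add x y)
  then show ?case using graded_sum_add[where W = weight_part, OF weight_part_0 weight_part_add] by (simp add: distrib_left)
next
  case (cong x y)
  then show ?case using graded_sum_cong U_eq_lmult U_eq_sym by blast
qed

lemma weight_part_in: "a \<in> A \<Longrightarrow> a * EF_pow d \<in> graded_sum weight_part"
  by (rule graded_sum_incl[where W = weight_part and d = d, OF weight_part_0]) (simp add: weight_part_def)

text \<open>
  A product of letters \<open>E\<close> and \<open>F\<close> reduces to a power of one of them with coefficients in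
  \<^const>\<open>A\<close>, because \<open>E F\<close> and \<open>F E\<close> lie in \<^const>\<open>A\<close>.
\<close>

lemma weight_decomposition: "x \<in> graded_sum weight_part"
proof (induction x rule: free_alg_induct)
  case one
  show ?case using weight_part_in[OF A_1, of 0] by (simp add: EF_pow_def)
next
  case (add x y)
  then show ?case using graded_sum_add[where W = weight_part, OF weight_part_0 weight_part_add] by simp
next
  case (const c x)
  have "const c * (a * EF_pow d) \<in> graded_sum weight_part" if "a \<in> A" for a d
    using weight_part_in[OF A_mult[OF A_const that]] by (simp add: mult.assoc)
  then show ?case using graded_sum_weight_part_lmult const by blast
next
  case (gen g x)
  have "gen g * (a * EF_pow d) \<in> graded_sum weight_part" if a: "a \<in> A" for a d
  proof (cases g)
    case GE
    obtain a' where a': "a' \<in> A" "gE * a \<doteq> a' * gE" using A_E[OF a] by blast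
    have *: "gE * (a * EF_pow d) \<doteq> a' * (gE * EF_pow d)"
      using U_eq_rmult[OF a'(2), of "EF_pow d"] by (simp add: mult.assoc)
    show ?thesis
    proof (cases "d \<ge> 0")
      case True
      then have "gE * EF_pow d = EF_pow (d + 1)" by (simp add: EF_pow_def nat_add_distrib)
      then show ?thesis using graded_sum_cong[OF weight_part_in[OF a'(1), of "d + 1"]] * GE by simp
    next
      case False
      then have n: "nat (- d) = Suc (nat (- (d + 1)))" by simp
      have "EF_pow d = gF * EF_pow (d + 1)" using False by (cases "d = -1") (simp_all add: EF_pow_def n)
      then have "a' * (gE * EF_pow d) = a' * (gE * gF) * EF_pow (d + 1)" by (simp add: mult.assoc)
      also have "\<dots> \<doteq> a' * (casimir - casimir_K_shift) * EF_pow (d + 1)" by (intro U_eq_lmult U_eq_rmult EF_U_eq)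
      finally have "gE * (a * EF_pow d) \<doteq> a' * (casimir - casimir_K_shift) * EF_pow (d + 1)" using * U_eq_trans by blast
      then show ?thesis
        using graded_sum_cong[OF weight_part_in[OF A_mult[OF a'(1) A_diff[OF A_casimir A_casimir_K_shift]]]] GE by simp
    qed
  next
    case GF
    obtain a' where a': "a' \<in> A" "gF * a \<doteq> a' * gF" using A_F[OF a] by blast
    have *: "gF * (a * EF_pow d) \<doteq> a' * (gF * EF_pow d)"
      using U_eq_rmult[OF a'(2), of "EF_pow d"] by (simp add: mult.assoc)
    show ?thesis
    proof (cases "d \<le> 0")
      case True
      then have n: "nat (1 - d) = Suc (nat (- d))" by simp
      have "gF * EF_pow d = EF_pow (d - 1)" using True by (cases "d = 0") (simp_all add: EF_pow_def n)
      then show ?thesis using graded_sum_cong[OF weight_part_in[OF a'(1), of "d - 1"]] * GF by simp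
    next
      case False
      then have n: "nat d = Suc (nat (d - 1))" by simp
      have "EF_pow d = gE * EF_pow (d - 1)" using False by (simp add: EF_pow_def n)
      then have "a' * (gF * EF_pow d) = a' * (casimir - casimir_K) * EF_pow (d - 1)"
        by (simp add: mult.assoc FE_eq[symmetric])
      then have "gF * (a * EF_pow d) \<doteq> a' * (casimir - casimir_K) * EF_pow (d - 1)" using * by simp
      then show ?thesis
        using graded_sum_cong[OF weight_part_in[OF A_mult[OF a'(1) A_diff[OF A_casimir A_casimir_K]]]] GF by simp
    qed
  next
    case GK
    show ?thesis using weight_part_in[OF A_mult[OF A_K_pow[of 1] a]] GK by (simp add: mult.assoc)
  next
    case GKinv
    show ?thesis using weight_part_in[OF A_mult[OF A_K_pow[of "-1"] a]] GKinv by (simp add: mult.assoc K_pow_def)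
  qed
  then show ?case using graded_sum_weight_part_lmult gen by blast
qed

section \<open>Separation of eigenvectors\<close>

text \<open>
  The usual linear independence of eigenvectors for distinct eigenvalues, relative to a subspace
  \<open>N\<close> of the free algebra. The relative form covers the quotient \<open>U\<close>, with \<open>N\<close> the defining ideal,
  and every cyclic module, with \<open>N\<close> the annihilator of the generator.
\<close>

lemma eigen_separation:
  fixes N :: "free_alg set"
  assumes N: "\<And>x y. x \<in> N \<Longrightarrow> y \<in> N \<Longrightarrow> x + y \<in> N" "\<And>c x. x \<in> N \<Longrightarrow> const c * x \<in> N"
    and T: "\<And>x y. T (x + y) = T x + T y" "\<And>c x. T (const c * x) = const c * T x"
    and TN: "\<And>x. x \<in> N \<Longrightarrow> T x \<in> N"
    and "finite D" "inj_on l D" "\<And>d. d \<in> D \<Longrightarrow> T (y d) - const (l d) * y d \<in> N"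
    and "sum y D \<in> N" "d \<in> D"
  shows "y d \<in> N"
  using assms(6-)
proof (induction D arbitrary: y d rule: finite_induct)
  case empty
  then show ?case by simp
next
  case (insert e D)
  have N_diff: "x - x' \<in> N" if "x \<in> N" "x' \<in> N" for x x'
    using N(1)[OF that(1) N(2)[OF that(2), of "-1"]] by (simp add: const_minus)
  have T0: "T 0 = 0" using T(1)[of 0 0] by simp
  have Tsum: "T (sum f B) = (\<Sum>i\<in>B. T (f i))" for f and B :: "'a set"
    by (induction B rule: infinite_finite_induct) (simp_all add: T T0)
  have N0: "0 \<in> N" using N(2)[OF insert.prems(3), of 0] by simp
  have Nsum: "finite B \<Longrightarrow> (\<And>i. i \<in> B \<Longrightarrow> f i \<in> N) \<Longrightarrow> sum f B \<in> N" for f and B :: "'a set"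
    by (induction B rule: finite_induct) (simp_all add: N0 N(1))
  \<comment> \<open>applying \<open>T - l e\<close> to the sum removes the summand at \<open>e\<close>\<close>
  define y' where "y' i = const (l i - l e) * y i" for i
  have y': "y' i \<in> N" if "i \<in> D" for i
  proof (rule insert.IH[OF _ _ _ that])
    show "inj_on l D" using insert.prems(1) by auto
    show "T (y' i) - const (l i) * y' i \<in> N" if "i \<in> D" for i
    proof -
      have "T (y' i) - const (l i) * y' i = const (l i - l e) * (T (y i) - const (l i) * y i)"
        by (simp add: y'_def T algebra_simps const_mult_assoc)
      then show ?thesis using N(2) insert.prems(2) that by simp
    qed
    have "sum y' D = sum y' (insert e D)" using insert.hyps by (simp add: y'_def)
    also have "\<dots> = (\<Sum>i\<in>insert e D. const (l i) * y i) - const (l e) * sum y (insert e D)"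
      by (simp add: y'_def const_diff left_diff_distrib sum_subtractf sum_distrib_left)
    also have "\<dots> = (T (sum y (insert e D)) - const (l e) * sum y (insert e D))
        - (\<Sum>i\<in>insert e D. T (y i) - const (l i) * y i)"
      by (simp only: Tsum sum_subtractf) simp
    also have "\<dots> \<in> N"
      by (rule N_diff[OF N_diff[OF TN N(2)] Nsum])
        (use insert.prems(2,3) insert.hyps(1) in blast)+
    finally show "sum y' D \<in> N" .
  qed
  have yD: "y i \<in> N" if "i \<in> D" for i
  proof -
    have "l i - l e \<noteq> 0" using insert.prems(1) insert.hyps(2) that by (auto simp: inj_on_def)
    then have "y i = const (inverse (l i - l e)) * y' i" by (simp add: y'_def const_mult_assoc)
    then show ?thesis using N(2)[OF y'[OF that]] by simp
  qed
  have "y e = sum y (insert e D) - sum y D" using insert.hyps by simp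
  also have "\<dots> \<in> N" using N_diff[OF insert.prems(3) Nsum[OF insert.hyps(1) yD]] .
  finally show ?case using yD insert.prems(4) by auto
qed

lemma q_powi_inj: "q powi a = q powi b \<longleftrightarrow> a = b"
proof
  assume *: "q powi a = q powi b"
  have "False" if "q powi a = q powi b" "a < b" for a b
  proof -
    have "q ^ nat (b - a) = q powi (b - a)" using that(2) by (simp add: power_int_def)
    also have "\<dots> = 1" using that(1) q_nz by (simp add: power_int_diff)
    finally show False using q_nroot that(2) by simp
  qed
  from this[of a b] this[of b a] * show "a = b" by (metis linorder_cases)
qed simp

text \<open>
  Here \<open>N\<close> stands for the annihilator of a Whittaker vector. After the reduction to \<^const>\<open>A\<close> the
  summands \<open>K\<^sup>b p\<^sub>b(\<Omega>)\<close> are eigenvectors of left multiplication by \<open>E\<close> modulo \<open>N\<close> with eigenvalues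
  \<open>q\<^sup>-\<^sup>2\<^sup>b h\<close>, so each of them lies in \<open>N\<close>, and \<open>K\<^sup>b\<close> can be cancelled.
\<close>

lemma whittaker_annihilator:
  assumes h: "h \<noteq> 0"
    and N: "I \<subseteq> N" "\<And>x y. x \<in> N \<Longrightarrow> y \<in> N \<Longrightarrow> x + y \<in> N" "\<And>x y. x \<in> N \<Longrightarrow> y * x \<in> N"
      "gE - const h \<in> N"
    and "x \<in> N"
  shows "\<exists>D p d. finite D \<and> x \<doteq> (\<Sum>b\<in>D. K_pow b * casimir_poly (p b)) + d * (gE - const h) \<and> (\<forall>b\<in>D. casimir_poly (p b) \<in> N)"
proof -
  obtain a d where a: "a \<in> A" "x \<doteq> a + d * (gE - const h)"
    using whittaker_reduction[OF h] by blast
  obtain D y where y: "finite D" "\<And>b. y b \<in> A0 b" "a \<doteq> sum y D"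
    using a(1) unfolding A_def graded_sum_def by blast
  have "\<exists>p. \<forall>b. y b = K_pow b * casimir_poly (p b)"
    using y(2) unfolding A0_def by (intro choice) auto
  then obtain p where p: "\<And>b. y b = K_pow b * casimir_poly (p b)" by blast
  have N_cong: "z \<in> N" if "w \<in> N" "z \<doteq> w" for z w
    using N(2)[OF that(1), of "z - w"] that(2) N(1) by (auto simp: U_eq_def)
  have x: "x \<doteq> sum y D + d * (gE - const h)"
    using U_eq_trans[OF a(2) U_eq_add[OF y(3) U_eq_refl]] .
  have "sum y D \<doteq> x + (- d) * (gE - const h)"
    using U_eq_add[OF U_eq_sym[OF x] U_eq_refl[of "(- d) * (gE - const h)"]] by (simp add: algebra_simps)
  then have sumN: "sum y D \<in> N" using N_cong N \<open>x \<in> N\<close> by blast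
  have "y b \<in> N" if "b \<in> D" for b
  proof (rule eigen_separation[where T = "\<lambda>x. gE * x" and l = "\<lambda>b. q powi (- 2 * b) * h"])
    show "inj_on (\<lambda>b. q powi (- 2 * b) * h) D"
      using h by (auto simp: inj_on_def q_powi_inj simp del: mult_minus_left)
    show "gE * y b - const (q powi (- 2 * b) * h) * y b \<in> N" for b
    proof -
      have "gE * y b = (gE * K_pow b) * casimir_poly (p b)" by (simp add: p mult.assoc)
      also have "\<dots> \<doteq> const (q powi (- 2 * b)) * (K_pow b * gE) * casimir_poly (p b)" by (intro U_eq_rmult E_K_pow)
      also have "\<dots> = const (q powi (- 2 * b)) * K_pow b * (gE * casimir_poly (p b))" by (simp add: mult.assoc)
      also have "\<dots> \<doteq> const (q powi (- 2 * b)) * K_pow b * (casimir_poly (p b) * gE)"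
        by (intro U_eq_lmult U_eq_sym[OF casimir_poly_central])
      finally have "gE * y b - const (q powi (- 2 * b) * h) * y b \<doteq>
          const (q powi (- 2 * b)) * K_pow b * (casimir_poly (p b) * gE) - const (q powi (- 2 * b) * h) * y b"
        by (intro U_eq_diff U_eq_refl)
      also have "\<dots> = (const (q powi (- 2 * b)) * K_pow b * casimir_poly (p b)) * (gE - const h)"
        by (simp add: p const_mult const_commute[of "K_pow b * casimir_poly (p b)"] algebra_simps
            del: mult_minus_left) (metis (no_types) const_commute mult.assoc)
      finally show ?thesis using N_cong N(3,4) by blast
    qed
  qed (use N y(1) sumN that in \<open>auto simp: distrib_left const_left_commute\<close>)
  then have "K_pow b * casimir_poly (p b) \<in> N" if "b \<in> D" for b using that p by simp
  moreover have "casimir_poly (p b) \<doteq> K_pow (- b) * (K_pow b * casimir_poly (p b))" for b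
    using U_eq_rmult[OF K_pow_add[of "-b" b], of "casimir_poly (p b)"] by (simp add: mult.assoc U_eq_sym)
  ultimately have "casimir_poly (p b) \<in> N" if "b \<in> D" for b using that N_cong N(3) by blast
  then show ?thesis using x y(1) p by (intro exI[of _ D] exI[of _ p] exI[of _ d]) simp
qed

end

context uq_generic
begin

section \<open>The universal Whittaker module\<close>

text \<open>
  A model of \<open>U / U (E - h)\<close>: a family \<open>f\<close> stands for \<open>\<Sum>\<^sub>b f\<^sub>b(\<Omega>) K\<^sup>b\<close>, and multiplication of
  polynomials by the indeterminate stands for \<open>\<Omega>\<close>. The action of \<open>F\<close> is forced by
  \<open>F K\<^sup>b = q\<^sup>2\<^sup>b K\<^sup>b F = h\<^sup>-\<^sup>1 q\<^sup>2\<^sup>b K\<^sup>b (\<Omega> - g(K))\<close>. The formulas make sense without any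
  condition of finite support.
\<close>

fun gen_act :: "complex \<Rightarrow> generator \<Rightarrow> (int \<Rightarrow> complex poly) \<Rightarrow> int \<Rightarrow> complex poly" where
  "gen_act h GK f b = f (b - 1)"
| "gen_act h GKinv f b = f (b + 1)"
| "gen_act h GE f b = smult (h * q powi (- 2 * b)) (f b)"
| "gen_act h GF f b = smult (inverse h)
     (pCons 0 (smult (q powi (2 * b)) (f b))
      - smult (ca * q powi (2 * (b - int m))) (f (b - int m))
      - smult (cb * q powi (2 * (b + int m))) (f (b + int m)))"

primrec word_act :: "complex \<Rightarrow> generator list \<Rightarrow> (int \<Rightarrow> complex poly) \<Rightarrow> int \<Rightarrow> complex poly" where
  "word_act h [] f = f"
| "word_act h (g # w) f = gen_act h g (word_act h w f)"

definition whittaker_act :: "complex \<Rightarrow> free_alg \<Rightarrow> (int \<Rightarrow> complex poly) \<Rightarrow> int \<Rightarrow> complex poly" where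
  "whittaker_act h x f b = (\<Sum>w\<in>Poly_Mapping.keys x. smult (Poly_Mapping.lookup x w) (word_act h (letters w) f b))"

lemma gen_act_lin:
  "gen_act h g (\<lambda>b. f b + f' b) = (\<lambda>b. gen_act h g f b + gen_act h g f' b)"
  "gen_act h g (\<lambda>b. p * f b) = (\<lambda>b. p * gen_act h g f b)"
proof -
  show "gen_act h g (\<lambda>b. f b + f' b) = (\<lambda>b. gen_act h g f b + gen_act h g f' b)"
    by (cases g) (simp_all add: fun_eq_iff smult_add_right smult_diff_right)
  show "gen_act h g (\<lambda>b. p * f b) = (\<lambda>b. p * gen_act h g f b)"
    by (cases g) (simp_all add: fun_eq_iff right_diff_distrib)
qed

lemma word_act_lin:
  "word_act h w (\<lambda>b. f b + f' b) = (\<lambda>b. word_act h w f b + word_act h w f' b)"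
  "word_act h w (\<lambda>b. p * f b) = (\<lambda>b. p * word_act h w f b)"
  by (induction w) (simp_all add: gen_act_lin)

lemma whittaker_act_lin:
  "whittaker_act h x (\<lambda>b. f b + f' b) = (\<lambda>b. whittaker_act h x f b + whittaker_act h x f' b)"
  "whittaker_act h x (\<lambda>b. p * f b) = (\<lambda>b. p * whittaker_act h x f b)"
  by (simp_all add: whittaker_act_def fun_eq_iff word_act_lin smult_add_right sum.distrib sum_distrib_left)

lemma whittaker_act_superset:
  assumes "finite S" "Poly_Mapping.keys x \<subseteq> S"
  shows "whittaker_act h x f b = (\<Sum>w\<in>S. smult (Poly_Mapping.lookup x w) (word_act h (letters w) f b))"
  unfolding whittaker_act_def
  by (rule sum.mono_neutral_left) (use assms in \<open>auto simp: in_keys_iff\<close>)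

lemma whittaker_act_add: "whittaker_act h (x + y) f = (\<lambda>b. whittaker_act h x f b + whittaker_act h y f b)"
proof
  fix b
  define S where "S = Poly_Mapping.keys x \<union> Poly_Mapping.keys y"
  have S: "finite S" by (simp add: S_def)
  have "Poly_Mapping.keys (x + y) \<subseteq> S" "Poly_Mapping.keys x \<subseteq> S" "Poly_Mapping.keys y \<subseteq> S"
    using Poly_Mapping.keys_add[of x y] by (auto simp: S_def)
  then show "whittaker_act h (x + y) f b = whittaker_act h x f b + whittaker_act h y f b"
    using S by (simp add: whittaker_act_superset[of S] lookup_add smult_add_left sum.distrib)
qed

lemma whittaker_act_0 [simp]: "whittaker_act h 0 f = (\<lambda>b. 0)"
  by (simp add: whittaker_act_def fun_eq_iff)

lemma whittaker_act_single: "whittaker_act h (Poly_Mapping.single w c) f = (\<lambda>b. smult c (word_act h (letters w) f b))"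
proof
  fix b
  show "whittaker_act h (Poly_Mapping.single w c) f b = smult c (word_act h (letters w) f b)"
    using whittaker_act_superset[of "{w}" "Poly_Mapping.single w c"] by simp
qed

lemma whittaker_act_const [simp]: "whittaker_act h (const c) f = (\<lambda>b. smult c (f b))"
  by (simp add: const_def whittaker_act_single zero_monomial_def)

lemma whittaker_act_1 [simp]: "whittaker_act h 1 f = f"
  using whittaker_act_const[of h 1 f] by simp

lemma whittaker_act_gen [simp]: "whittaker_act h (gen g) f = gen_act h g f"
  by (simp add: gen_def whittaker_act_single)

lemma whittaker_act_smult: "whittaker_act h x (\<lambda>b. smult c (f b)) = (\<lambda>b. smult c (whittaker_act h x f b))"
  using whittaker_act_lin(2)[of h x "[:c:]" f] by simp

lemma whittaker_act_mult: "whittaker_act h (x * y) f = whittaker_act h x (whittaker_act h y f)"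
proof (induction x rule: free_alg_induct)
  case (add x x')
  then show ?case by (simp add: distrib_right whittaker_act_add)
next
  case (const c x)
  have "whittaker_act h (const c * z) f = (\<lambda>b. smult c (whittaker_act h z f b))" for z f
  proof (induction z rule: free_alg_single_induct)
    case (2 x y)
    then show ?case by (simp add: distrib_left whittaker_act_add smult_add_right)
  next
    case (3 w d)
    show ?case by (simp add: const_def mult_single whittaker_act_single)
  qed simp
  then show ?case using const by (simp add: mult.assoc)
next
  case (gen g x)
  have "whittaker_act h (gen g * z) f = gen_act h g (whittaker_act h z f)" for z f
  proof (induction z rule: free_alg_single_induct)
    case 1
    show ?case using gen_act_lin(2)[of h g 0 "\<lambda>b. 0"] by simp
  next
    case (2 x y)
    then show ?case by (simp add: distrib_left whittaker_act_add gen_act_lin)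
  next
    case (3 w d)
    have "gen_act h g (\<lambda>b. smult d (word_act h (letters w) f b))
      = (\<lambda>b. smult d (gen_act h g (word_act h (letters w) f) b))"
      using gen_act_lin(2)[of h g "[:d:]"] by simp
    then show ?case by (simp add: gen_def mult_single whittaker_act_single plus_monomial_def)
  qed
  then show ?case using gen by (simp add: mult.assoc)
qed simp

lemma whittaker_act_minus: "whittaker_act h (- x) f = (\<lambda>b. - whittaker_act h x f b)"
proof -
  have "- x = const (- 1) * x" by (simp add: const_minus)
  then show ?thesis by (simp only: whittaker_act_mult whittaker_act_const) simp
qed

lemma whittaker_act_diff: "whittaker_act h (x - y) f = (\<lambda>b. whittaker_act h x f b - whittaker_act h y f b)"
  using whittaker_act_add[of h x "- y" f] by (simp add: whittaker_act_minus)

lemma whittaker_act_sum: "whittaker_act h (sum y D) f b = (\<Sum>d\<in>D. whittaker_act h (y d) f b)"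
  by (induction D rule: infinite_finite_induct) (simp_all add: whittaker_act_add)

lemma whittaker_act_K_pow: "whittaker_act h (K_pow b) f = (\<lambda>c. f (c - b))"
proof -
  have K: "whittaker_act h (gK ^ n) f = (\<lambda>c. f (c - int n))" for n
    by (induction n) (simp_all add: whittaker_act_mult fun_eq_iff algebra_simps)
  have Ki: "whittaker_act h (gKi ^ n) f = (\<lambda>c. f (c + int n))" for n
    by (induction n) (simp_all add: whittaker_act_mult fun_eq_iff algebra_simps)
  show ?thesis by (simp add: K_pow_def K Ki)
qed

lemma whittaker_act_casimir_K: "whittaker_act h casimir_K f b = smult ca (f (b - int m)) + smult cb (f (b + int m))"
  by (simp add: casimir_K_def whittaker_act_add whittaker_act_mult whittaker_act_K_pow)

lemma whittaker_act_casimir_K_shift: "whittaker_act h casimir_K_shift f b = smult (q powi (- 2 * int m) * ca) (f (b - int m))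
    + smult (q powi (2 * int m) * cb) (f (b + int m))"
  by (simp add: casimir_K_shift_def whittaker_act_add whittaker_act_mult whittaker_act_K_pow)

text \<open>
  With the next lemma: in the model, \<open>F E = \<Omega> - g(K)\<close> and \<open>E F = \<Omega> - g(q\<^sup>-\<^sup>2 K)\<close>, so that the
  difference is \<open>f\<^sub>m(K)\<close>, as the last defining relation requires.
\<close>

lemma whittaker_act_FE: assumes "h \<noteq> 0" shows "whittaker_act h (gF * gE) f b = pCons 0 (f b) - whittaker_act h casimir_K f b"
proof -
  have *: "q powi (2 * c) * (h * q powi (- 2 * c)) = h" for c
    using q_nz by (simp add: power_int_minus)
  have "whittaker_act h (gF * gE) f b = smult (inverse h)
     (pCons 0 (smult (q powi (2 * b) * (h * q powi (- 2 * b))) (f b))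
      - smult (ca * (q powi (2 * (b - int m)) * (h * q powi (- 2 * (b - int m))))) (f (b - int m))
      - smult (cb * (q powi (2 * (b + int m)) * (h * q powi (- 2 * (b + int m))))) (f (b + int m)))"
    by (simp only: whittaker_act_mult whittaker_act_gen gen_act.simps smult_smult mult.assoc)
  also have "\<dots> = pCons 0 (f b) - whittaker_act h casimir_K f b"
  proof -
    have "inverse h * (x * h) = x" for x using assms by (simp add: field_simps)
    then show ?thesis unfolding * using assms by (simp add: whittaker_act_casimir_K smult_diff_right \<open>\<And>x. inverse h * (x * h) = x\<close>)
  qed
  finally show ?thesis .
qed

lemma whittaker_act_EF: assumes "h \<noteq> 0" shows "whittaker_act h (gE * gF) f b = pCons 0 (f b) - whittaker_act h casimir_K_shift f b"
proof -
  have *: "(h * q powi (- 2 * b)) * (inverse h * (x * q powi (2 * (b + c)))) = q powi (2 * c) * x" for c x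
    using q_nz assms by (simp add: power_int_minus power_int_add field_simps)
  have "whittaker_act h (gE * gF) f b = 
     pCons 0 (smult ((h * q powi (- 2 * b)) * (inverse h * (1 * q powi (2 * (b + 0))))) (f b))
      - smult ((h * q powi (- 2 * b)) * (inverse h * (ca * q powi (2 * (b + - int m))))) (f (b - int m))
      - smult ((h * q powi (- 2 * b)) * (inverse h * (cb * q powi (2 * (b + int m))))) (f (b + int m))"
    by (simp add: whittaker_act_mult smult_diff_right mult.assoc)
  also have "\<dots> = pCons 0 (f b) - whittaker_act h casimir_K_shift f b"
    unfolding * by (simp add: whittaker_act_casimir_K_shift)
  finally show ?thesis .
qed

lemma whittaker_act_casimir: "h \<noteq> 0 \<Longrightarrow> whittaker_act h casimir f b = pCons 0 (f b)"
  unfolding casimir_def by (simp add: whittaker_act_add whittaker_act_FE)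

lemma whittaker_act_casimir_poly: assumes "h \<noteq> 0" shows "whittaker_act h (casimir_poly p) f b = p * f b"
  by (induction p) (simp_all add: whittaker_act_add whittaker_act_mult whittaker_act_casimir assms)

lemma whittaker_act_relators:
  assumes "h \<noteq> 0" "x \<in> uq_relators q m" shows "whittaker_act h x f b = 0"
proof -
  have 1: "whittaker_act h (gK * gE) f b = whittaker_act h (const (q^2) * gE * gK) f b" for f b
  proof -
    have "q powi (- 2 * (b - 1)) = q powi (- 2 * b) * q powi 2"
      using q_nz by (subst power_int_add[symmetric]) (simp_all add: algebra_simps)
    then show ?thesis by (simp add: whittaker_act_mult algebra_simps)
  qed
  have 2: "whittaker_act h (gK * gF) f b = whittaker_act h (const (inverse (q^2)) * gF * gK) f b" for f b
  proof -
    have *: "q powi (2 * (c - 1)) = inverse (q^2) * q powi (2 * c)" for c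
      using q_nz by (simp add: right_diff_distrib power_int_diff divide_inverse)
    have a: "whittaker_act h (gK * gF) f b = smult (inverse h)
     (pCons 0 (smult (q powi (2 * (b - 1))) (f (b - 1)))
      - smult (ca * q powi (2 * (b - int m - 1))) (f (b - int m - 1))
      - smult (cb * q powi (2 * (b + int m - 1))) (f (b + int m - 1)))"
      by (simp add: whittaker_act_mult algebra_simps)
    show ?thesis unfolding a *
      by (simp add: whittaker_act_mult smult_diff_right mult.assoc mult.left_commute)
  qed
  have 3: "whittaker_act h (gE * gF) f b = whittaker_act h (gF * gE + f_poly q m) f b" for f b
    by (simp add: whittaker_act_EF whittaker_act_FE whittaker_act_add whittaker_act_diff f_poly_eq assms)
  show ?thesis
    using assms(2) 1 2 3 unfolding uq_relators_def
    by (auto simp: whittaker_act_diff whittaker_act_mult whittaker_act_add simp del: gen_act.simps) (simp_all add: whittaker_act_diff whittaker_act_mult whittaker_act_add)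
qed

text \<open>
  The elements that act by zero form a two-sided ideal, and the relators belong to it. The
  model is thus a module over \<open>U\<close>.
\<close>

lemma whittaker_act_I:
  assumes h: "h \<noteq> 0" and "x \<in> I" shows "whittaker_act h x f b = 0"
proof -
  define J where "J = {x. \<forall>f b. whittaker_act h x f b = 0}"
  have z: "whittaker_act h x (\<lambda>b. 0) = (\<lambda>b. 0)" for x
    using whittaker_act_lin(2)[of h x 0 "\<lambda>b. 0"] by simp
  have "ideal J FA"
  proof (rule idealI)
    show "ring FA" by (rule FA_ring)
    show "subgroup J (add_monoid FA)"
    proof (rule group.subgroupI)
      show "group (add_monoid FA)"
        using FA_ring abelian_group.a_group ring.is_abelian_group by blast
      show "inv\<^bsub>add_monoid FA\<^esub> a \<in> J" if "a \<in> J" for a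
        using that FA_a_inv[of a] by (simp add: J_def whittaker_act_minus a_inv_def)
    qed (auto simp: J_def whittaker_act_add intro: exI[of _ 0])
    show "x \<otimes>\<^bsub>FA\<^esub> a \<in> J" "a \<otimes>\<^bsub>FA\<^esub> x \<in> J" if "a \<in> J" for a x
    proof -
      have "whittaker_act h a f = (\<lambda>b. 0)" for f using that by (simp add: J_def fun_eq_iff)
      then show "x \<otimes>\<^bsub>FA\<^esub> a \<in> J" "a \<otimes>\<^bsub>FA\<^esub> x \<in> J" by (simp_all add: J_def whittaker_act_mult z)
    qed
  qed
  moreover have "uq_relators q m \<subseteq> J"
    using whittaker_act_relators[OF h] by (auto simp: J_def)
  ultimately have "I \<subseteq> J"
    unfolding uq_ideal_def by (rule ring.genideal_minimal[OF FA_ring])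
  then show ?thesis using assms(2) by (auto simp: J_def)
qed

lemma whittaker_act_U_eq: "h \<noteq> 0 \<Longrightarrow> x \<doteq> y \<Longrightarrow> whittaker_act h x f = whittaker_act h y f"
  using whittaker_act_I[of h "x - y" f] by (auto simp: U_eq_def whittaker_act_diff)

definition whittaker_gen :: "int \<Rightarrow> complex poly" where "whittaker_gen b = (if b = 0 then 1 else 0)"

text \<open>
  The coefficient of \<open>K\<^sup>0\<close> in \<open>x w\<close>, where \<open>w\<close> is the generator of the model.
\<close>

definition gen_coeff :: "complex \<Rightarrow> free_alg \<Rightarrow> complex poly" where "gen_coeff h x = whittaker_act h x whittaker_gen 0"

lemma whittaker_act_E_whittaker_gen: "whittaker_act h (gE - const h) whittaker_gen = (\<lambda>b. 0)"
  by (simp add: whittaker_act_diff whittaker_gen_def fun_eq_iff)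

lemma gen_coeff_U_eq: "h \<noteq> 0 \<Longrightarrow> x \<doteq> y \<Longrightarrow> gen_coeff h x = gen_coeff h y"
  by (simp add: gen_coeff_def whittaker_act_U_eq)

lemma gen_coeff_add: "gen_coeff h (x + y) = gen_coeff h x + gen_coeff h y"
  by (simp add: gen_coeff_def whittaker_act_add)

text \<open>
  Together with \<open>gen_coeff_E_mult\<close> this makes the coefficient compatible with right multiplication
  by \<open>\<complex>[\<Omega>]\<close> and by \<open>U\<^sub>q(E)\<close>.
\<close>

lemma gen_coeff_casimir_poly_mult: assumes "h \<noteq> 0" shows "gen_coeff h (x * casimir_poly p) = gen_coeff h x * p"
proof -
  have "whittaker_act h (casimir_poly p) whittaker_gen = (\<lambda>b. p * whittaker_gen b)" using whittaker_act_casimir_poly[OF assms] by blast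
  then show ?thesis by (simp add: gen_coeff_def whittaker_act_mult whittaker_act_lin)
qed

lemma gen_coeff_casimir_poly: "h \<noteq> 0 \<Longrightarrow> gen_coeff h (casimir_poly p) = p"
  by (simp add: gen_coeff_def whittaker_act_casimir_poly whittaker_gen_def)

lemma gen_coeff_E_mult: "gen_coeff h (x * (const c + d * (gE - const h))) = smult c (gen_coeff h x)"
proof -
  have "whittaker_act h d (\<lambda>b. 0) = (\<lambda>b. 0)"
    using whittaker_act_lin(2)[of h d 0 "\<lambda>b. 0"] by simp
  then have "whittaker_act h (const c + d * (gE - const h)) whittaker_gen = (\<lambda>b. smult c (whittaker_gen b))"
    by (simp add: whittaker_act_add whittaker_act_mult whittaker_act_E_whittaker_gen)
  then show ?thesis by (simp add: gen_coeff_def whittaker_act_mult whittaker_act_smult)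
qed

section \<open>The centre\<close>

lemma conj_K_weight: "gK * x * gKi \<doteq> const c * x" if "K_weight c x" for c x
proof -
  have "gK * x * gKi \<doteq> const c * (x * gK) * gKi"
    using that by (intro U_eq_rmult) (simp add: K_weight_def)
  also have "\<dots> = const c * (x * (gK * gKi))" by (simp add: mult.assoc)
  also have "\<dots> \<doteq> const c * (x * 1)" by (intro U_eq_lmult rel_KKi)
  finally show ?thesis by simp
qed

text \<open>
  Decompose \<open>z\<close> into weight vectors \<open>y\<^sub>d\<close>. Since conjugation by \<open>K\<close> fixes \<open>z\<close>, the sum of
  \<open>(q\<^sup>2\<^sup>d - 1) y\<^sub>d\<close> vanishes in \<open>U\<close>, hence so does each summand; only \<open>y\<^sub>0\<close> remains.
\<close>

lemma weight_zero:
  assumes "gK * z \<doteq> z * gK" shows "z \<in> A"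
proof -
  obtain D y where y: "finite D" "\<And>d. y d \<in> weight_part d" "z \<doteq> sum y D"
    using weight_decomposition[of z] unfolding graded_sum_def by blast
  have yd: "gK * y d * gKi - const (q powi (2 * d)) * y d \<in> I" for d
    using conj_K_weight[OF K_weight_weight_part[OF y(2)]] by (simp add: U_eq_def)
  define y' where "y' d = const (q powi (2 * d) - 1) * y d" for d
  have ad: "gK * z * gKi \<doteq> z"
    using conj_K_weight[of 1 z] assms by (simp add: K_weight_def)
  have "sum y' D = (\<Sum>d\<in>D. const (q powi (2 * d)) * y d) - sum y D"
    by (simp add: y'_def const_diff left_diff_distrib sum_subtractf)
  also have "\<dots> \<doteq> (\<Sum>d\<in>D. gK * y d * gKi) - sum y D"
    by (intro U_eq_diff U_eq_sum U_eq_refl U_eq_sym[OF conj_K_weight[OF K_weight_weight_part[OF y(2)]]])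
  also have "\<dots> = gK * sum y D * gKi - sum y D"
    by (simp add: sum_distrib_left sum_distrib_right)
  also have "\<dots> \<doteq> gK * z * gKi - z"
    by (intro U_eq_diff U_eq_lmult U_eq_rmult U_eq_sym[OF y(3)])
  also have "\<dots> \<doteq> z - z" by (intro U_eq_diff ad U_eq_refl)
  finally have sum0: "sum y' D \<in> I" by (simp add: U_eq_def)
  have "y' d \<in> I" if "d \<in> D" for d
  proof (rule eigen_separation[where T = "\<lambda>x. gK * x * gKi" and l = "\<lambda>d. q powi (2 * d)"])
    show "inj_on (\<lambda>d. q powi (2 * d)) D" by (auto simp: inj_on_def q_powi_inj)
    show "gK * y' d * gKi - const (q powi (2 * d)) * y' d \<in> I" for d
    proof -
      have "const (q powi (2 * d) - 1) * const (q powi (2 * d)) = const (q powi (2 * d)) * const (q powi (2 * d) - 1)"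
        by (simp add: const_mult[symmetric] mult.commute)
      then have "gK * y' d * gKi - const (q powi (2 * d)) * y' d
        = const (q powi (2 * d) - 1) * (gK * y d * gKi - const (q powi (2 * d)) * y d)"
        by (simp add: y'_def right_diff_distrib const_left_commute[of gK] mult.assoc[symmetric])
          (simp add: mult.assoc const_left_commute[of gK])
      then show ?thesis using I_lmult[OF yd] by simp
    qed
  qed (use y(1) sum0 that in \<open>auto simp: algebra_simps const_left_commute[of gK] intro: I_add I_lmult I_rmult\<close>)
  then have y0: "y d \<doteq> 0" if "d \<in> D" "d \<noteq> 0" for d
  proof -
    have "q powi (2 * d) - 1 \<noteq> 0" using q_powi_inj[of "2 * d" 0] that(2) by simp
    then have "y d = const (inverse (q powi (2 * d) - 1)) * y' d" by (simp add: y'_def const_mult_assoc)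
    then show ?thesis using I_lmult \<open>\<And>d. d \<in> D \<Longrightarrow> y' d \<in> I\<close>[OF that(1)] by (simp add: U_eq_0_iff)
  qed
  have "y 0 \<in> A" using y(2)[of 0] by (auto simp: weight_part_def EF_pow_def)
  have "sum y D \<doteq> sum (\<lambda>d. if d = 0 then y 0 else 0) D"
    using y0 by (intro U_eq_sum) auto
  then have "z \<doteq> sum (\<lambda>d. if d = 0 then y 0 else 0) D" by (rule U_eq_trans[OF y(3)])
  then have "z \<doteq> (if 0 \<in> D then y 0 else 0)" using y(1) by simp
  moreover have "(if 0 \<in> D then y 0 else 0) \<in> A" using \<open>y 0 \<in> A\<close> A_0 by simp
  ultimately show ?thesis using A_cong by blast
qed

text \<open>
  Applied to the generator \<open>w\<close> of the model, a central \<open>z = \<Sum>\<^sub>b K\<^sup>b p\<^sub>b(\<Omega>)\<close> gives the family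
  \<open>(p\<^sub>b)\<close>. The operators \<open>z E\<close> and \<open>E z\<close> multiply the entry at \<open>b\<close> by \<open>h\<close> and by \<open>q\<^sup>-\<^sup>2\<^sup>b h\<close>,
  whence \<open>p\<^sub>b = 0\<close> for \<open>b \<noteq> 0\<close>. Any \<open>h \<noteq> 0\<close> serves; it is taken to be \<open>1\<close>.
\<close>

lemma central_imp_casimir_poly:
  assumes z: "\<And>x. z * x \<doteq> x * z"
  shows "\<exists>p. z \<doteq> casimir_poly p"
proof -
  have "z \<in> A" using weight_zero U_eq_sym[OF z[of gK]] by simp
  then obtain D y where y: "finite D" "\<And>b. y b \<in> A0 b" "z \<doteq> sum y D"
    unfolding A_def graded_sum_def by blast
  have "\<exists>p. \<forall>b. y b = K_pow b * casimir_poly (p b)"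
    using y(2) unfolding A0_def by (intro choice) auto
  then obtain p where p: "\<And>b. y b = K_pow b * casimir_poly (p b)" by blast
  have zb: "whittaker_act 1 z whittaker_gen b = (if b \<in> D then p b else 0)" for b
  proof -
    have "whittaker_act 1 z whittaker_gen b = (\<Sum>d\<in>D. p d * whittaker_gen (b - d))"
      by (simp add: whittaker_act_U_eq[OF _ y(3)] whittaker_act_sum p whittaker_act_mult whittaker_act_K_pow whittaker_act_casimir_poly)
    also have "\<dots> = (\<Sum>d\<in>D. if d = b then p b else 0)"
      by (intro sum.cong) (auto simp: whittaker_gen_def)
    finally show ?thesis using y(1) by simp
  qed
  have "p b = 0" if "b \<in> D" "b \<noteq> 0" for b
  proof -
    have "whittaker_act 1 (gE * z) whittaker_gen b = whittaker_act 1 (z * gE) whittaker_gen b" by (simp add: whittaker_act_U_eq[OF _ z])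
    moreover have "whittaker_act 1 gE whittaker_gen = whittaker_gen" by (simp add: whittaker_gen_def fun_eq_iff)
    ultimately have "smult (q powi (- 2 * b)) (p b) = p b"
      using that(1) by (simp add: whittaker_act_mult zb del: mult_minus_left)
    moreover have "q powi (- 2 * b) \<noteq> 1" using q_powi_inj[of "- 2 * b" 0] that(2) by simp
    ultimately show ?thesis
      using smult_diff_left[of "q powi (- 2 * b)" 1 "p b"] by simp
  qed
  then have "sum y D = sum (\<lambda>b. if b = 0 then casimir_poly (p 0) else 0) D"
    by (intro sum.cong) (auto simp: p)
  then have "z \<doteq> casimir_poly (if 0 \<in> D then p 0 else 0)" using y(1,3) by auto
  then show ?thesis by blast
qed

end

section \<open>Additive maps from free abelian groups\<close>

text \<open>
  The additive extension of \<open>f\<close> to formal sums, which is the expression inside \<^const>\<open>tensor_lift\<close>.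
\<close>

definition frag_eval :: "('g, 'a) ring_scheme \<Rightarrow> ('x \<Rightarrow> 'g) \<Rightarrow> ('x \<Rightarrow>\<^sub>0 int) \<Rightarrow> 'g" where
  "frag_eval G f p = (\<Oplus>\<^bsub>G\<^esub>s\<in>Poly_Mapping.keys p. [Poly_Mapping.lookup p s] \<cdot>\<^bsub>G\<^esub> f s)"

lemma frag_eval_superset:
  assumes G: "abelian_group G" and f: "f ` B \<subseteq> carrier G" and S: "finite S" "Poly_Mapping.keys p \<subseteq> S" "S \<subseteq> B"
  shows "frag_eval G f p = (\<Oplus>\<^bsub>G\<^esub>s\<in>S. [Poly_Mapping.lookup p s] \<cdot>\<^bsub>G\<^esub> f s)"
proof -
  interpret G: abelian_group G by (rule G)
  have c: "[k] \<cdot>\<^bsub>G\<^esub> f s \<in> carrier G" if "s \<in> S" for s and k :: int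
    using G.add.int_pow_closed[of "f s" k] f S(3) that by auto
  show ?thesis unfolding frag_eval_def
    by (rule G.add.finprod_mono_neutral_cong_left)
      (use S c in \<open>auto simp: in_keys_iff add_pow_def\<close>)
qed

lemma frag_eval_hom:
  assumes G: "abelian_group G" and f: "f ` B \<subseteq> carrier G"
  shows "frag_eval G f \<in> hom (free_Abelian_group B) (add_monoid G)"
proof -
  interpret G: abelian_group G by (rule G)
  have c: "[k] \<cdot>\<^bsub>G\<^esub> f s \<in> carrier G" if "s \<in> B" for s and k :: int
    using G.add.int_pow_closed[of "f s" k] f that by auto
  show ?thesis
  proof (rule homI)
    fix p assume p: "p \<in> carrier (free_Abelian_group B)"
    show "frag_eval G f p \<in> carrier (add_monoid G)"
      unfolding frag_eval_def using p c by (auto intro!: G.finsum_closed)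
    fix r assume r: "r \<in> carrier (free_Abelian_group B)"
    define S where "S = Poly_Mapping.keys p \<union> Poly_Mapping.keys r"
    have S: "finite S" "S \<subseteq> B" using p r by (auto simp: S_def)
    have k: "Poly_Mapping.keys p \<subseteq> S" "Poly_Mapping.keys r \<subseteq> S" "Poly_Mapping.keys (p + r) \<subseteq> S"
      using Poly_Mapping.keys_add[of p r] by (auto simp: S_def)
    have "frag_eval G f (p + r) = (\<Oplus>\<^bsub>G\<^esub>s\<in>S. [Poly_Mapping.lookup p s] \<cdot>\<^bsub>G\<^esub> f s \<oplus>\<^bsub>G\<^esub> [Poly_Mapping.lookup r s] \<cdot>\<^bsub>G\<^esub> f s)"
      unfolding frag_eval_superset[OF G f S(1) k(3) S(2)]
    proof (rule G.finsum_cong')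
      fix i assume "i \<in> S"
      then have "f i \<in> carrier G" using S f by auto
      then show "[Poly_Mapping.lookup (p + r) i] \<cdot>\<^bsub>G\<^esub> f i = [Poly_Mapping.lookup p i] \<cdot>\<^bsub>G\<^esub> f i \<oplus>\<^bsub>G\<^esub> [Poly_Mapping.lookup r i] \<cdot>\<^bsub>G\<^esub> f i"
        using G.add.int_pow_mult[of "f i"] by (simp add: lookup_add)
    qed (use c S in auto)
    also have "\<dots> = frag_eval G f p \<oplus>\<^bsub>G\<^esub> frag_eval G f r"
      unfolding frag_eval_superset[OF G f S(1) k(1) S(2)] frag_eval_superset[OF G f S(1) k(2) S(2)]
      by (rule G.finsum_addf) (use c S in auto)
    finally show "frag_eval G f (p \<otimes>\<^bsub>free_Abelian_group B\<^esub> r)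
        = frag_eval G f p \<otimes>\<^bsub>add_monoid G\<^esub> frag_eval G f r" by simp
  qed
qed

lemma frag_eval_of:
  assumes G: "abelian_group G" and "f x \<in> carrier G"
  shows "frag_eval G f (frag_of x) = f x"
proof -
  interpret G: abelian_group G by (rule G)
  show ?thesis
    using assms(2) G.add.int_pow_1[of "f x"] by (simp add: frag_eval_def keys_frag_of)
qed

lemma frag_hom_eqI:
  assumes G: "group G" and h: "g \<in> hom (free_Abelian_group B) G" "h \<in> hom (free_Abelian_group B) G"
    and eq: "\<And>x. x \<in> B \<Longrightarrow> g (frag_of x) = h (frag_of x)" and p: "Poly_Mapping.keys p \<subseteq> B"
  shows "g p = h p"
proof -
  interpret g: group_hom "free_Abelian_group B" G g
    using h(1) G by (simp add: group_hom_def group_hom_axioms_def)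
  interpret h: group_hom "free_Abelian_group B" G h
    using h(2) G by (simp add: group_hom_def group_hom_axioms_def)
  show ?thesis
    using p
  proof (induction p rule: free_Abelian_group_induct[consumes 1])
    case 1
    then show ?case using g.hom_one h.hom_one by simp
  next
    case (2 x y)
    have "k (x - y) = k x \<otimes>\<^bsub>G\<^esub> inv\<^bsub>G\<^esub> (k y)" if "group_hom (free_Abelian_group B) G k" for k
      using 2(1,2) group_hom.hom_mult[OF that, of x "- y"] group_hom.hom_inv[OF that, of y] by simp
    from this[OF g.group_hom_axioms] this[OF h.group_hom_axioms] show ?case using 2(3,4) by simp
  qed (rule eq)
qed

lemma frag_eval_cong:
  "(\<And>x. x \<in> Poly_Mapping.keys p \<Longrightarrow> f x = f' x) \<Longrightarrow> (\<And>x. x \<in> Poly_Mapping.keys p \<Longrightarrow> f' x \<in> carrier G)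
    \<Longrightarrow> abelian_group G \<Longrightarrow> frag_eval G f p = frag_eval G f' p"
proof -
  assume *: "\<And>x. x \<in> Poly_Mapping.keys p \<Longrightarrow> f x = f' x" "\<And>x. x \<in> Poly_Mapping.keys p \<Longrightarrow> f' x \<in> carrier G"
    and G: "abelian_group G"
  interpret G: abelian_group G by (rule G)
  have "[k] \<cdot>\<^bsub>G\<^esub> f' x \<in> carrier G" if "x \<in> Poly_Mapping.keys p" for x and k :: int
    using G.add.int_pow_closed[of "f' x" k] *(2)[OF that] by simp
  then show ?thesis unfolding frag_eval_def by (intro G.finsum_cong') (auto simp: *)
qed

text \<open>
  The scalars of the tensor products below are themselves tensors. By this lemma a condition that
  is additive in the scalar has to be checked on pure tensors only.
\<close>

lemma hom_frag_eval:
  assumes G: "abelian_group G" "abelian_group H" and g: "g \<in> hom (add_monoid G) (add_monoid H)"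
    and f: "f ` B \<subseteq> carrier G" and p: "Poly_Mapping.keys p \<subseteq> B"
  shows "g (frag_eval G f p) = frag_eval H (\<lambda>x. g (f x)) p"
proof (rule frag_hom_eqI[where B = B and G = "add_monoid H" and g = "\<lambda>p. g (frag_eval G f p)"])
  show "group (add_monoid H)" using G(2) abelian_group.a_group by blast
  have gf: "(\<lambda>x. g (f x)) ` B \<subseteq> carrier H" using f g by (auto simp: hom_def)
  show "(\<lambda>p. g (frag_eval G f p)) \<in> hom (free_Abelian_group B) (add_monoid H)"
    using hom_compose[OF frag_eval_hom[OF G(1) f] g] by (simp add: comp_def)
  show "frag_eval H (\<lambda>x. g (f x)) \<in> hom (free_Abelian_group B) (add_monoid H)"
    by (rule frag_eval_hom[OF G(2) gf])
  show "g (frag_eval G f (frag_of x)) = frag_eval H (\<lambda>x. g (f x)) (frag_of x)" if "x \<in> B" for x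
    using that f gf by (subst (1 2) frag_eval_of) (auto simp: G)
qed (rule p)

section \<open>Tensor products\<close>

locale tensor_pair =
  fixes S :: "'s set" and M :: "('x, 'a) ring_scheme" and ra :: "'x \<Rightarrow> 's \<Rightarrow> 'x"
    and N :: "('y, 'b) ring_scheme" and la :: "'s \<Rightarrow> 'y \<Rightarrow> 'y"
  assumes M: "abelian_group M" and N: "abelian_group N"
    and ra_closed: "\<And>x s. x \<in> carrier M \<Longrightarrow> s \<in> S \<Longrightarrow> ra x s \<in> carrier M"
    and la_closed: "\<And>s y. s \<in> S \<Longrightarrow> y \<in> carrier N \<Longrightarrow> la s y \<in> carrier N"
begin

abbreviation "P \<equiv> carrier M \<times> carrier N"
abbreviation "FP \<equiv> free_Abelian_group P"
abbreviation "TK \<equiv> tensor_kernel S M ra N la"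
abbreviation "TG \<equiv> tensor_group S M ra N la"
abbreviation "coset_of \<equiv> tensor_coset S M ra N la"

interpretation M: abelian_group M by (rule M)
interpretation N: abelian_group N by (rule N)
interpretation FP: comm_group FP by (rule abelian_free_Abelian_group)

lemma keys_diff_subset:
  "Poly_Mapping.keys a \<subseteq> B \<Longrightarrow> Poly_Mapping.keys b \<subseteq> B \<Longrightarrow> Poly_Mapping.keys (a - b) \<subseteq> B"
  for a b :: "'z \<Rightarrow>\<^sub>0 int"
  using keys_diff[of a b] by blast

lemma relators_carrier: "tensor_relators S M ra N la \<subseteq> carrier FP"
proof
  fix r assume "r \<in> tensor_relators S M ra N la"
  then show "r \<in> carrier FP"
    unfolding tensor_relators_def carrier_free_Abelian_group_iff
    by (-, elim UnE CollectE exE conjE; simp only:;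
        intro keys_diff_subset; simp add: keys_frag_of ra_closed la_closed)
qed

lemma kernel_subgroup: "subgroup TK FP"
  unfolding tensor_kernel_def by (rule FP.generate_is_subgroup[OF relators_carrier])

lemma kernel_normal: "normal TK FP"
  by (rule FP.subgroup_imp_normal[OF kernel_subgroup])

lemma kernel_carrier: "p \<in> TK \<Longrightarrow> Poly_Mapping.keys p \<subseteq> P"
  using subsetD[OF subgroup.subset[OF kernel_subgroup], of p] by (simp only: carrier_free_Abelian_group_iff)

lemma kernel_0: "0 \<in> TK"
  using subgroup.one_closed[OF kernel_subgroup] by simp

lemma kernel_minus: "p \<in> TK \<Longrightarrow> - p \<in> TK"
  using subgroup.m_inv_closed[OF kernel_subgroup, of p] by (simp add: kernel_carrier)

lemma kernel_add: "p \<in> TK \<Longrightarrow> r \<in> TK \<Longrightarrow> p + r \<in> TK"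
  using subgroup.m_closed[OF kernel_subgroup, of p r] by simp

lemma relator_kernel: "p \<in> tensor_relators S M ra N la \<Longrightarrow> p \<in> TK"
  unfolding tensor_kernel_def by (rule generate.incl)

lemma kernel_induct [consumes 1, case_names relator zero add minus]:
  assumes "p \<in> TK" "\<And>r. r \<in> tensor_relators S M ra N la \<Longrightarrow> Q r" "Q 0"
    and "\<And>r s. r \<in> TK \<Longrightarrow> s \<in> TK \<Longrightarrow> Q r \<Longrightarrow> Q s \<Longrightarrow> Q (r + s)" "\<And>r. r \<in> TK \<Longrightarrow> Q r \<Longrightarrow> Q (- r)"
  shows "Q p"
proof -
  have "p \<in> TK \<and> Q p"
    using assms(1) unfolding tensor_kernel_def
  proof (induction rule: generate.induct)
    case one
    then show ?case using assms(3) kernel_0 by (simp add: tensor_kernel_def)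
  next
    case (incl h)
    then show ?case using assms(2) by (simp add: generate.incl)
  next
    case (inv h)
    then have "h \<in> TK" by (rule relator_kernel)
    moreover have "inv\<^bsub>FP\<^esub> h = - h" using kernel_carrier[OF \<open>h \<in> TK\<close>] by simp
    ultimately show ?case using assms(2,5) inv kernel_minus by (simp add: tensor_kernel_def)
  next
    case (eng h1 h2)
    then show ?case using assms(4) kernel_add by (simp add: tensor_kernel_def)
  qed
  then show ?thesis ..
qed

lemma coset_of_alt: "coset_of p = {k + p | k. k \<in> TK}"
  by (auto simp: tensor_coset_def r_coset_def)

lemma coset_of_eq_iff: "coset_of p = coset_of r \<longleftrightarrow> p - r \<in> TK"
proof
  assume "coset_of p = coset_of r"
  moreover have "p \<in> coset_of p" using kernel_0 by (auto simp: coset_of_alt intro!: exI[of _ 0])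
  ultimately show "p - r \<in> TK" by (auto simp: coset_of_alt)
next
  assume *: "p - r \<in> TK"
  show "coset_of p = coset_of r"
  proof (intro Set.set_eqI iffI)
    fix x assume "x \<in> coset_of p"
    then obtain k where "k \<in> TK" "x = k + p" by (auto simp: coset_of_alt)
    then have "x = (k + (p - r)) + r" "k + (p - r) \<in> TK" using kernel_add * by auto
    then show "x \<in> coset_of r" unfolding coset_of_alt by blast
  next
    fix x assume "x \<in> coset_of r"
    then obtain k where "k \<in> TK" "x = k + r" by (auto simp: coset_of_alt)
    then have "x = (k + - (p - r)) + p" "k + - (p - r) \<in> TK"
      using kernel_add kernel_minus[OF *] by auto
    then show "x \<in> coset_of p" unfolding coset_of_alt by blast
  qed
qed

lemma carrier_TG: "carrier TG = coset_of ` carrier FP"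
  by (auto simp: tensor_group_def FactGroup_def RCOSETS_def tensor_coset_def)

lemma coset_of_in: "Poly_Mapping.keys p \<subseteq> P \<Longrightarrow> coset_of p \<in> carrier TG"
  by (auto simp: carrier_TG)

lemma TG_cases:
  assumes "t \<in> carrier TG" obtains p where "Poly_Mapping.keys p \<subseteq> P" "t = coset_of p"
  using assms by (auto simp: carrier_TG)

lemma TG_mult: "Poly_Mapping.keys p \<subseteq> P \<Longrightarrow> Poly_Mapping.keys r \<subseteq> P \<Longrightarrow> coset_of p \<otimes>\<^bsub>TG\<^esub> coset_of r = coset_of (p + r)"
  using normal.rcos_sum[OF kernel_normal, of p r]
  by (simp add: tensor_group_def FactGroup_def tensor_coset_def)

lemma TG_group: "group TG"
  unfolding tensor_group_def by (rule normal.factorgroup_is_group[OF kernel_normal])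

lemma TG_comm_group: "comm_group TG"
  by (rule group.group_comm_groupI[OF TG_group])
    (auto simp: carrier_TG TG_mult add.commute)

lemma TG_one: "\<one>\<^bsub>TG\<^esub> = coset_of 0"
proof -
  have "coset_of 0 \<otimes>\<^bsub>TG\<^esub> coset_of 0 = coset_of 0" by (simp add: TG_mult)
  then show ?thesis using group.l_cancel_one[OF TG_group, of "coset_of 0" "coset_of 0"] coset_of_in[of 0] by simp
qed

text \<open>
  The maps that factor through the tensor product.
\<close>

definition balanced_map :: "('g, 'c) ring_scheme \<Rightarrow> ('x \<times> 'y \<Rightarrow> 'g) \<Rightarrow> bool" where
  "balanced_map G f \<longleftrightarrow> abelian_group G \<and>
     (\<forall>x\<in>carrier M. \<forall>y\<in>carrier N. f (x, y) \<in> carrier G) \<and>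
     (\<forall>x\<in>carrier M. \<forall>x'\<in>carrier M. \<forall>y\<in>carrier N. f (x \<oplus>\<^bsub>M\<^esub> x', y) = f (x, y) \<oplus>\<^bsub>G\<^esub> f (x', y)) \<and>
     (\<forall>x\<in>carrier M. \<forall>y\<in>carrier N. \<forall>y'\<in>carrier N. f (x, y \<oplus>\<^bsub>N\<^esub> y') = f (x, y) \<oplus>\<^bsub>G\<^esub> f (x, y')) \<and>
     (\<forall>x\<in>carrier M. \<forall>s\<in>S. \<forall>y\<in>carrier N. f (ra x s, y) = f (x, la s y))"

context
  fixes G :: "('g, 'c) ring_scheme" and f :: "'x \<times> 'y \<Rightarrow> 'g"
  assumes f: "balanced_map G f"
begin

lemma balanced_abelian_group: "abelian_group G" and balanced_img: "f ` P \<subseteq> carrier G"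
  using f by (auto simp: balanced_map_def)

interpretation G: abelian_group G by (rule balanced_abelian_group)

interpretation phi: group_hom FP "add_monoid G" "frag_eval G f"
  using frag_eval_hom[OF balanced_abelian_group balanced_img]
  by (simp add: group_hom_def group_hom_axioms_def G.a_group)

lemma frag_eval_add:
  "Poly_Mapping.keys p \<subseteq> P \<Longrightarrow> Poly_Mapping.keys r \<subseteq> P \<Longrightarrow> frag_eval G f (p + r) = frag_eval G f p \<oplus>\<^bsub>G\<^esub> frag_eval G f r"
  using phi.hom_mult[of p r] by simp

lemma frag_eval_minus:
  "Poly_Mapping.keys p \<subseteq> P \<Longrightarrow> frag_eval G f (- p) = \<ominus>\<^bsub>G\<^esub> frag_eval G f p"
  using phi.hom_inv[of p] by (simp add: a_inv_def)

lemma frag_eval_closed: "Poly_Mapping.keys p \<subseteq> P \<Longrightarrow> frag_eval G f p \<in> carrier G"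
  using phi.hom_closed[of p] by simp

lemma frag_eval_diff:
  "Poly_Mapping.keys p \<subseteq> P \<Longrightarrow> Poly_Mapping.keys r \<subseteq> P \<Longrightarrow> frag_eval G f (p - r) = frag_eval G f p \<ominus>\<^bsub>G\<^esub> frag_eval G f r"
  using frag_eval_add[of p "- r"] frag_eval_minus[of r] by (simp add: a_minus_def)

lemma frag_eval_frag: "x \<in> carrier M \<Longrightarrow> y \<in> carrier N \<Longrightarrow> frag_eval G f (frag_of (x, y)) = f (x, y)"
  using balanced_img by (intro frag_eval_of[OF balanced_abelian_group]) auto

lemma frag_eval_kernel:
  assumes "p \<in> TK" shows "frag_eval G f p = \<zero>\<^bsub>G\<^esub>"
  using assms
proof (induction rule: kernel_induct)
  case relator
  have c: "f (x, y) \<in> carrier G" if "x \<in> carrier M" "y \<in> carrier N" for x y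
    using balanced_img that by auto
  have z: "(a \<oplus>\<^bsub>G\<^esub> b) \<ominus>\<^bsub>G\<^esub> a \<ominus>\<^bsub>G\<^esub> b = \<zero>\<^bsub>G\<^esub>" if "a \<in> carrier G" "b \<in> carrier G" for a b
    using that by (simp add: a_minus_def G.a_assoc G.a_comm[of a b] G.r_neg G.r_neg1 G.r_neg2)
  have z': "a \<ominus>\<^bsub>G\<^esub> a = \<zero>\<^bsub>G\<^esub>" if "a \<in> carrier G" for a
    using that by (simp add: a_minus_def G.r_neg)
  from relator show ?case unfolding tensor_relators_def
    using f ra_closed la_closed
    by (auto simp: frag_eval_diff frag_eval_frag keys_frag_of keys_diff_subset balanced_map_def z z' c)
next
  case zero
  show ?case using phi.hom_one by simp
next
  case (add r s)
  then show ?case using frag_eval_add kernel_carrier by simp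
next
  case (minus r)
  then show ?case using frag_eval_minus kernel_carrier by simp
qed

lemma tensor_lift_coset_of:
  assumes "Poly_Mapping.keys p \<subseteq> P" shows "tensor_lift G f (coset_of p) = frag_eval G f p"
proof -
  have "frag_eval G f (k + p) = frag_eval G f p" if "k \<in> TK" for k
    using frag_eval_add[OF kernel_carrier[OF that] assms] frag_eval_kernel[OF that] frag_eval_closed[OF assms]
    by simp
  then have "frag_eval G f ` coset_of p = {frag_eval G f p}"
    unfolding coset_of_alt using kernel_0 by (auto simp: image_iff intro!: exI[of _ 0])
  then show ?thesis by (simp add: tensor_lift_def frag_eval_def)
qed

lemma tensor_lift_closed: "t \<in> carrier TG \<Longrightarrow> tensor_lift G f t \<in> carrier G"
  by (auto elim!: TG_cases simp: tensor_lift_coset_of frag_eval_closed)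

lemma tensor_lift_frag: "x \<in> carrier M \<Longrightarrow> y \<in> carrier N \<Longrightarrow> tensor_lift G f (coset_of (frag_of (x, y))) = f (x, y)"
  by (subst tensor_lift_coset_of) (simp_all add: keys_frag_of frag_eval_frag)

end

end

context tensor_pair
begin

abbreviation "ext g \<equiv> frag_extend (\<lambda>(x, y). frag_of (g x, y))"

context
  fixes g :: "'x \<Rightarrow> 'x"
  assumes g_closed: "\<And>x. x \<in> carrier M \<Longrightarrow> g x \<in> carrier M"
    and g_add: "\<And>x x'. x \<in> carrier M \<Longrightarrow> x' \<in> carrier M \<Longrightarrow> g (x \<oplus>\<^bsub>M\<^esub> x') = g x \<oplus>\<^bsub>M\<^esub> g x'"
    and g_ra: "\<And>x s. x \<in> carrier M \<Longrightarrow> s \<in> S \<Longrightarrow> g (ra x s) = ra (g x) s"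
begin

text \<open>
  An additive map of the left factor that commutes with the right action sends relators to relators,
  and therefore acts on the tensor product.
\<close>

lemma ext_kernel:
  assumes "p \<in> TK" shows "ext g p \<in> TK"
  using assms
proof (induction rule: kernel_induct)
  case (relator r)
  then have "ext g r \<in> tensor_relators S M ra N la"
    unfolding tensor_relators_def Un_iff mem_Collect_eq
  proof (elim disjE exE conjE, goal_cases)
    case (1 x x' y)
    then show ?case
      by (intro disjI1 exI[of _ "g x"] exI[of _ "g x'"] exI[of _ y])
        (simp add: frag_extend_diff g_add g_closed)
  next
    case (2 x y y')
    then show ?case
      by (intro disjI1[OF disjI2] exI[of _ "g x"] exI[of _ y] exI[of _ y'])
        (simp add: frag_extend_diff g_closed)
  next
    case (3 x s y)
    then show ?case
      by (intro disjI2 exI[of _ "g x"] exI[of _ s] exI[of _ y])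
        (simp add: frag_extend_diff g_ra g_closed)
  qed
  then show ?case by (rule relator_kernel)
next
  case zero
  show ?case using kernel_0 by simp
next
  case (add r s)
  then show ?case by (simp add: frag_extend_add kernel_add)
next
  case (minus r)
  then show ?case by (simp add: frag_extend_minus kernel_minus)
qed

lemma ext_coset: "(\<Union>p\<in>coset_of p0. coset_of (ext g p)) = coset_of (ext g p0)"
proof -
  have "coset_of (ext g p) = coset_of (ext g p0)" if p: "p \<in> coset_of p0" for p
  proof -
    obtain k where k: "k \<in> TK" "p = k + p0" using p by (auto simp: coset_of_alt)
    then have "ext g p - ext g p0 \<in> TK" using ext_kernel[OF k(1)] by (simp add: frag_extend_add)
    then show ?thesis by (simp add: coset_of_eq_iff)
  qed
  moreover have "p0 \<in> coset_of p0" using kernel_0 by (auto simp: coset_of_alt intro!: exI[of _ 0])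
  ultimately show ?thesis by blast
qed

end

lemma coset_of_add_left:
  assumes "x \<in> carrier M" "x' \<in> carrier M" "y \<in> carrier N"
  shows "coset_of (frag_of (x \<oplus>\<^bsub>M\<^esub> x', y)) = coset_of (frag_of (x, y) + frag_of (x', y))"
proof -
  have "frag_of (x \<oplus>\<^bsub>M\<^esub> x', y) - frag_of (x, y) - frag_of (x', y) \<in> TK"
    by (rule relator_kernel) (use assms in \<open>auto simp: tensor_relators_def\<close>)
  then show ?thesis by (simp add: coset_of_eq_iff diff_diff_eq)
qed

lemma coset_of_balanced:
  assumes "x \<in> carrier M" "s \<in> S" "y \<in> carrier N"
  shows "coset_of (frag_of (ra x s, y)) = coset_of (frag_of (x, la s y))"
proof -
  have "frag_of (ra x s, y) - frag_of (x, la s y) \<in> TK"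
    by (rule relator_kernel) (use assms in \<open>auto simp: tensor_relators_def\<close>)
  then show ?thesis by (simp add: coset_of_eq_iff)
qed

end

context uq_generic
begin

abbreviation "U \<equiv> Uq q m"
abbreviation "cl \<equiv> uq_class q m"
abbreviation "sc \<equiv> uq_scalar q m"

section \<open>Classes in the algebra\<close>

lemma U_ring: "ring U"
  unfolding Uq_def by (rule ideal.quotient_is_ring[OF ideal_I])

lemma cl_hom: "cl \<in> ring_hom FA U"
proof -
  have "cl = (+>\<^bsub>FA\<^esub>) I" by (simp add: uq_class_def fun_eq_iff)
  then show ?thesis unfolding Uq_def using ideal.rcos_ring_hom[OF ideal_I] by simp
qed

lemma cl_mult: "cl x \<otimes>\<^bsub>U\<^esub> cl y = cl (x * y)"
  using ring_hom_mult[OF cl_hom, of x y] by simp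

lemma cl_add: "cl x \<oplus>\<^bsub>U\<^esub> cl y = cl (x + y)"
  using ring_hom_add[OF cl_hom, of x y] by simp

lemma cl_one: "\<one>\<^bsub>U\<^esub> = cl 1"
  using ring_hom_one[OF cl_hom] by simp

lemma cl_closed [simp]: "cl x \<in> carrier U"
  using ring_hom_closed[OF cl_hom, of x] by simp

lemma cl_eq_iff: "cl x = cl y \<longleftrightarrow> x \<doteq> y"
  using ring.quotient_eq_iff_same_a_r_cos[OF FA_ring ideal_I, of x y]
  by (simp add: uq_class_def U_eq_def a_minus_def)

lemma carrier_U: "carrier U = range cl"
  by (auto simp: Uq_def FactRing_def A_RCOSETS_def' uq_class_def)

lemma cl_zero: "\<zero>\<^bsub>U\<^esub> = cl 0"
  using ring_hom_zero[OF cl_hom FA_ring U_ring] by simp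

lemma cl_minus: "\<ominus>\<^bsub>U\<^esub> cl x = cl (- x)"
  by (rule abelian_group.minus_equality[OF ring.is_abelian_group[OF U_ring]])
    (simp_all add: cl_add cl_zero)

lemma sc_cl: "sc c = cl (const c)"
  by (simp add: uq_scalar_def)

lemma E_cl: "uq_E q m = cl gE"
  by (simp add: uq_E_def)

section \<open>The centre as a ring\<close>

abbreviation "Z \<equiv> ZU q m"

text \<open>
  By \<open>central_imp_casimir_poly\<close> these are all the central elements. Through this parametrization
  computations in the centre and in its quotients become computations with polynomials.
\<close>

definition central_elem :: "complex poly \<Rightarrow> uq" where "central_elem p = cl (casimir_poly p)"

lemma center_U: "ring_center U = range central_elem"
proof
  show "ring_center U \<subseteq> range central_elem"
  proof
    fix z assume z: "z \<in> ring_center U"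
    then obtain x where x: "z = cl x" by (auto simp: ring_center_def carrier_U)
    have "x * y \<doteq> y * x" for y
      using z by (simp add: ring_center_def carrier_U x cl_mult cl_eq_iff)
    then obtain p where "x \<doteq> casimir_poly p" using central_imp_casimir_poly by blast
    then show "z \<in> range central_elem" by (auto simp: x central_elem_def cl_eq_iff)
  qed
  show "range central_elem \<subseteq> ring_center U"
  proof
    fix z assume "z \<in> range central_elem"
    then obtain p where z: "z = cl (casimir_poly p)" by (auto simp: central_elem_def)
    have "cl (casimir_poly p) \<otimes>\<^bsub>U\<^esub> y = y \<otimes>\<^bsub>U\<^esub> cl (casimir_poly p)" if y: "y \<in> carrier U" for y
    proof -
      obtain x where "y = cl x" using y by (auto simp: carrier_U)
      then show ?thesis by (simp add: cl_mult cl_eq_iff casimir_poly_central)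
    qed
    then show "z \<in> ring_center U" by (simp add: ring_center_def z)
  qed
qed

lemma central_elem_closed: "central_elem p \<in> carrier U"
  by (simp add: central_elem_def)

lemma central_elem_mult: "central_elem p \<otimes>\<^bsub>U\<^esub> central_elem r = central_elem (p * r)"
  by (simp add: central_elem_def cl_mult casimir_poly_mult)

lemma central_elem_add: "central_elem p \<oplus>\<^bsub>U\<^esub> central_elem r = central_elem (p + r)"
  by (simp add: central_elem_def cl_add casimir_poly_add)

lemma central_elem_one: "\<one>\<^bsub>U\<^esub> = central_elem 1"
  by (simp add: central_elem_def cl_one)

lemma central_elem_zero: "\<zero>\<^bsub>U\<^esub> = central_elem 0"
  by (simp add: central_elem_def cl_zero)

lemma casimir_poly_minus: "casimir_poly (- p) = - casimir_poly p"
  using casimir_poly_smult[of "-1" p] by (simp add: const_minus)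

lemma central_elem_minus: "\<ominus>\<^bsub>U\<^esub> central_elem p = central_elem (- p)"
  by (simp add: central_elem_def cl_minus casimir_poly_minus)

lemma sc_central_elem: "sc c = central_elem [:c:]"
  by (simp add: sc_cl central_elem_def)

lemma carrier_Z: "carrier Z = range central_elem"
  by (simp add: ZU_def center_U)

lemma Z_simps [simp]:
  "x \<otimes>\<^bsub>Z\<^esub> y = x \<otimes>\<^bsub>U\<^esub> y" "x \<oplus>\<^bsub>Z\<^esub> y = x \<oplus>\<^bsub>U\<^esub> y" "\<one>\<^bsub>Z\<^esub> = \<one>\<^bsub>U\<^esub>" "\<zero>\<^bsub>Z\<^esub> = \<zero>\<^bsub>U\<^esub>"
  by (simp_all add: ZU_def)

lemma Z_ring: "ring Z"
proof -
  have "subring (range central_elem) U"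
    by (rule ring.subringI[OF U_ring])
      (auto simp: central_elem_mult central_elem_add central_elem_minus central_elem_one central_elem_closed)
  from ring.subring_is_ring[OF U_ring this] show ?thesis
    by (simp add: ZU_def center_U)
qed

lemma Z_minus: "\<ominus>\<^bsub>Z\<^esub> central_elem p = central_elem (- p)"
  by (rule abelian_group.minus_equality[OF ring.is_abelian_group[OF Z_ring]])
    (simp_all add: central_elem_add central_elem_zero carrier_Z)

end

section \<open>The character of the subalgebra generated by E\<close>

locale uq_character = uq_generic +
  fixes \<eta> :: "uq \<Rightarrow> complex"
  assumes eta: "nonsingular_character q m \<eta>"
begin

abbreviation "UE \<equiv> UqE q m"
abbreviation "h \<equiv> \<eta> (uq_E q m)"

lemma h_nz: "h \<noteq> 0" and eta_sc: "\<eta> (sc c) = c" and eta_hom: "\<eta> \<in> ring_hom UE ring_of_type_algebra"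
  using eta by (simp_all add: nonsingular_character_def)

abbreviation "EH \<equiv> gE - const h"

lemma UE_gens: "insert (uq_E q m) (range sc) \<subseteq> carrier U"
  by (auto simp: E_cl sc_cl)

lemma UE_carrier: "carrier UE = generate_ring U (insert (uq_E q m) (range sc))"
  by (simp add: UqE_def)

lemma UE_subset: "e \<in> carrier UE \<Longrightarrow> e \<in> carrier U"
  using ring.generate_ring_incl[OF U_ring UE_gens] by (auto simp: UE_carrier)

lemma UE_simps [simp]:
  "x \<otimes>\<^bsub>UE\<^esub> y = x \<otimes>\<^bsub>U\<^esub> y" "x \<oplus>\<^bsub>UE\<^esub> y = x \<oplus>\<^bsub>U\<^esub> y" "\<one>\<^bsub>UE\<^esub> = \<one>\<^bsub>U\<^esub>" "\<zero>\<^bsub>UE\<^esub> = \<zero>\<^bsub>U\<^esub>"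
  by (simp_all add: UqE_def)

lemma UE_ring: "ring UE"
  unfolding UqE_def by (rule ring.generate_ring_is_ring[OF U_ring UE_gens])

lemma UE_sc: "sc c \<in> carrier UE" and UE_E: "uq_E q m \<in> carrier UE" and UE_one: "\<one>\<^bsub>U\<^esub> \<in> carrier UE"
  by (auto simp: UE_carrier intro: generate_ring.incl generate_ring.one)

lemma eta_mult: "x \<in> carrier UE \<Longrightarrow> y \<in> carrier UE \<Longrightarrow> \<eta> (x \<otimes>\<^bsub>U\<^esub> y) = \<eta> x * \<eta> y"
  using ring_hom_mult[OF eta_hom, of x y] by (simp add: ring_of_type_algebra_def)

lemma eta_add: "x \<in> carrier UE \<Longrightarrow> y \<in> carrier UE \<Longrightarrow> \<eta> (x \<oplus>\<^bsub>U\<^esub> y) = \<eta> x + \<eta> y"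
  using ring_hom_add[OF eta_hom, of x y] by (simp add: ring_of_type_algebra_def)

lemma eta_one: "\<eta> \<one>\<^bsub>U\<^esub> = 1"
  using ring_hom_one[OF eta_hom] by (simp add: ring_of_type_algebra_def)

lemma const_plus_mult:
  "(const a + d * D) * (const b + d' * D) = const (a * b) + (const a * d' + const b * d + d * D * d') * D"
  using const_commute[of "d * D" b] by (simp add: const_mult algebra_simps)

text \<open>
  An element of \<open>U\<^sub>q(E)\<close> is a polynomial in \<open>E\<close>, and \<open>\<eta>\<close> evaluates it at \<open>h\<close>; the remainder is
  divisible by \<open>E - h\<close>.
\<close>

lemma UE_reduction:
  assumes "e \<in> carrier UE"
  shows "\<exists>d. e = cl (const (\<eta> e) + d * EH)"
  using assms unfolding UE_carrier
proof (induction rule: generate_ring.induct)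
  case one
  have "\<one>\<^bsub>U\<^esub> = cl (const (\<eta> \<one>\<^bsub>U\<^esub>) + 0 * EH)" by (simp add: cl_one[symmetric] eta_one)
  then show ?case by blast
next
  case (incl e)
  have "e = cl (const (\<eta> e) + 1 * EH)" if "e = uq_E q m" using that by (simp add: E_cl)
  moreover have "e = cl (const (\<eta> e) + 0 * EH)" if e: "e \<in> range sc"
  proof -
    obtain c where "e = sc c" using e by blast
    then show ?thesis using eta_sc[of c] by (simp add: sc_cl)
  qed
  ultimately show ?case using incl by blast
next
  case (a_inv e)
  then obtain d where e: "e = cl (const (\<eta> e) + d * EH)" by blast
  have "e \<in> carrier UE" "\<ominus>\<^bsub>U\<^esub> e \<in> carrier UE"
    using a_inv(1) by (auto simp: UE_carrier intro: generate_ring.a_inv)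
  then have "\<eta> (e \<oplus>\<^bsub>U\<^esub> \<ominus>\<^bsub>U\<^esub> e) = \<eta> e + \<eta> (\<ominus>\<^bsub>U\<^esub> e)" by (rule eta_add)
  moreover have "e \<oplus>\<^bsub>U\<^esub> \<ominus>\<^bsub>U\<^esub> e = sc 0"
    using abelian_group.r_neg[OF ring.is_abelian_group[OF U_ring] UE_subset[OF \<open>e \<in> carrier UE\<close>]]
    by (simp add: cl_zero sc_cl)
  ultimately have n: "\<eta> (\<ominus>\<^bsub>U\<^esub> e) = - \<eta> e" by (simp add: eta_sc eq_neg_iff_add_eq_0 add.commute)
  have "\<ominus>\<^bsub>U\<^esub> e = cl (- (const (\<eta> e) + d * EH))"
    by (subst e) (rule cl_minus)
  also have "\<dots> = cl (const (\<eta> (\<ominus>\<^bsub>U\<^esub> e)) + (- d) * EH)"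
    by (simp add: n const_minus)
  finally show ?case by blast
next
  case (eng_add x y)
  then obtain d d' where xy: "x = cl (const (\<eta> x) + d * EH)" "y = cl (const (\<eta> y) + d' * EH)" by blast
  have n: "\<eta> (x \<oplus>\<^bsub>U\<^esub> y) = \<eta> x + \<eta> y" using eng_add by (intro eta_add) (simp_all add: UE_carrier)
  have "x \<oplus>\<^bsub>U\<^esub> y = cl ((const (\<eta> x) + d * EH) + (const (\<eta> y) + d' * EH))"
    by (subst xy(1), subst xy(2)) (rule cl_add)
  also have "\<dots> = cl (const (\<eta> (x \<oplus>\<^bsub>U\<^esub> y)) + (d + d') * EH)"
    by (simp add: n const_add algebra_simps)
  finally show ?case by blast
next
  case (eng_mult x y)
  then obtain d d' where xy: "x = cl (const (\<eta> x) + d * EH)" "y = cl (const (\<eta> y) + d' * EH)" by blast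
  have n: "\<eta> (x \<otimes>\<^bsub>U\<^esub> y) = \<eta> x * \<eta> y" using eng_mult by (intro eta_mult) (simp_all add: UE_carrier)
  have "x \<otimes>\<^bsub>U\<^esub> y = cl ((const (\<eta> x) + d * EH) * (const (\<eta> y) + d' * EH))"
    by (subst xy(1), subst xy(2)) (rule cl_mult)
  also have "(const (\<eta> x) + d * EH) * (const (\<eta> y) + d' * EH)
      = const (\<eta> (x \<otimes>\<^bsub>U\<^esub> y)) + (const (\<eta> x) * d' + const (\<eta> y) * d + d * EH * d') * EH"
    unfolding n by (rule const_plus_mult)
  finally show ?case by blast
qed

end

section \<open>The two actions of the scalar algebra\<close>

lemma abelian_group_cong:
  fixes R :: "('a, 'm) ring_scheme" and R' :: "('a, 'n) ring_scheme"
  assumes R: "abelian_group R"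
    and eq: "carrier R' = carrier R" "\<And>x y. x \<oplus>\<^bsub>R'\<^esub> y = x \<oplus>\<^bsub>R\<^esub> y" "\<zero>\<^bsub>R'\<^esub> = \<zero>\<^bsub>R\<^esub>"
  shows "abelian_group R'"
proof -
  interpret R: abelian_group R by (rule R)
  show ?thesis
    by (rule abelian_groupI) (auto simp: eq R.a_assoc intro: R.a_comm R.add.l_inv_ex)
qed

context uq_character
begin

text \<open>
  The two actions of \<open>\<complex>\<close> over which \<open>Z(U) \<otimes> U\<^sub>q(E)\<close> is formed.
\<close>

definition raA :: "uq \<Rightarrow> complex \<Rightarrow> uq" where "raA a c = sc c \<otimes>\<^bsub>U\<^esub> a"
definition laA :: "complex \<Rightarrow> uq \<Rightarrow> uq" where "laA c b = sc c \<otimes>\<^bsub>U\<^esub> b"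
abbreviation "SC \<equiv> carrier (ZU_UqE q m)"
abbreviation "scalar_coset \<equiv> tensor_coset UNIV Z raA UE laA"
abbreviation "right_act \<equiv> ZU_UqE_right q m"

lemma Z_subset: "z \<in> carrier Z \<Longrightarrow> z \<in> carrier U"
  by (auto simp: carrier_Z central_elem_closed)

lemma Z_commute: "z \<in> carrier Z \<Longrightarrow> u \<in> carrier U \<Longrightarrow> z \<otimes>\<^bsub>U\<^esub> u = u \<otimes>\<^bsub>U\<^esub> z"
  by (simp add: ZU_def ring_center_def)

lemma sc_Z: "sc c \<in> carrier Z"
  by (simp add: carrier_Z sc_central_elem)

lemma raA_central_elem: "raA (central_elem p) c = central_elem (smult c p)"
  by (simp add: raA_def sc_central_elem central_elem_mult)

lemma laA_closed: "e \<in> carrier UE \<Longrightarrow> laA c e \<in> carrier UE"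
  using ring.ring_simprules(5)[OF UE_ring UE_sc[of c], of e] by (simp add: laA_def)

lemma eta_laA: "e \<in> carrier UE \<Longrightarrow> \<eta> (laA c e) = c * \<eta> e"
  by (simp add: laA_def eta_mult UE_sc eta_sc)

lemma scalars_pair: "tensor_pair UNIV Z raA UE laA"
  by (rule tensor_pair.intro)
    (auto simp: Z_ring UE_ring ring.is_abelian_group laA_closed carrier_Z raA_central_elem)

interpretation A: tensor_pair UNIV Z raA UE laA by (rule scalars_pair)
interpretation U: ring U by (rule U_ring)

lemma SC_carrier: "SC = carrier (tensor_group UNIV Z raA UE laA)"
  by (simp add: ZU_UqE_def tensor_algebra_def Let_def raA_def[abs_def] laA_def[abs_def])

lemma SC_cases:
  assumes "t \<in> SC"
  obtains p where "Poly_Mapping.keys p \<subseteq> carrier Z \<times> carrier UE" "t = scalar_coset p"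
  using assms unfolding SC_carrier by (rule A.TG_cases)

lemma scalar_coset_SC: "Poly_Mapping.keys p \<subseteq> carrier Z \<times> carrier UE \<Longrightarrow> scalar_coset p \<in> SC"
  unfolding SC_carrier by (rule A.coset_of_in)

text \<open>
  The map \<open>(z, e) \<mapsto> u z e\<close> respects scalars because these are central.
\<close>

lemma balanced_right_act:
  assumes u: "u \<in> carrier U"
  shows "A.balanced_map U (\<lambda>(z, e). u \<otimes>\<^bsub>U\<^esub> z \<otimes>\<^bsub>U\<^esub> e)"
  unfolding A.balanced_map_def
proof (intro conjI ballI)
  show "abelian_group U" by (rule U.is_abelian_group)
  fix z s assume z: "z \<in> carrier Z" and s: "s \<in> (UNIV :: complex set)"
  fix e assume e: "e \<in> carrier UE"
  have "sc s \<otimes>\<^bsub>U\<^esub> z = z \<otimes>\<^bsub>U\<^esub> sc s" using sc_Z Z_subset[OF z] by (rule Z_commute)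
  then show "(case (raA z s, e) of (z, e) \<Rightarrow> u \<otimes>\<^bsub>U\<^esub> z \<otimes>\<^bsub>U\<^esub> e) =
      (case (z, laA s e) of (z, e) \<Rightarrow> u \<otimes>\<^bsub>U\<^esub> z \<otimes>\<^bsub>U\<^esub> e)"
    using u Z_subset[OF z] Z_subset[OF sc_Z] UE_subset[OF e] by (simp add: U.m_assoc raA_def laA_def)
qed (use u in \<open>auto simp: Z_subset UE_subset U.r_distr U.l_distr\<close>)

lemma right_act_scalar_coset:
  assumes "u \<in> carrier U" "Poly_Mapping.keys p \<subseteq> carrier Z \<times> carrier UE"
  shows "right_act u (scalar_coset p) = frag_eval U (\<lambda>(z, e). u \<otimes>\<^bsub>U\<^esub> z \<otimes>\<^bsub>U\<^esub> e) p"
  unfolding ZU_UqE_right_def by (rule A.tensor_lift_coset_of[OF balanced_right_act[OF assms(1)] assms(2)])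

lemma right_act_frag:
  assumes "u \<in> carrier U" "z \<in> carrier Z" "e \<in> carrier UE"
  shows "right_act u (scalar_coset (frag_of (z, e))) = u \<otimes>\<^bsub>U\<^esub> z \<otimes>\<^bsub>U\<^esub> e"
  unfolding ZU_UqE_right_def using A.tensor_lift_frag[OF balanced_right_act[OF assms(1)] assms(2,3)] by simp

lemma right_act_closed: "u \<in> carrier U \<Longrightarrow> t \<in> SC \<Longrightarrow> right_act u t \<in> carrier U"
  unfolding ZU_UqE_right_def SC_carrier by (rule A.tensor_lift_closed[OF balanced_right_act])

lemma right_act_img: "u \<in> carrier U \<Longrightarrow> (\<lambda>(z, e). u \<otimes>\<^bsub>U\<^esub> z \<otimes>\<^bsub>U\<^esub> e) ` (carrier Z \<times> carrier UE) \<subseteq> carrier U"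
  by (auto simp: Z_subset UE_subset)

text \<open>
  An additive map applied to \<open>u t\<close> is determined by its values on \<open>u z e\<close>. With the
  analogous statement \<open>hom_N\<close> for the action on \<open>Z(U) / Z\<^sub>*\<close>, this reduces balancedness
  over \<open>Z(U) \<otimes> U\<^sub>q(E)\<close> to pure tensors.
\<close>

lemma hom_right_act:
  assumes u: "u \<in> carrier U" and G: "abelian_group G" and g: "g \<in> hom (add_monoid U) (add_monoid G)"
    and p: "Poly_Mapping.keys p \<subseteq> carrier Z \<times> carrier UE"
  shows "g (right_act u (scalar_coset p)) = frag_eval G (\<lambda>(z, e). g (u \<otimes>\<^bsub>U\<^esub> z \<otimes>\<^bsub>U\<^esub> e)) p"
  unfolding right_act_scalar_coset[OF u p]
  using hom_frag_eval[OF U.is_abelian_group G g right_act_img[OF u] p] by (simp add: case_prod_unfold)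

lemma right_act_lmult:
  assumes u: "u \<in> carrier U" and x: "x \<in> carrier U" and t: "t \<in> SC"
  shows "u \<otimes>\<^bsub>U\<^esub> right_act x t = right_act (u \<otimes>\<^bsub>U\<^esub> x) t"
  using t
proof (rule SC_cases)
  fix p assume p: "Poly_Mapping.keys p \<subseteq> carrier Z \<times> carrier UE" and t: "t = scalar_coset p"
  have g: "(\<lambda>y. u \<otimes>\<^bsub>U\<^esub> y) \<in> hom (add_monoid U) (add_monoid U)"
    using u by (auto intro!: homI simp: U.r_distr)
  have "u \<otimes>\<^bsub>U\<^esub> right_act x t = frag_eval U (\<lambda>(z, e). u \<otimes>\<^bsub>U\<^esub> (x \<otimes>\<^bsub>U\<^esub> z \<otimes>\<^bsub>U\<^esub> e)) p"
    unfolding t by (rule hom_right_act[OF x U.is_abelian_group g p])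
  also have "\<dots> = frag_eval U (\<lambda>(z, e). u \<otimes>\<^bsub>U\<^esub> x \<otimes>\<^bsub>U\<^esub> z \<otimes>\<^bsub>U\<^esub> e) p"
    by (rule frag_eval_cong) (use p u x Z_subset UE_subset in \<open>auto simp: U.m_assoc U.is_abelian_group\<close>)
  also have "\<dots> = right_act (u \<otimes>\<^bsub>U\<^esub> x) t"
    unfolding t using right_act_scalar_coset[of "u \<otimes>\<^bsub>U\<^esub> x" p] u x p by simp
  finally show ?thesis .
qed

end

locale uq_quotient = uq_character +
  fixes Zs :: "uq set"
  assumes Zs: "ideal Zs (ZU q m)"
begin

abbreviation "Q \<equiv> Z Quot Zs"
abbreviation "qc z \<equiv> Zs +>\<^bsub>Z\<^esub> z"
abbreviation "N \<equiv> ZU_quot q m \<eta> Zs"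

text \<open>
  The class of \<open>p(\<Omega>)\<close> in \<open>Z(U) / Z\<^sub>*\<close>.
\<close>

definition quot_elem :: "complex poly \<Rightarrow> uq set" where "quot_elem p = qc (central_elem p)"

lemma Q_ring: "ring Q"
  by (rule ideal.quotient_is_ring[OF Zs])

interpretation A: tensor_pair UNIV Z raA UE laA by (rule scalars_pair)
interpretation U: ring U by (rule U_ring)
interpretation Z: ring Z by (rule Z_ring)
interpretation Q: ring Q by (rule Q_ring)

lemma central_elem_Z [simp]: "central_elem p \<in> carrier Z"
  by (simp add: carrier_Z)

lemma qc_hom: "qc \<in> ring_hom Z Q"
  using ideal.rcos_ring_hom[OF Zs] .

lemma quot_elem_mult: "quot_elem p \<otimes>\<^bsub>Q\<^esub> quot_elem r = quot_elem (p * r)"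
  using ring_hom_mult[OF qc_hom, of "central_elem p" "central_elem r"] by (simp add: quot_elem_def central_elem_mult)

lemma quot_elem_add: "quot_elem p \<oplus>\<^bsub>Q\<^esub> quot_elem r = quot_elem (p + r)"
  using ring_hom_add[OF qc_hom, of "central_elem p" "central_elem r"] by (simp add: quot_elem_def central_elem_add)

lemma quot_elem_closed [simp]: "quot_elem p \<in> carrier Q"
  using ring_hom_closed[OF qc_hom, of "central_elem p"] by (simp add: quot_elem_def)

lemma quot_elem_eq_iff: "quot_elem p = quot_elem r \<longleftrightarrow> central_elem (p - r) \<in> Zs"
  using ring.quotient_eq_iff_same_a_r_cos[OF Z_ring Zs, of "central_elem p" "central_elem r"]
  by (simp add: quot_elem_def a_minus_def Z_minus central_elem_add)

lemma carrier_Q: "carrier Q = range quot_elem"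
  by (auto simp: FactRing_def A_RCOSETS_def' carrier_Z quot_elem_def)

lemma qc_sc: "qc (sc c) = quot_elem [:c:]"
  by (simp add: quot_elem_def sc_central_elem)

lemma N_simps: "carrier N = carrier Q" "x \<oplus>\<^bsub>N\<^esub> y = x \<oplus>\<^bsub>Q\<^esub> y" "\<zero>\<^bsub>N\<^esub> = \<zero>\<^bsub>Q\<^esub>"
  and N_smult: "t \<odot>\<^bsub>N\<^esub> w = tensor_lift Q (\<lambda>(z, e). qc z \<otimes>\<^bsub>Q\<^esub> (qc (sc (\<eta> e)) \<otimes>\<^bsub>Q\<^esub> w)) t"
  by (simp_all add: ZU_quot_def Let_def)

lemma N_abelian_group: "abelian_group N"
  by (rule abelian_group_cong[OF Q.is_abelian_group]) (simp_all add: N_simps)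

lemma N_fun: "qc (central_elem p) \<otimes>\<^bsub>Q\<^esub> (qc (sc c) \<otimes>\<^bsub>Q\<^esub> quot_elem r) = quot_elem (smult c (p * r))"
  by (simp add: qc_sc quot_elem_mult flip: quot_elem_def)

lemma balanced_N:
  assumes "w \<in> carrier Q"
  shows "A.balanced_map Q (\<lambda>(z, e). qc z \<otimes>\<^bsub>Q\<^esub> (qc (sc (\<eta> e)) \<otimes>\<^bsub>Q\<^esub> w))"
proof -
  obtain r where w: "w = quot_elem r" using assms by (auto simp: carrier_Q)
  show ?thesis
    unfolding A.balanced_map_def w carrier_Z
    by (auto simp: N_fun Q.is_abelian_group central_elem_add quot_elem_add raA_central_elem eta_laA eta_add
        smult_add_left smult_add_right algebra_simps)
qed

lemma N_scalar_coset:
  assumes "w \<in> carrier Q" "Poly_Mapping.keys p \<subseteq> carrier Z \<times> carrier UE"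
  shows "scalar_coset p \<odot>\<^bsub>N\<^esub> w = frag_eval Q (\<lambda>(z, e). qc z \<otimes>\<^bsub>Q\<^esub> (qc (sc (\<eta> e)) \<otimes>\<^bsub>Q\<^esub> w)) p"
  unfolding N_smult by (rule A.tensor_lift_coset_of[OF balanced_N[OF assms(1)] assms(2)])

lemma N_frag:
  assumes "e \<in> carrier UE"
  shows "scalar_coset (frag_of (central_elem p, e)) \<odot>\<^bsub>N\<^esub> quot_elem r = quot_elem (smult (\<eta> e) (p * r))"
  unfolding N_smult using A.tensor_lift_frag[OF balanced_N[OF quot_elem_closed] central_elem_Z assms] by (simp add: N_fun)

lemma N_closed: "w \<in> carrier Q \<Longrightarrow> t \<in> SC \<Longrightarrow> t \<odot>\<^bsub>N\<^esub> w \<in> carrier Q"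
  unfolding N_smult SC_carrier by (rule A.tensor_lift_closed[OF balanced_N])

lemma hom_N:
  assumes w: "w \<in> carrier Q" and G: "abelian_group G" and g: "g \<in> hom (add_monoid Q) (add_monoid G)"
    and p: "Poly_Mapping.keys p \<subseteq> carrier Z \<times> carrier UE"
  shows "g (scalar_coset p \<odot>\<^bsub>N\<^esub> w) = frag_eval G (\<lambda>(z, e). g (qc z \<otimes>\<^bsub>Q\<^esub> (qc (sc (\<eta> e)) \<otimes>\<^bsub>Q\<^esub> w))) p"
proof -
  have "(\<lambda>(z, e). qc z \<otimes>\<^bsub>Q\<^esub> (qc (sc (\<eta> e)) \<otimes>\<^bsub>Q\<^esub> w)) ` (carrier Z \<times> carrier UE) \<subseteq> carrier Q"
    using w ring_hom_closed[OF qc_hom] sc_Z by auto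
  from hom_frag_eval[OF Q.is_abelian_group G g this p] show ?thesis
    unfolding N_scalar_coset[OF w p] by (simp add: case_prod_unfold)
qed

lemma induced_pair: "tensor_pair SC U right_act N (module.smult N)"
  by (rule tensor_pair.intro) (simp_all add: N_abelian_group U.is_abelian_group N_simps right_act_closed N_closed)

end

context uq_quotient
begin

interpretation U: ring U by (rule U_ring)
interpretation Q: ring Q by (rule Q_ring)
interpretation B: tensor_pair SC U right_act N "module.smult N" by (rule induced_pair)

abbreviation "T \<equiv> induced_module q m \<eta> Zs"
abbreviation "induced_coset \<equiv> tensor_coset SC U right_act N (module.smult N)"
abbreviation "TG \<equiv> tensor_group SC U right_act N (module.smult N)"

section \<open>The induced module\<close>

text \<open>
  The element \<open>x \<otimes> p(\<Omega>)\<close> of the induced module.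
\<close>

definition pure_tensor :: "free_alg \<Rightarrow> complex poly \<Rightarrow> (uq \<times> uq set \<Rightarrow>\<^sub>0 int) set" where
  "pure_tensor x p = induced_coset (frag_of (cl x, quot_elem p))"

lemma T_simps: "carrier T = carrier TG" "x \<oplus>\<^bsub>T\<^esub> y = x \<otimes>\<^bsub>TG\<^esub> y" "\<zero>\<^bsub>T\<^esub> = \<one>\<^bsub>TG\<^esub>"
  by (simp_all add: induced_module_def tensor_module_def)

lemma T_smult: "u \<odot>\<^bsub>T\<^esub> t = (\<Union>p\<in>t. induced_coset (frag_extend (\<lambda>(x, y). frag_of (u \<otimes>\<^bsub>U\<^esub> x, y)) p))"
  by (simp add: induced_module_def tensor_module_def)

lemma T_abelian_group: "abelian_group T"
proof -
  interpret G: comm_group TG by (rule B.TG_comm_group)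
  show ?thesis
  proof (rule abelian_groupI, unfold T_simps)
    fix x y z assume xyz: "x \<in> carrier TG" "y \<in> carrier TG" "z \<in> carrier TG"
    show "x \<otimes>\<^bsub>TG\<^esub> y \<otimes>\<^bsub>TG\<^esub> z = x \<otimes>\<^bsub>TG\<^esub> (y \<otimes>\<^bsub>TG\<^esub> z)" using xyz by (rule G.m_assoc)
  next
    fix x y assume xy: "x \<in> carrier TG" "y \<in> carrier TG"
    show "x \<otimes>\<^bsub>TG\<^esub> y \<in> carrier TG" using xy by (rule G.m_closed)
    show "x \<otimes>\<^bsub>TG\<^esub> y = y \<otimes>\<^bsub>TG\<^esub> x" using xy by (rule G.m_comm)
  next
    fix x assume x: "x \<in> carrier TG"
    show "\<one>\<^bsub>TG\<^esub> \<otimes>\<^bsub>TG\<^esub> x = x" using x by (rule G.l_one)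
    show "\<exists>y\<in>carrier TG. y \<otimes>\<^bsub>TG\<^esub> x = \<one>\<^bsub>TG\<^esub>" using x by (rule G.l_inv_ex)
  qed (rule G.one_closed)
qed

interpretation T: abelian_group T by (rule T_abelian_group)

lemma frag_keys: "Poly_Mapping.keys (frag_of (cl x, quot_elem p)) \<subseteq> carrier U \<times> carrier N"
  by (simp add: keys_frag_of N_simps)

lemma pure_tensor_closed [simp]: "pure_tensor x p \<in> carrier T"
  unfolding pure_tensor_def T_simps by (rule B.coset_of_in[OF frag_keys])

lemma pure_tensor_cong: "x \<doteq> y \<Longrightarrow> pure_tensor x p = pure_tensor y p"
  by (simp add: pure_tensor_def cl_eq_iff[symmetric])

lemma pure_tensor_add: "pure_tensor (x + y) p = pure_tensor x p \<oplus>\<^bsub>T\<^esub> pure_tensor y p"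
  using B.coset_of_add_left[of "cl x" "cl y" "quot_elem p"] B.TG_mult[OF frag_keys frag_keys, of x p y p]
  by (simp add: pure_tensor_def T_simps N_simps cl_add)

lemma pure_tensor_smult: "cl y \<odot>\<^bsub>T\<^esub> pure_tensor x p = pure_tensor (y * x) p"
proof -
  have "cl y \<odot>\<^bsub>T\<^esub> pure_tensor x p = induced_coset (frag_extend (\<lambda>(x, y'). frag_of (cl y \<otimes>\<^bsub>U\<^esub> x, y')) (frag_of (cl x, quot_elem p)))"
    unfolding T_smult pure_tensor_def
    by (rule B.ext_coset) (auto simp: U.r_distr right_act_lmult)
  then show ?thesis by (simp add: pure_tensor_def cl_mult)
qed

text \<open>
  The balancing relation for the scalar \<open>p(\<Omega>) \<otimes> e\<close>. Taking \<open>e = 1\<close> moves central factors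
  across the tensor sign, and taking \<open>e = E\<close> evaluates \<open>E\<close> at \<open>h\<close>.
\<close>

lemma pure_tensor_move:
  assumes "e \<in> carrier UE"
  shows "induced_coset (frag_of (cl x \<otimes>\<^bsub>U\<^esub> central_elem p \<otimes>\<^bsub>U\<^esub> e, quot_elem r)) = pure_tensor x (smult (\<eta> e) (p * r))"
proof -
  have k: "Poly_Mapping.keys (frag_of (central_elem p, e)) \<subseteq> carrier Z \<times> carrier UE"
    using assms by (simp add: keys_frag_of)
  have "induced_coset (frag_of (right_act (cl x) (scalar_coset (frag_of (central_elem p, e))), quot_elem r))
      = induced_coset (frag_of (cl x, scalar_coset (frag_of (central_elem p, e)) \<odot>\<^bsub>N\<^esub> quot_elem r))"
    by (rule B.coset_of_balanced) (simp_all add: scalar_coset_SC[OF k] N_simps)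
  then show ?thesis
    using assms by (simp add: right_act_frag N_frag pure_tensor_def)
qed

lemma pure_tensor_casimir_poly: "pure_tensor (x * casimir_poly p) r = pure_tensor x (p * r)"
proof -
  have "cl x \<otimes>\<^bsub>U\<^esub> central_elem p \<otimes>\<^bsub>U\<^esub> \<one>\<^bsub>U\<^esub> = cl (x * casimir_poly p)"
    by (simp add: central_elem_def cl_mult)
  then show ?thesis using pure_tensor_move[OF UE_one, of x p r] by (simp add: eta_one pure_tensor_def)
qed

lemma pure_tensor_E: "pure_tensor (x * gE) r = pure_tensor (x * const h) r"
proof -
  have "cl x \<otimes>\<^bsub>U\<^esub> central_elem 1 \<otimes>\<^bsub>U\<^esub> uq_E q m = cl (x * gE)"
    by (simp add: central_elem_def cl_mult E_cl)
  then have "pure_tensor (x * gE) r = pure_tensor x (smult h r)"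
    using pure_tensor_move[OF UE_E, of x 1 r] by (simp add: pure_tensor_def)
  then show ?thesis using pure_tensor_casimir_poly[of x "[:h:]" r] by simp
qed

lemma pure_tensor_zero: "pure_tensor 0 r = \<zero>\<^bsub>T\<^esub>"
  using pure_tensor_add[of 0 0 r] by simp

text \<open>
  Both \<open>E\<close> and \<open>h\<close> move across the tensor sign as multiplication by \<open>h\<close>.
\<close>

lemma pure_tensor_EH: "pure_tensor (x * EH) r = \<zero>\<^bsub>T\<^esub>"
proof -
  have "x * EH + x * const h = x * gE" by (simp add: algebra_simps)
  then have "pure_tensor (x * EH) r \<oplus>\<^bsub>T\<^esub> pure_tensor (x * const h) r = pure_tensor (x * const h) r"
    using pure_tensor_add[of "x * EH" "x * const h" r] pure_tensor_E by simp
  then show ?thesis by simp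
qed

lemma pure_tensor_Zs: assumes "central_elem p \<in> Zs" shows "pure_tensor x p = \<zero>\<^bsub>T\<^esub>"
proof -
  have "quot_elem p = quot_elem 0" using assms by (simp add: quot_elem_eq_iff)
  then have "pure_tensor x p = pure_tensor x 0" by (simp add: pure_tensor_def)
  also have "\<dots> = pure_tensor (x * casimir_poly 0) 1" by (simp only: pure_tensor_casimir_poly) simp
  finally show ?thesis by (simp add: pure_tensor_zero)
qed

lemma pure_tensor_sum: "(\<And>i. i \<in> D \<Longrightarrow> pure_tensor (f i) r = \<zero>\<^bsub>T\<^esub>) \<Longrightarrow> pure_tensor (sum f D) r = \<zero>\<^bsub>T\<^esub>"
  by (induction D rule: infinite_finite_induct) (simp_all add: pure_tensor_zero pure_tensor_add)

lemma pure_tensor_diff: "pure_tensor (x - y) r = \<zero>\<^bsub>T\<^esub> \<longleftrightarrow> pure_tensor x r = pure_tensor y r"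
proof -
  have "pure_tensor x r = pure_tensor (x - y) r \<oplus>\<^bsub>T\<^esub> pure_tensor y r" using pure_tensor_add[of "x - y" y r] by simp
  moreover have "pure_tensor (x - y) r \<oplus>\<^bsub>T\<^esub> pure_tensor y r = pure_tensor y r \<longleftrightarrow> pure_tensor (x - y) r = \<zero>\<^bsub>T\<^esub>" by simp
  ultimately show ?thesis by simp
qed

text \<open>
  Central elements move to the left factor, so every tensor has the form \<open>x \<otimes> 1\<close>.
\<close>

lemma T_cases:
  assumes "t \<in> carrier T" obtains x where "t = pure_tensor x 1"
proof -
  obtain p where p: "Poly_Mapping.keys p \<subseteq> carrier U \<times> carrier N" "t = induced_coset p"
    using assms unfolding T_simps by (rule B.TG_cases)
  have "\<exists>x. induced_coset p = pure_tensor x 1"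
    using p(1)
  proof (induction p rule: free_Abelian_group_induct[consumes 1])
    case 1
    have "induced_coset 0 = pure_tensor 0 1" by (simp add: pure_tensor_zero T_simps B.TG_one)
    then show ?case by blast
  next
    case (2 a b)
    then obtain x y where xy: "induced_coset a = pure_tensor x 1" "induced_coset b = pure_tensor y 1" by blast
    have k: "Poly_Mapping.keys (a - b) \<subseteq> carrier U \<times> carrier N"
      using 2(1,2) by (rule B.keys_diff_subset)
    have "induced_coset (a - b) \<oplus>\<^bsub>T\<^esub> induced_coset b = induced_coset a"
      unfolding T_simps using B.TG_mult[OF k 2(2)] by simp
    then have "induced_coset (a - b) \<oplus>\<^bsub>T\<^esub> pure_tensor y 1 = pure_tensor (x - y) 1 \<oplus>\<^bsub>T\<^esub> pure_tensor y 1"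
      using pure_tensor_add[of "x - y" y 1] xy by simp
    moreover have "induced_coset (a - b) \<in> carrier T" unfolding T_simps by (rule B.coset_of_in[OF k])
    ultimately have "induced_coset (a - b) = pure_tensor (x - y) 1" by simp
    then show ?case by blast
  next
    case (3 a)
    then obtain x r where "a = (cl x, quot_elem r)" by (auto simp: N_simps carrier_Q carrier_U)
    then have "induced_coset (frag_of a) = pure_tensor (x * casimir_poly r) 1" by (simp add: pure_tensor_casimir_poly) (simp add: pure_tensor_def)
    then show ?case by blast
  qed
  then show ?thesis using that p(2) by blast
qed

section \<open>Faithfulness over the centre\<close>

text \<open>
  The coefficient of the generator is constant on classes, so any representative may be used.
\<close>

definition coeff0 :: "uq \<Rightarrow> complex poly" where "coeff0 u = gen_coeff h (SOME x. cl x = u)"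

lemma coeff0_cl: "coeff0 (cl x) = gen_coeff h x"
proof -
  have "cl (SOME y. cl y = cl x) = cl x" by (rule someI) simp
  then show ?thesis unfolding coeff0_def using gen_coeff_U_eq[OF h_nz] cl_eq_iff by blast
qed

lemma coeff0_central_elem_mult:
  assumes u: "u \<in> carrier U" and e: "e \<in> carrier UE"
  shows "coeff0 (u \<otimes>\<^bsub>U\<^esub> central_elem p \<otimes>\<^bsub>U\<^esub> e) = smult (\<eta> e) (p * coeff0 u)"
proof -
  obtain x where x: "u = cl x" using u by (auto simp: carrier_U)
  obtain d where d: "e = cl (const (\<eta> e) + d * EH)" using UE_reduction[OF e] by blast
  have "u \<otimes>\<^bsub>U\<^esub> central_elem p \<otimes>\<^bsub>U\<^esub> e = cl (x * casimir_poly p * (const (\<eta> e) + d * EH))"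
    by (subst d) (simp add: x central_elem_def cl_mult)
  then show ?thesis
    by (simp add: coeff0_cl gen_coeff_E_mult gen_coeff_casimir_poly_mult[OF h_nz] x mult.commute)
qed

text \<open>
  The map \<open>u \<otimes> w \<mapsto> c(u) w\<close>, with \<open>c(u)\<close> the coefficient of the generator in the model, takes
  the induced module back to \<open>Z(U) / Z\<^sub>*\<close>.
\<close>

lemma balanced_coeff0: "B.balanced_map Q (\<lambda>(u, w). quot_elem (coeff0 u) \<otimes>\<^bsub>Q\<^esub> w)"
  unfolding B.balanced_map_def N_simps
proof (intro conjI ballI)
  fix u t w assume u: "u \<in> carrier U" and t: "t \<in> SC" and w: "w \<in> carrier Q"
  obtain r where r: "w = quot_elem r" using w by (auto simp: carrier_Q)
  obtain p where p: "Poly_Mapping.keys p \<subseteq> carrier Z \<times> carrier UE" "t = scalar_coset p"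
    using t by (rule SC_cases)
  have c_add: "coeff0 (u \<oplus>\<^bsub>U\<^esub> u') = coeff0 u + coeff0 u'" if "u \<in> carrier U" "u' \<in> carrier U" for u u'
    using that by (auto simp: carrier_U cl_add coeff0_cl gen_coeff_add)
  have g: "(\<lambda>v. quot_elem (coeff0 v) \<otimes>\<^bsub>Q\<^esub> w) \<in> hom (add_monoid U) (add_monoid Q)"
    using w by (auto intro!: homI simp: c_add quot_elem_add[symmetric] Q.l_distr)
  have g': "(\<lambda>v. quot_elem (coeff0 u) \<otimes>\<^bsub>Q\<^esub> v) \<in> hom (add_monoid Q) (add_monoid Q)"
    by (auto intro!: homI simp: Q.r_distr)
  have "quot_elem (coeff0 (right_act u t)) \<otimes>\<^bsub>Q\<^esub> w
      = frag_eval Q (\<lambda>(z, e). quot_elem (coeff0 (u \<otimes>\<^bsub>U\<^esub> z \<otimes>\<^bsub>U\<^esub> e)) \<otimes>\<^bsub>Q\<^esub> w) p"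
    unfolding p(2) by (rule hom_right_act[OF u Q.is_abelian_group g p(1)])
  also have "\<dots> = frag_eval Q (\<lambda>(z, e). quot_elem (coeff0 u) \<otimes>\<^bsub>Q\<^esub> (qc z \<otimes>\<^bsub>Q\<^esub> (qc (sc (\<eta> e)) \<otimes>\<^bsub>Q\<^esub> w))) p"
  proof (rule frag_eval_cong)
    fix s assume "s \<in> Poly_Mapping.keys p"
    then obtain a e where s: "s = (central_elem a, e)" "e \<in> carrier UE" using p(1) by (auto simp: carrier_Z)
    show "(case s of (z, e) \<Rightarrow> quot_elem (coeff0 (u \<otimes>\<^bsub>U\<^esub> z \<otimes>\<^bsub>U\<^esub> e)) \<otimes>\<^bsub>Q\<^esub> w) =
        (case s of (z, e) \<Rightarrow> quot_elem (coeff0 u) \<otimes>\<^bsub>Q\<^esub> (qc z \<otimes>\<^bsub>Q\<^esub> (qc (sc (\<eta> e)) \<otimes>\<^bsub>Q\<^esub> w)))"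
      by (simp add: s coeff0_central_elem_mult[OF u] r N_fun quot_elem_mult mult_ac)
    show "(case s of (z, e) \<Rightarrow> quot_elem (coeff0 u) \<otimes>\<^bsub>Q\<^esub> (qc z \<otimes>\<^bsub>Q\<^esub> (qc (sc (\<eta> e)) \<otimes>\<^bsub>Q\<^esub> w))) \<in> carrier Q"
      by (simp add: s r N_fun quot_elem_mult)
  qed (rule Q.is_abelian_group)
  also have "\<dots> = quot_elem (coeff0 u) \<otimes>\<^bsub>Q\<^esub> (t \<odot>\<^bsub>N\<^esub> w)"
    unfolding p(2) by (rule hom_N[OF w Q.is_abelian_group g' p(1), symmetric])
  finally show "(case (right_act u t, w) of (u, w) \<Rightarrow> quot_elem (coeff0 u) \<otimes>\<^bsub>Q\<^esub> w)
      = (case (u, t \<odot>\<^bsub>N\<^esub> w) of (u, w) \<Rightarrow> quot_elem (coeff0 u) \<otimes>\<^bsub>Q\<^esub> w)" by simp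
next
  show "abelian_group Q" by (rule Q.is_abelian_group)
qed (auto simp: carrier_U cl_add coeff0_cl gen_coeff_add quot_elem_add[symmetric] Q.l_distr Q.r_distr)

text \<open>
  The retraction of the previous lemma sends \<open>1 \<otimes> w\<close> to \<open>w\<close>, so no element of \<open>Z(U) / Z\<^sub>*\<close> is
  lost in the tensor product.
\<close>

lemma pure_tensor_eq_zero_iff: "pure_tensor 1 p = \<zero>\<^bsub>T\<^esub> \<longleftrightarrow> central_elem p \<in> Zs"
proof
  assume "pure_tensor 1 p = \<zero>\<^bsub>T\<^esub>"
  then have eq: "pure_tensor 1 p = pure_tensor 1 0" using pure_tensor_casimir_poly[of 1 0 1] pure_tensor_zero[of 1] by simp
  have "tensor_lift Q (\<lambda>(u, w). quot_elem (coeff0 u) \<otimes>\<^bsub>Q\<^esub> w) (pure_tensor 1 r) = quot_elem r" for r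
    unfolding pure_tensor_def
    by (subst B.tensor_lift_frag[OF balanced_coeff0]) (simp_all add: N_simps coeff0_cl gen_coeff_casimir_poly[OF h_nz, of 1, simplified] quot_elem_mult)
  from this[of p] this[of 0] have "quot_elem p = quot_elem 0" by (simp add: eq)
  then show "central_elem p \<in> Zs" by (simp add: quot_elem_eq_iff)
qed (rule pure_tensor_Zs)

text \<open>
  A central \<open>z\<close> that annihilates \<open>1 \<otimes> 1\<close> lies in \<open>Z\<^sub>*\<close> by the preceding lemma.
\<close>

lemma T_annihilator: "central_annihilator q m T = Zs"
proof (intro equalityI subsetI)
  fix z assume "z \<in> central_annihilator q m T"
  then obtain p where p: "z = central_elem p" "z \<odot>\<^bsub>T\<^esub> pure_tensor 1 1 = \<zero>\<^bsub>T\<^esub>"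
    by (auto simp: central_annihilator_def center_U)
  have "central_elem p \<odot>\<^bsub>T\<^esub> pure_tensor 1 1 = pure_tensor 1 p"
    using pure_tensor_casimir_poly[of 1 p 1] by (simp add: central_elem_def pure_tensor_smult)
  then show "z \<in> Zs" using p pure_tensor_eq_zero_iff by simp
next
  fix z assume z: "z \<in> Zs"
  then have "z \<in> carrier Z" using ideal.Icarr[OF Zs] by blast
  then obtain p where p: "z = central_elem p" by (auto simp: carrier_Z)
  have "z \<odot>\<^bsub>T\<^esub> t = \<zero>\<^bsub>T\<^esub>" if t: "t \<in> carrier T" for t
  proof -
    obtain x where "t = pure_tensor x 1" using T_cases[OF t] .
    then have "z \<odot>\<^bsub>T\<^esub> t = pure_tensor (casimir_poly p * x) 1" by (simp add: p central_elem_def pure_tensor_smult)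
    also have "\<dots> = pure_tensor (x * casimir_poly p) 1" by (rule pure_tensor_cong[OF casimir_poly_central])
    also have "\<dots> = \<zero>\<^bsub>T\<^esub>" using z p by (simp add: pure_tensor_casimir_poly pure_tensor_Zs)
    finally show ?thesis .
  qed
  then show "z \<in> central_annihilator q m T" by (simp add: central_annihilator_def center_U p)
qed

lemma T_whittaker:
  assumes "Zs \<noteq> carrier Z"
  shows "whittaker_vector q m \<eta> T (pure_tensor 1 1)"
    and "carrier T = {u \<odot>\<^bsub>T\<^esub> pure_tensor 1 1 | u. u \<in> carrier U}"
proof -
  have "central_elem 1 \<notin> Zs" using assms ideal.one_imp_carrier[OF Zs] by (auto simp: central_elem_one)
  moreover have "cl gE \<odot>\<^bsub>T\<^esub> pure_tensor 1 1 = sc h \<odot>\<^bsub>T\<^esub> pure_tensor 1 1"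
    using pure_tensor_E[of 1 1] by (simp add: sc_cl pure_tensor_smult)
  ultimately show "whittaker_vector q m \<eta> T (pure_tensor 1 1)"
    by (simp add: whittaker_vector_def pure_tensor_eq_zero_iff E_cl)
  show "carrier T = {u \<odot>\<^bsub>T\<^esub> pure_tensor 1 1 | u. u \<in> carrier U}"
  proof (intro equalityI subsetI)
    fix t assume "t \<in> carrier T"
    then obtain x where "t = cl x \<odot>\<^bsub>T\<^esub> pure_tensor 1 1" using T_cases by (metis pure_tensor_smult mult_1_right)
    then show "t \<in> {u \<odot>\<^bsub>T\<^esub> pure_tensor 1 1 | u. u \<in> carrier U}" by (auto simp: carrier_U)
  next
    fix t assume "t \<in> {u \<odot>\<^bsub>T\<^esub> pure_tensor 1 1 | u. u \<in> carrier U}"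
    then obtain x where "t = cl x \<odot>\<^bsub>T\<^esub> pure_tensor 1 1" by (auto simp: carrier_U)
    then show "t \<in> carrier T" by (simp add: pure_tensor_smult)
  qed
qed

end

context uq_quotient
begin

interpretation U: ring U by (rule U_ring)
interpretation Q: ring Q by (rule Q_ring)
interpretation B: tensor_pair SC U right_act N "module.smult N" by (rule induced_pair)
interpretation T: abelian_group T by (rule T_abelian_group)

context
  fixes V :: "(uq, 'v) module"
  assumes V: "left_module U V"
begin

interpretation V: left_module U V by (rule V)

context
  fixes v :: 'v
  assumes v: "v \<in> carrier V" and Ev: "uq_E q m \<odot>\<^bsub>V\<^esub> v = sc h \<odot>\<^bsub>V\<^esub> v"
    and Zs_v: "\<And>z. z \<in> Zs \<Longrightarrow> z \<odot>\<^bsub>V\<^esub> v = \<zero>\<^bsub>V\<^esub>"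
begin

section \<open>Whittaker modules are induced\<close>

text \<open>
  The map \<open>(u, z + Z\<^sub>*) \<mapsto> u z v\<close>. Any representative \<open>z\<close> of the coset may be chosen because
  \<open>Z\<^sub>*\<close> annihilates \<open>v\<close>.
\<close>

definition whit_map :: "uq \<times> uq set \<Rightarrow> 'v" where
  "whit_map = (\<lambda>(u, w). u \<odot>\<^bsub>V\<^esub> ((SOME z. z \<in> w) \<odot>\<^bsub>V\<^esub> v))"

lemma V_smult_zero: "u \<in> carrier U \<Longrightarrow> u \<odot>\<^bsub>V\<^esub> \<zero>\<^bsub>V\<^esub> = \<zero>\<^bsub>V\<^esub>"
  using V.smult_r_distr[of u "\<zero>\<^bsub>V\<^esub>" "\<zero>\<^bsub>V\<^esub>"] by simp

lemma whit_map_quot_elem: assumes "u \<in> carrier U" shows "whit_map (u, quot_elem p) = u \<odot>\<^bsub>V\<^esub> (central_elem p \<odot>\<^bsub>V\<^esub> v)"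
proof -
  have quot_elem: "quot_elem p = {i \<oplus>\<^bsub>U\<^esub> central_elem p | i. i \<in> Zs}"
    by (auto simp: quot_elem_def a_r_coset_def r_coset_def)
  have "\<zero>\<^bsub>Z\<^esub> \<in> Zs"
    using additive_subgroup.zero_closed[OF ideal.axioms(1)[OF Zs]] .
  then have "\<exists>z. z \<in> quot_elem p" by (auto simp: quot_elem)
  then have "(SOME z. z \<in> quot_elem p) \<in> quot_elem p" by (rule someI_ex)
  then obtain i where i: "i \<in> Zs" "(SOME z. z \<in> quot_elem p) = i \<oplus>\<^bsub>U\<^esub> central_elem p" by (auto simp: quot_elem)
  have "i \<in> carrier U" using i(1) ideal.Icarr[OF Zs] Z_subset by blast
  then have "(SOME z. z \<in> quot_elem p) \<odot>\<^bsub>V\<^esub> v = central_elem p \<odot>\<^bsub>V\<^esub> v"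
    using Zs_v[OF i(1)] v by (simp add: i(2) V.smult_l_distr central_elem_closed)
  then show ?thesis by (simp add: whit_map_def)
qed

lemma E_act: assumes e: "e \<in> carrier UE" shows "e \<odot>\<^bsub>V\<^esub> v = sc (\<eta> e) \<odot>\<^bsub>V\<^esub> v"
proof -
  obtain d where d: "e = cl (const (\<eta> e) + d * EH)" using UE_reduction[OF e] by blast
  have "cl EH \<odot>\<^bsub>V\<^esub> v \<oplus>\<^bsub>V\<^esub> sc h \<odot>\<^bsub>V\<^esub> v = cl gE \<odot>\<^bsub>V\<^esub> v"
    using V.smult_l_distr[of "cl EH" "sc h" v] v by (simp add: sc_cl cl_add)
  then have EH: "cl EH \<odot>\<^bsub>V\<^esub> v = \<zero>\<^bsub>V\<^esub>"
    using Ev v by (simp add: E_cl sc_cl)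
  have "e \<odot>\<^bsub>V\<^esub> v = (sc (\<eta> e) \<oplus>\<^bsub>U\<^esub> cl d \<otimes>\<^bsub>U\<^esub> cl EH) \<odot>\<^bsub>V\<^esub> v"
    by (subst d) (simp add: sc_cl cl_add cl_mult)
  also have "\<dots> = sc (\<eta> e) \<odot>\<^bsub>V\<^esub> v"
    using v by (simp add: V.smult_l_distr V.smult_assoc EH V_smult_zero sc_cl)
  finally show ?thesis .
qed

lemma balanced_whit_map: "B.balanced_map V whit_map"
  unfolding B.balanced_map_def N_simps
proof (intro conjI ballI)
  show "abelian_group V" by (rule V.abelian_group_axioms)
  fix u w assume u: "u \<in> carrier U" and w: "w \<in> carrier Q"
  obtain r where r: "w = quot_elem r" using w by (auto simp: carrier_Q)
  show "whit_map (u, w) \<in> carrier V" using u v by (simp add: r whit_map_quot_elem central_elem_closed)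
  show "whit_map (u, w \<oplus>\<^bsub>Q\<^esub> w') = whit_map (u, w) \<oplus>\<^bsub>V\<^esub> whit_map (u, w')" if w': "w' \<in> carrier Q" for w'
  proof -
    obtain r' where r': "w' = quot_elem r'" using w' by (auto simp: carrier_Q)
    show ?thesis using u v
      by (simp add: r r' quot_elem_add whit_map_quot_elem central_elem_closed V.smult_r_distr[symmetric] V.smult_l_distr[symmetric] central_elem_add)
  qed
  show "whit_map (u \<oplus>\<^bsub>U\<^esub> u', w) = whit_map (u, w) \<oplus>\<^bsub>V\<^esub> whit_map (u', w)" if "u' \<in> carrier U" for u'
    using u v that by (simp add: r whit_map_quot_elem central_elem_closed V.smult_l_distr)
  show "whit_map (right_act u t, w) = whit_map (u, t \<odot>\<^bsub>N\<^esub> w)" if t: "t \<in> SC" for t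
  proof -
    obtain p where p: "Poly_Mapping.keys p \<subseteq> carrier Z \<times> carrier UE" "t = scalar_coset p"
      using t by (rule SC_cases)
    have g: "(\<lambda>x. whit_map (x, w)) \<in> hom (add_monoid U) (add_monoid V)"
      using v by (auto intro!: homI simp: r whit_map_quot_elem central_elem_closed V.smult_l_distr)
    have g': "(\<lambda>x. whit_map (u, x)) \<in> hom (add_monoid Q) (add_monoid V)"
      using u v by (auto intro!: homI simp: carrier_Q quot_elem_add whit_map_quot_elem central_elem_closed
          V.smult_r_distr[symmetric] V.smult_l_distr[symmetric] central_elem_add)
    have "whit_map (right_act u t, w) = frag_eval V (\<lambda>(z, e). whit_map (u \<otimes>\<^bsub>U\<^esub> z \<otimes>\<^bsub>U\<^esub> e, w)) p"
      unfolding p(2) by (rule hom_right_act[OF u V.abelian_group_axioms g p(1)])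
    also have "\<dots> = frag_eval V (\<lambda>(z, e). whit_map (u, qc z \<otimes>\<^bsub>Q\<^esub> (qc (sc (\<eta> e)) \<otimes>\<^bsub>Q\<^esub> w))) p"
    proof (rule frag_eval_cong)
      fix s assume "s \<in> Poly_Mapping.keys p"
      then obtain a e where s: "s = (central_elem a, e)" "e \<in> carrier UE" using p(1) by (auto simp: carrier_Z)
      have eU: "e \<in> carrier U" using s(2) by (rule UE_subset)
      have "(u \<otimes>\<^bsub>U\<^esub> central_elem a \<otimes>\<^bsub>U\<^esub> e) \<odot>\<^bsub>V\<^esub> (central_elem r \<odot>\<^bsub>V\<^esub> v) = u \<odot>\<^bsub>V\<^esub> (central_elem a \<odot>\<^bsub>V\<^esub> ((e \<otimes>\<^bsub>U\<^esub> central_elem r) \<odot>\<^bsub>V\<^esub> v))"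
        using u v eU by (simp add: V.smult_assoc central_elem_closed)
      also have "e \<otimes>\<^bsub>U\<^esub> central_elem r = central_elem r \<otimes>\<^bsub>U\<^esub> e" using Z_commute[OF _ eU, of "central_elem r"] by simp
      also have "u \<odot>\<^bsub>V\<^esub> (central_elem a \<odot>\<^bsub>V\<^esub> ((central_elem r \<otimes>\<^bsub>U\<^esub> e) \<odot>\<^bsub>V\<^esub> v)) = u \<odot>\<^bsub>V\<^esub> (central_elem a \<odot>\<^bsub>V\<^esub> (central_elem r \<odot>\<^bsub>V\<^esub> (central_elem [:\<eta> e:] \<odot>\<^bsub>V\<^esub> v)))"
        using v eU s(2) by (simp add: V.smult_assoc central_elem_closed E_act sc_central_elem)
      also have "\<dots> = u \<odot>\<^bsub>V\<^esub> (central_elem (smult (\<eta> e) (a * r)) \<odot>\<^bsub>V\<^esub> v)"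
        using v by (simp add: V.smult_assoc[symmetric] central_elem_closed central_elem_mult)
      finally show "(case s of (z, e) \<Rightarrow> whit_map (u \<otimes>\<^bsub>U\<^esub> z \<otimes>\<^bsub>U\<^esub> e, w)) =
          (case s of (z, e) \<Rightarrow> whit_map (u, qc z \<otimes>\<^bsub>Q\<^esub> (qc (sc (\<eta> e)) \<otimes>\<^bsub>Q\<^esub> w)))"
        using u eU by (simp add: s r N_fun whit_map_quot_elem central_elem_closed)
      show "(case s of (z, e) \<Rightarrow> whit_map (u, qc z \<otimes>\<^bsub>Q\<^esub> (qc (sc (\<eta> e)) \<otimes>\<^bsub>Q\<^esub> w))) \<in> carrier V"
        using u v by (simp add: s r N_fun whit_map_quot_elem central_elem_closed)
    qed (rule V.abelian_group_axioms)
    also have "\<dots> = whit_map (u, t \<odot>\<^bsub>N\<^esub> w)"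
      unfolding p(2) by (rule hom_N[OF w V.abelian_group_axioms g' p(1), symmetric])
    finally show ?thesis .
  qed
qed

definition induced_to_V :: "(uq \<times> uq set \<Rightarrow>\<^sub>0 int) set \<Rightarrow> 'v" where "induced_to_V = tensor_lift V whit_map"

lemma induced_to_V_pure_tensor: "induced_to_V (pure_tensor x 1) = cl x \<odot>\<^bsub>V\<^esub> v"
proof -
  have "induced_to_V (pure_tensor x 1) = whit_map (cl x, quot_elem 1)"
    unfolding induced_to_V_def pure_tensor_def by (rule B.tensor_lift_frag[OF balanced_whit_map]) (simp_all add: N_simps)
  also have "\<dots> = cl x \<odot>\<^bsub>V\<^esub> v" using v by (simp add: whit_map_quot_elem central_elem_one[symmetric])
  finally show ?thesis .
qed

text \<open>
  The map \<open>u \<otimes> z \<mapsto> u z v\<close> is injective: if \<open>x v = 0\<close>, then \<open>x\<close> is a sum of terms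
  \<open>K\<^sup>b p\<^sub>b(\<Omega>)\<close> with \<open>p\<^sub>b(\<Omega>) \<in> Z\<^sub>*\<close> and of a multiple of \<open>E - h\<close>, and all of these kill
  \<open>1 \<otimes> 1\<close>.
\<close>

lemma induced_iso:
  assumes gen: "carrier V = {u \<odot>\<^bsub>V\<^esub> v | u. u \<in> carrier U}"
    and ann: "\<And>z. z \<in> ring_center U \<Longrightarrow> z \<odot>\<^bsub>V\<^esub> v = \<zero>\<^bsub>V\<^esub> \<Longrightarrow> z \<in> Zs"
  shows "module_isomorphic U V T"
proof -
  have add: "cl (x + y) \<odot>\<^bsub>V\<^esub> v = cl x \<odot>\<^bsub>V\<^esub> v \<oplus>\<^bsub>V\<^esub> cl y \<odot>\<^bsub>V\<^esub> v" for x y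
    using v V.smult_l_distr[of "cl x" "cl y" v] by (simp add: cl_add)
  have mult: "cl (x * y) \<odot>\<^bsub>V\<^esub> v = cl x \<odot>\<^bsub>V\<^esub> (cl y \<odot>\<^bsub>V\<^esub> v)" for x y
    using v V.smult_assoc[of "cl x" "cl y" v] by (simp add: cl_mult)
  \<comment> \<open>the annihilator of \<open>v\<close>, pulled back to the free algebra\<close>
  define K where "K = {x. cl x \<odot>\<^bsub>V\<^esub> v = \<zero>\<^bsub>V\<^esub>}"
  have zero: "cl 0 \<odot>\<^bsub>V\<^esub> v = \<zero>\<^bsub>V\<^esub>" using add[of 0 0] v by simp
  have K_pure_tensor: "pure_tensor x 1 = \<zero>\<^bsub>T\<^esub>" if x: "x \<in> K" for x
  proof -
    have "\<exists>D p d. finite D \<and> x \<doteq> (\<Sum>b\<in>D. K_pow b * casimir_poly (p b)) + d * EH \<and> (\<forall>b\<in>D. casimir_poly (p b) \<in> K)"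
    proof (rule whittaker_annihilator[OF h_nz _ _ _ _ x])
      show "I \<subseteq> K"
      proof
        fix y assume "y \<in> I"
        then have "cl y = cl 0" by (simp add: cl_eq_iff U_eq_0_iff)
        then show "y \<in> K" using zero by (simp add: K_def)
      qed
      have "cl EH \<odot>\<^bsub>V\<^esub> v \<oplus>\<^bsub>V\<^esub> sc h \<odot>\<^bsub>V\<^esub> v = sc h \<odot>\<^bsub>V\<^esub> v"
        using add[of EH "const h"] Ev by (simp add: E_cl sc_cl)
      then show "EH \<in> K" using v by (simp add: K_def sc_cl)
    qed (use v in \<open>auto simp: K_def add mult V_smult_zero\<close>)
    then obtain D p d where D: "finite D" "x \<doteq> (\<Sum>b\<in>D. K_pow b * casimir_poly (p b)) + d * EH" "\<forall>b\<in>D. casimir_poly (p b) \<in> K" by blast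
    have "pure_tensor (K_pow b * casimir_poly (p b)) 1 = \<zero>\<^bsub>T\<^esub>" if "b \<in> D" for b
    proof -
      have "central_elem (p b) \<in> Zs" using D(3) that by (intro ann) (simp_all add: center_U K_def central_elem_def)
      then show ?thesis by (simp add: pure_tensor_casimir_poly pure_tensor_Zs)
    qed
    then have "pure_tensor (\<Sum>b\<in>D. K_pow b * casimir_poly (p b)) 1 = \<zero>\<^bsub>T\<^esub>" by (rule pure_tensor_sum)
    then show ?thesis using pure_tensor_cong[OF D(2)] by (simp add: pure_tensor_add pure_tensor_EH)
  qed
  have inj: "inj_on induced_to_V (carrier T)"
  proof (rule inj_onI)
    fix s t assume s: "s \<in> carrier T" and t: "t \<in> carrier T" and eq: "induced_to_V s = induced_to_V t"
    obtain x where x: "s = pure_tensor x 1" using T_cases[OF s] .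
    obtain y where y: "t = pure_tensor y 1" using T_cases[OF t] .
    have "cl (x - y) \<odot>\<^bsub>V\<^esub> v \<oplus>\<^bsub>V\<^esub> cl y \<odot>\<^bsub>V\<^esub> v = cl y \<odot>\<^bsub>V\<^esub> v"
      using add[of "x - y" y] eq by (simp add: x y induced_to_V_pure_tensor)
    then have "x - y \<in> K" using v by (simp add: K_def)
    then show "s = t" using K_pure_tensor pure_tensor_diff x y by blast
  qed
  have img: "induced_to_V ` carrier T = carrier V"
  proof (intro equalityI subsetI)
    fix w assume "w \<in> induced_to_V ` carrier T"
    then obtain t where t: "t \<in> carrier T" "w = induced_to_V t" by blast
    obtain x where "t = pure_tensor x 1" using T_cases[OF t(1)] .
    then have "w = cl x \<odot>\<^bsub>V\<^esub> v" by (simp add: t induced_to_V_pure_tensor)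
    then show "w \<in> carrier V" using v by simp
  next
    fix w assume "w \<in> carrier V"
    then obtain x where "w = cl x \<odot>\<^bsub>V\<^esub> v" by (auto simp: gen carrier_U)
    then show "w \<in> induced_to_V ` carrier T" using induced_to_V_pure_tensor[of x] pure_tensor_closed by (metis image_eqI)
  qed
  let ?\<phi> = "inv_into (carrier T) induced_to_V"
  have bij: "bij_betw ?\<phi> (carrier V) (carrier T)"
    using bij_betw_inv_into[of induced_to_V "carrier T" "carrier V"] inj img by (simp add: bij_betw_def)
  have \<phi>: "?\<phi> (cl x \<odot>\<^bsub>V\<^esub> v) = pure_tensor x 1" for x
    using inv_into_f_f[OF inj, of "pure_tensor x 1"] by (simp add: induced_to_V_pure_tensor)
  show ?thesis unfolding module_isomorphic_def
  proof (intro exI conjI ballI)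
    show "bij_betw ?\<phi> (carrier V) (carrier T)" by (rule bij)
    fix w assume "w \<in> carrier V"
    then obtain x where x: "w = cl x \<odot>\<^bsub>V\<^esub> v" by (auto simp: gen carrier_U)
    show "?\<phi> (w \<oplus>\<^bsub>V\<^esub> w') = ?\<phi> w \<oplus>\<^bsub>T\<^esub> ?\<phi> w'" if w': "w' \<in> carrier V" for w'
    proof -
      obtain y where "w' = cl y \<odot>\<^bsub>V\<^esub> v" using w' by (auto simp: gen carrier_U)
      then show ?thesis by (simp add: x \<phi> add[symmetric] pure_tensor_add)
    qed
    show "?\<phi> (u \<odot>\<^bsub>V\<^esub> w) = u \<odot>\<^bsub>T\<^esub> ?\<phi> w" if u: "u \<in> carrier U" for u
    proof -
      obtain y where "u = cl y" using u by (auto simp: carrier_U)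
      then show ?thesis by (simp add: x \<phi> mult[symmetric] pure_tensor_smult)
    qed
  qed
qed

end

section \<open>Modules isomorphic to an induced module\<close>

text \<open>
  Annihilators and cyclic Whittaker vectors are transported along the isomorphism.
\<close>

lemma iso_annihilator:
  assumes iso: "module_isomorphic U V T"
  shows "central_annihilator q m V = Zs"
    and "Zs \<noteq> carrier Z \<Longrightarrow> whittaker_module q m \<eta> V"
proof -
  obtain \<phi> where bij: "bij_betw \<phi> (carrier V) (carrier T)"
    and add: "\<And>x y. x \<in> carrier V \<Longrightarrow> y \<in> carrier V \<Longrightarrow> \<phi> (x \<oplus>\<^bsub>V\<^esub> y) = \<phi> x \<oplus>\<^bsub>T\<^esub> \<phi> y"
    and smult: "\<And>r x. r \<in> carrier U \<Longrightarrow> x \<in> carrier V \<Longrightarrow> \<phi> (r \<odot>\<^bsub>V\<^esub> x) = r \<odot>\<^bsub>T\<^esub> \<phi> x"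
    using iso unfolding module_isomorphic_def by blast
  have inj: "inj_on \<phi> (carrier V)" and img: "\<phi> ` carrier V = carrier T"
    using bij by (simp_all add: bij_betw_def)
  have cl: "\<phi> x \<in> carrier T" if "x \<in> carrier V" for x using img that by blast
  have zero: "\<phi> \<zero>\<^bsub>V\<^esub> = \<zero>\<^bsub>T\<^esub>"
    using add[of "\<zero>\<^bsub>V\<^esub>" "\<zero>\<^bsub>V\<^esub>"] cl[of "\<zero>\<^bsub>V\<^esub>"] by simp
  have zero_iff: "\<phi> x = \<zero>\<^bsub>T\<^esub> \<longleftrightarrow> x = \<zero>\<^bsub>V\<^esub>" if "x \<in> carrier V" for x
    using inj_on_eq_iff[OF inj that, of "\<zero>\<^bsub>V\<^esub>"] zero by simp
  have "(\<forall>x\<in>carrier V. z \<odot>\<^bsub>V\<^esub> x = \<zero>\<^bsub>V\<^esub>) \<longleftrightarrow> (\<forall>t\<in>carrier T. z \<odot>\<^bsub>T\<^esub> t = \<zero>\<^bsub>T\<^esub>)" if z: "z \<in> carrier U" for z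
    unfolding img[symmetric] using z by (auto simp: smult[symmetric] zero_iff)
  then have "central_annihilator q m V = central_annihilator q m T"
    unfolding central_annihilator_def by (auto simp: ring_center_def)
  then show "central_annihilator q m V = Zs" by (simp add: T_annihilator)
  show "whittaker_module q m \<eta> V" if proper: "Zs \<noteq> carrier Z"
  proof -
    obtain v where v: "v \<in> carrier V" "\<phi> v = pure_tensor 1 1" using img pure_tensor_closed by (metis imageE)
    have E: "uq_E q m \<in> carrier U" "sc c \<in> carrier U" for c by (simp_all add: E_cl sc_cl)
    have "whittaker_vector q m \<eta> V v"
      unfolding whittaker_vector_def
    proof (intro conjI)
      show "v \<in> carrier V" by (rule v)
      show "v \<noteq> \<zero>\<^bsub>V\<^esub>" using T_whittaker(1)[OF proper] zero v by (auto simp: whittaker_vector_def)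
      have "\<phi> (uq_E q m \<odot>\<^bsub>V\<^esub> v) = \<phi> (sc h \<odot>\<^bsub>V\<^esub> v)"
        using T_whittaker(1)[OF proper] v by (simp add: smult E whittaker_vector_def)
      then show "uq_E q m \<odot>\<^bsub>V\<^esub> v = sc h \<odot>\<^bsub>V\<^esub> v"
        using inj_onD[OF inj] v E by blast
    qed
    moreover have "carrier V = {u \<odot>\<^bsub>V\<^esub> v | u. u \<in> carrier U}"
    proof (intro equalityI subsetI)
      fix x assume x: "x \<in> carrier V"
      then obtain u where u: "u \<in> carrier U" "\<phi> x = u \<odot>\<^bsub>T\<^esub> \<phi> v"
        using cl[OF x] v unfolding T_whittaker(2)[OF proper] by auto
      then have "\<phi> x = \<phi> (u \<odot>\<^bsub>V\<^esub> v)" using v by (simp add: smult)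
      then have "x = u \<odot>\<^bsub>V\<^esub> v" using inj_onD[OF inj] x u v by blast
      then show "x \<in> {u \<odot>\<^bsub>V\<^esub> v | u. u \<in> carrier U}" using u by blast
    qed (use v in auto)
    ultimately show ?thesis unfolding whittaker_module_def by blast
  qed
qed

end

end

context uq_character
begin

text \<open>
  For a cyclic module, a central element that kills the generator kills the whole module; so
  \<open>Z\<^sub>V\<close> is the annihilator of \<open>v\<close> in the centre.
\<close>

lemma whittaker_iso:
  fixes V :: "(uq, 'v) module"
  assumes V: "left_module U V" and W: "whittaker_module q m \<eta> V"
  defines "Zs \<equiv> central_annihilator q m V"
  shows "ideal Zs Z \<and> Zs \<noteq> carrier Z \<and> module_isomorphic U V (induced_module q m \<eta> Zs)"
proof -
  interpret V: left_module U V by (rule V)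
  interpret Z: ring Z by (rule Z_ring)
  obtain v where v: "whittaker_vector q m \<eta> V v" and gen: "carrier V = {u \<odot>\<^bsub>V\<^esub> v | u. u \<in> carrier U}"
    using W unfolding whittaker_module_def by blast
  have v': "v \<in> carrier V" "v \<noteq> \<zero>\<^bsub>V\<^esub>" "uq_E q m \<odot>\<^bsub>V\<^esub> v = sc h \<odot>\<^bsub>V\<^esub> v"
    using v by (simp_all add: whittaker_vector_def)
  have sz: "u \<odot>\<^bsub>V\<^esub> \<zero>\<^bsub>V\<^esub> = \<zero>\<^bsub>V\<^esub>" if "u \<in> carrier U" for u
    using V.smult_r_distr[of u "\<zero>\<^bsub>V\<^esub>" "\<zero>\<^bsub>V\<^esub>"] that by simp
  have Zs: "z \<in> Zs \<longleftrightarrow> z \<in> carrier Z \<and> z \<odot>\<^bsub>V\<^esub> v = \<zero>\<^bsub>V\<^esub>" for z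
  proof
    assume z: "z \<in> carrier Z \<and> z \<odot>\<^bsub>V\<^esub> v = \<zero>\<^bsub>V\<^esub>"
    have "z \<odot>\<^bsub>V\<^esub> w = \<zero>\<^bsub>V\<^esub>" if w: "w \<in> carrier V" for w
    proof -
      obtain u where u: "u \<in> carrier U" "w = u \<odot>\<^bsub>V\<^esub> v" using w unfolding gen by blast
      have zU: "z \<in> carrier U" using z Z_subset by blast
      have "z \<odot>\<^bsub>V\<^esub> w = (z \<otimes>\<^bsub>U\<^esub> u) \<odot>\<^bsub>V\<^esub> v" using zU u v'(1) by (simp add: V.smult_assoc)
      also have "z \<otimes>\<^bsub>U\<^esub> u = u \<otimes>\<^bsub>U\<^esub> z" using Z_commute z u by blast
      also have "\<dots> \<odot>\<^bsub>V\<^esub> v = \<zero>\<^bsub>V\<^esub>" using zU u v'(1) z by (simp add: V.smult_assoc sz)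
      finally show ?thesis .
    qed
    then show "z \<in> Zs" using z by (simp add: Zs_def central_annihilator_def carrier_Z center_U)
  qed (auto simp: Zs_def central_annihilator_def carrier_Z center_U v'(1))
  have act_zero: "central_elem 0 \<odot>\<^bsub>V\<^esub> v = \<zero>\<^bsub>V\<^esub>"
    using V.smult_l_distr[of "central_elem 0" "central_elem 0" v] v'(1) by (simp add: central_elem_closed central_elem_add)
  have ideal: "ideal Zs Z"
  proof (rule idealI)
    show "ring Z" by (rule Z_ring)
    show "subgroup Zs (add_monoid Z)"
    proof (rule group.subgroupI)
      show "group (add_monoid Z)" by (rule Z.a_group)
      show "Zs \<subseteq> carrier (add_monoid Z)" by (auto simp: Zs)
      show "Zs \<noteq> {}" using Zs[of "central_elem 0"] act_zero by (auto simp: carrier_Z)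
    next
      fix a b assume a: "a \<in> Zs" and b: "b \<in> Zs"
      then show "a \<otimes>\<^bsub>add_monoid Z\<^esub> b \<in> Zs"
        using Z.a_closed[of a b] v'(1) by (simp add: Zs V.smult_l_distr Z_subset)
    next
      fix a assume a: "a \<in> Zs"
      then obtain p where p: "a = central_elem p" by (auto simp: Zs carrier_Z)
      have "central_elem p \<odot>\<^bsub>V\<^esub> v = \<zero>\<^bsub>V\<^esub>" using a by (simp add: Zs p)
      moreover have "central_elem 0 \<odot>\<^bsub>V\<^esub> v = central_elem p \<odot>\<^bsub>V\<^esub> v \<oplus>\<^bsub>V\<^esub> central_elem (- p) \<odot>\<^bsub>V\<^esub> v"
        using V.smult_l_distr[of "central_elem p" "central_elem (- p)" v] v'(1) by (simp add: central_elem_closed central_elem_add)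
      ultimately have "central_elem (- p) \<odot>\<^bsub>V\<^esub> v = \<zero>\<^bsub>V\<^esub>"
        using v'(1) by (simp add: act_zero central_elem_closed)
      then show "inv\<^bsub>add_monoid Z\<^esub> a \<in> Zs"
        using Z_minus[of p] by (simp add: Zs p a_inv_def carrier_Z)
    qed
  next
    fix a x assume a: "a \<in> Zs" and x: "x \<in> carrier Z"
    have *: "x \<otimes>\<^bsub>U\<^esub> a \<in> Zs"
      using a x Z.m_closed[of x a] v'(1) by (simp add: Zs V.smult_assoc Z_subset sz)
    then show "x \<otimes>\<^bsub>Z\<^esub> a \<in> Zs" by simp
    have "a \<otimes>\<^bsub>U\<^esub> x = x \<otimes>\<^bsub>U\<^esub> a" using a x by (intro Z_commute Z_subset) (simp_all add: Zs)
    then show "a \<otimes>\<^bsub>Z\<^esub> x \<in> Zs" using * by simp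
  qed
  interpret W: uq_quotient q m \<eta> Zs
    by (intro uq_quotient.intro uq_character_axioms uq_quotient_axioms.intro ideal)
  have proper: "Zs \<noteq> carrier Z"
  proof
    assume "Zs = carrier Z"
    with Z.one_closed have "\<one>\<^bsub>Z\<^esub> \<in> Zs" by (simp only:)
    then show False using v'(1,2) by (simp add: Zs)
  qed
  have "module_isomorphic U V W.T"
    by (rule W.induced_iso[OF V v'(1,3) _ gen]) (auto simp: Zs carrier_Z center_U)
  then show ?thesis using ideal proper by blast
qed

end

theorem theorem3p4:
  fixes q :: complex and m :: nat and \<eta> :: "uq \<Rightarrow> complex" and V :: "(uq, 'v) module"
  assumes "q \<noteq> 0" and "q^2 \<noteq> 1" and "\<forall>n>0. q ^ n \<noteq> 1"
    and "nonsingular_character q m \<eta>"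
    and "left_module (Uq q m) V"
  shows "(whittaker_module q m \<eta> V \<longleftrightarrow>
           (\<exists>Zs. ideal Zs (ZU q m) \<and> Zs \<noteq> carrier (ZU q m) \<and>
                 module_isomorphic (Uq q m) V (induced_module q m \<eta> Zs))) \<and>
         (\<forall>Zs. ideal Zs (ZU q m) \<and>
                 module_isomorphic (Uq q m) V (induced_module q m \<eta> Zs) \<longrightarrow>
               Zs = central_annihilator q m V)"
proof -
  interpret uq_character q m \<eta>
    using assms(1-4) by unfold_locales
  have quot: "uq_quotient q m \<eta> Zs" if "ideal Zs (ZU q m)" for Zs
    using that by (intro uq_quotient.intro uq_character_axioms uq_quotient_axioms.intro)
  show ?thesis
    using whittaker_iso[OF assms(5)] uq_quotient.iso_annihilator[OF quot assms(5)] by blast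
qed

end
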